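(* Let $h:\mathbb{R}^m\to\mathbb{R}$ be a bounded kernel satisfying the extended variation condition. Let $(X_n)_{n\in\mathbb{N}}$ be a stationary, strongly mixing sequence of real random variables with $\mathbb{E}|X_1|^{\rho}<\infty$ for some $\rho>0$ and mixing coefficients $\alpha(l)=O(l^{-\delta})$ for some $\delta>\frac{2\rho+1}{\rho}$. Then $$\sqrt n\,(U_n-\theta)\xrightarrow{\ \mathcal{D}\ }N(0,m^2\sigma^2)$$ with $$\sigma^2=\operatorname{Var}(g_1(X_1))+2\sum_{j=1}^\infty\operatorname{Cov}(g_1(X_1),g_1(X_{1+j})).$$ If $\sigma=0$, the statement means convergence to $0$ in probability.
   Context: A kernel is a measurable function $h:\mathbb{R}^m\to\mathbb{R}$ that is symmetric in its arguments ($m\ge2$ given). For a stationary process $(X_n)_{n\in\mathbb{N}}$ the strong mixing coefficients are $$\alpha(k)=\sup_{n\in\mathbb{N}}\sup\{|\mathbb{P}(A\cap B)-\mathbb{P}(A)\mathbb{P}(B)|: A\in\mathcal{F}_1^n,\ B\in\mathcal{F}_{n+k}^\infty\},$$ where $\mathcal{F}_a^b$ is the $\sigma$-field generated by $X_a,\ldots,X_b$; the process is strongly mixing if $\alpha(k)\to0$ as $k\to\infty$. Let $(Y_n)$ be independent copies of $X_1$ (independent of each other and of $(X_n)$). Define $$U_n=\frac{1}{\binom nm}\sum_{1\le i_1<\ldots<i_m\le n}h(X_{i_1},\ldots,X_{i_m}),\qquad \theta=\mathbb{E}(h(Y_1,\ldots,Y_m)),\qquad g_1(x)=\mathbb{E}(h(x,Y_2,\ldots,Y_m))-\theta.$$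 Variation condition: there are constants $L$ and $\epsilon_0>0$ such that for all $\epsilon\in(0,\epsilon_0)$ $$\mathbb{E}\Big(\sup_{\|(x_1,\ldots,x_m)-(X_1',\ldots,X_m')\|\le\epsilon}|h(x_1,\ldots,x_m)-h(X_1',\ldots,X_m')|\Big)\le L\epsilon,$$ where the $X_i'$ are independent with the same distribution as $X_i$ and $\|\cdot\|$ is the Euclidean norm. Extended variation condition: the variation condition holds and additionally there are constants $L'>0$, $\delta_0>0$ such that for all $\delta\in(0,\delta_0)$, all $2\le k\le m$ and all $i_1<i_2<\ldots<i_m$ $$\mathbb{E}\Big(\sup_{|x_{i_1}-Y_{i_1}|\le\delta}\big|h(x_{i_1},X_{i_2},\ldots,X_{i_k},Y_{i_{k+1}},\ldots,Y_{i_m})-h(Y_{i_1},X_{i_2},\ldots,X_{i_k},Y_{i_{k+1}},\ldots,Y_{i_m})\big|\Big)\le L'\delta.$$ *)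

theory Defs
  imports "HOL-Probability.Probability" "HOL-Library.Landau_Symbols"
begin

text \<open>
  Points of the \<open>m\<close>-dimensional real space are functions \<open>nat \<Rightarrow> real\<close> that are extensional on
  \<open>{1..m}\<close>, so that its Borel sigma-algebra is the product sigma-algebra below.  Processes are indexed
  by \<open>1, 2, \<dots>\<close>; the value of a process at index \<open>0\<close> is never used.
\<close>

abbreviation borel_vec :: "nat \<Rightarrow> (nat \<Rightarrow> real) measure" where
  "borel_vec m \<equiv> Pi\<^sub>M {1..m} (\<lambda>_. borel)"

definition symmetric_kernel :: "nat \<Rightarrow> ((nat \<Rightarrow> real) \<Rightarrow> real) \<Rightarrow> bool" where
  "symmetric_kernel m h \<longleftrightarrow>
     h \<in> borel_measurable (borel_vec m) \<and>
     (\<forall>p. p permutes {1..m} \<longrightarrow> (\<forall>x\<in>space (borel_vec m). h (x \<circ> p) = h x))"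

definition bounded_kernel :: "nat \<Rightarrow> ((nat \<Rightarrow> real) \<Rightarrow> real) \<Rightarrow> bool" where
  "bounded_kernel m h \<longleftrightarrow> bounded (h ` space (borel_vec m))"

definition path :: "(nat \<Rightarrow> 'a \<Rightarrow> real) \<Rightarrow> 'a \<Rightarrow> nat \<Rightarrow> real" where
  "path X \<omega> = (\<lambda>i\<in>{1..}. X i \<omega>)"

definition stationary :: "'a measure \<Rightarrow> (nat \<Rightarrow> 'a \<Rightarrow> real) \<Rightarrow> bool" where
  "stationary M X \<longleftrightarrow>
     (\<forall>n\<ge>1. X n \<in> borel_measurable M) \<and>
     (\<forall>k. distr M (Pi\<^sub>M {1..} (\<lambda>_. borel)) (path (\<lambda>i. X (i + k)))
        = distr M (Pi\<^sub>M {1..} (\<lambda>_. borel)) (path X))"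

definition iid_copies :: "'a measure \<Rightarrow> (nat \<Rightarrow> 'a \<Rightarrow> real) \<Rightarrow> (nat \<Rightarrow> 'a \<Rightarrow> real) \<Rightarrow> bool" where
  "iid_copies M X Y \<longleftrightarrow>
     prob_space.indep_vars M (\<lambda>_. borel) Y {1..} \<and>
     (\<forall>n\<ge>1. distr M borel (Y n) = distr M borel (X 1)) \<and>
     prob_space.indep_var M
       (Pi\<^sub>M {1..} (\<lambda>_. borel)) (path X) (Pi\<^sub>M {1..} (\<lambda>_. borel)) (path Y)"

definition gen_field :: "'a measure \<Rightarrow> (nat \<Rightarrow> 'a \<Rightarrow> real) \<Rightarrow> nat set \<Rightarrow> 'a set set" where
  "gen_field M X I =
     sigma_sets (space M) (\<Union>i\<in>I. {X i -` S \<inter> space M | S. S \<in> sets borel})"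

definition mixing_coeff :: "'a measure \<Rightarrow> (nat \<Rightarrow> 'a \<Rightarrow> real) \<Rightarrow> nat \<Rightarrow> real" where
  "mixing_coeff M X k =
     (SUP n\<in>{1..}. SUP (A, B) \<in> gen_field M X {1..n} \<times> gen_field M X {n + k..}.
        \<bar>measure M (A \<inter> B) - measure M A * measure M B\<bar>)"

definition strongly_mixing :: "'a measure \<Rightarrow> (nat \<Rightarrow> 'a \<Rightarrow> real) \<Rightarrow> bool" where
  "strongly_mixing M X \<longleftrightarrow> mixing_coeff M X \<longlonglongrightarrow> 0"

text \<open>
  The supremum over an uncountable ball need not be Borel measurable in \<open>\<omega>\<close>, but it is the
  composition of a random vector with a universally measurable function.  The library's
  nonnegative integral of such a function is its integral with respect to the completed measure
  (see \<^term>\<open>nn_integral (completion M)\<close> and \<open>nn_integral_completion\<close>), so it is the expectation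
  meant here; the Bochner integral would be \<open>0\<close> in the non-measurable case.  The supremum is taken
  in \<^typ>\<open>ennreal\<close> and may be infinite.
\<close>

definition variation_condition ::
    "'a measure \<Rightarrow> (nat \<Rightarrow> 'a \<Rightarrow> real) \<Rightarrow> nat \<Rightarrow> ((nat \<Rightarrow> real) \<Rightarrow> real) \<Rightarrow> bool" where
  "variation_condition M X' m h \<longleftrightarrow>
     (\<exists>L \<epsilon>0. \<epsilon>0 > 0 \<and> (\<forall>\<epsilon>. 0 < \<epsilon> \<and> \<epsilon> < \<epsilon>0 \<longrightarrow>
        (\<integral>\<^sup>+\<omega>. (SUP x\<in>{x \<in> space (borel_vec m). L2_set (\<lambda>j. x j - X' j \<omega>) {1..m} \<le> \<epsilon>}.
                 ennreal \<bar>h x - h (\<lambda>j\<in>{1..m}. X' j \<omega>)\<bar>) \<partial>M) \<le> ennreal (L * \<epsilon>)))"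

definition mixed_arg :: "nat \<Rightarrow> nat \<Rightarrow> (nat \<Rightarrow> nat) \<Rightarrow> (nat \<Rightarrow> 'a \<Rightarrow> real) \<Rightarrow> (nat \<Rightarrow> 'a \<Rightarrow> real) \<Rightarrow>
    'a \<Rightarrow> real \<Rightarrow> (nat \<Rightarrow> real)" where
  "mixed_arg m k i X Y \<omega> x =
     (\<lambda>j\<in>{1..m}. if j = 1 then x else if j \<le> k then X (i j) \<omega> else Y (i j) \<omega>)"

definition extended_variation_condition ::
    "'a measure \<Rightarrow> (nat \<Rightarrow> 'a \<Rightarrow> real) \<Rightarrow> (nat \<Rightarrow> 'a \<Rightarrow> real) \<Rightarrow> nat \<Rightarrow>
      ((nat \<Rightarrow> real) \<Rightarrow> real) \<Rightarrow> bool" where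
  "extended_variation_condition M X Y m h \<longleftrightarrow>
     variation_condition M Y m h \<and>
     (\<exists>L' \<delta>0. L' > 0 \<and> \<delta>0 > 0 \<and> (\<forall>\<delta> k i.
        0 < \<delta> \<and> \<delta> < \<delta>0 \<and> 2 \<le> k \<and> k \<le> m \<and> i ` {1..m} \<subseteq> {1..} \<and> strict_mono_on {1..m} i \<longrightarrow>
        (\<integral>\<^sup>+\<omega>. (SUP x\<in>{x. \<bar>x - Y (i 1) \<omega>\<bar> \<le> \<delta>}.
                 ennreal \<bar>h (mixed_arg m k i X Y \<omega> x)
                          - h (mixed_arg m k i X Y \<omega> (Y (i 1) \<omega>))\<bar>) \<partial>M) \<le> ennreal (L' * \<delta>)))"

definition U_stat :: "nat \<Rightarrow> ((nat \<Rightarrow> real) \<Rightarrow> real) \<Rightarrow> (nat \<Rightarrow> 'a \<Rightarrow> real) \<Rightarrow> nat \<Rightarrow> 'a \<Rightarrow> real" where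
  "U_stat m h X n \<omega> =
     1 / real (n choose m) *
     (\<Sum>i\<in>{i \<in> {1..m} \<rightarrow>\<^sub>E {1..n}. strict_mono_on {1..m} i}. h (\<lambda>j\<in>{1..m}. X (i j) \<omega>))"

definition theta :: "'a measure \<Rightarrow> nat \<Rightarrow> ((nat \<Rightarrow> real) \<Rightarrow> real) \<Rightarrow> (nat \<Rightarrow> 'a \<Rightarrow> real) \<Rightarrow> real" where
  "theta M m h Y = (\<integral>\<omega>. h (\<lambda>j\<in>{1..m}. Y j \<omega>) \<partial>M)"

definition g1 ::
    "'a measure \<Rightarrow> nat \<Rightarrow> ((nat \<Rightarrow> real) \<Rightarrow> real) \<Rightarrow> (nat \<Rightarrow> 'a \<Rightarrow> real) \<Rightarrow> real \<Rightarrow> real" where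
  "g1 M m h Y x = (\<integral>\<omega>. h (\<lambda>j\<in>{1..m}. if j = 1 then x else Y j \<omega>) \<partial>M) - theta M m h Y"

definition covar :: "'a measure \<Rightarrow> ('a \<Rightarrow> real) \<Rightarrow> ('a \<Rightarrow> real) \<Rightarrow> real" where
  "covar M V W = (\<integral>\<omega>. (V \<omega> - (\<integral>\<omega>'. V \<omega>' \<partial>M)) * (W \<omega> - (\<integral>\<omega>'. W \<omega>' \<partial>M)) \<partial>M)"

definition var :: "'a measure \<Rightarrow> ('a \<Rightarrow> real) \<Rightarrow> real" where
  "var M V = (\<integral>\<omega>. (V \<omega> - (\<integral>\<omega>'. V \<omega>' \<partial>M))\<^sup>2 \<partial>M)"

text \<open>The covariances at lags \<open>1, 2, \<dots>\<close>; lag \<open>j + 1\<close> is at index \<open>j\<close>.\<close>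

definition g1_cov ::
    "'a measure \<Rightarrow> nat \<Rightarrow> ((nat \<Rightarrow> real) \<Rightarrow> real) \<Rightarrow> (nat \<Rightarrow> 'a \<Rightarrow> real) \<Rightarrow> (nat \<Rightarrow> 'a \<Rightarrow> real) \<Rightarrow>
      nat \<Rightarrow> real" where
  "g1_cov M m h X Y j =
     covar M (\<lambda>\<omega>. g1 M m h Y (X 1 \<omega>)) (\<lambda>\<omega>. g1 M m h Y (X (1 + Suc j) \<omega>))"

definition asymp_var ::
    "'a measure \<Rightarrow> nat \<Rightarrow> ((nat \<Rightarrow> real) \<Rightarrow> real) \<Rightarrow> (nat \<Rightarrow> 'a \<Rightarrow> real) \<Rightarrow> (nat \<Rightarrow> 'a \<Rightarrow> real) \<Rightarrow>
      real" where
  "asymp_var M m h X Y =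
     var M (\<lambda>\<omega>. g1 M m h Y (X 1 \<omega>)) + 2 * (\<Sum>j. g1_cov M m h X Y j)"

definition tendsto_zero_in_prob :: "'a measure \<Rightarrow> (nat \<Rightarrow> 'a \<Rightarrow> real) \<Rightarrow> bool" where
  "tendsto_zero_in_prob M Z \<longleftrightarrow>
     (\<forall>\<epsilon>>0. (\<lambda>n. measure M {\<omega> \<in> space M. \<bar>Z n \<omega>\<bar> > \<epsilon>}) \<longlonglongrightarrow> 0)"

text \<open>
  Convergence in distribution to the centred normal law of variance \<open>v\<close> (note that
  \<^const>\<open>normal_density\<close> takes the standard deviation), which for \<open>v = 0\<close> means convergence to
  \<open>0\<close> in probability.
\<close>

definition converges_to_normal :: "'a measure \<Rightarrow> (nat \<Rightarrow> 'a \<Rightarrow> real) \<Rightarrow> real \<Rightarrow> bool" where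
  "converges_to_normal M Z v \<longleftrightarrow>
     (if v = 0 then tendsto_zero_in_prob M Z
      else v > 0 \<and> weak_conv_m (\<lambda>n. distr M borel (Z n)) (density lborel (normal_density 0 (sqrt v))))"

end

theory Submission
  imports Defs "HOL-Real_Asymp.Real_Asymp"
begin

text \<open>
  Write \<open>H x = h x - \<theta> - (\<Sum>c. g1 (x c))\<close> for the kernel without its constant and linear parts.
  Summing over increasing tuples, \<open>sqrt n * (U n - \<theta>)\<close> is
  \<open>m / sqrt n * (\<Sum>t\<le>n. g1 (X t))\<close> plus a normalised sum of the \<open>H (X (i 1), \<dots>, X (i m))\<close>
  (\<open>hoeffding_decomposition\<close>).  The first part is asymptotically normal, because \<open>g1 (X t)\<close> is a
  bounded, centred, stationary sequence with quickly decaying mixing coefficients: long blocks of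
  summands separated by shorter gaps are nearly independent, each block has a Taylor expansion of its
  characteristic function, and the gaps carry little variance (\<open>clt_characteristic\<close>).  The second part
  tends to \<open>0\<close> in mean square (\<open>remainder_second_moment\<close>), so it changes neither characteristic
  functions nor, if the variance is \<open>0\<close>, limits in probability.

  For the second part one needs \<open>E (\<Sum>i. H (X i))\<^sup>2 = o(n ^ (2 * m - 1))\<close>, the sum over increasing
  tuples.  Expanding the square gives expectations \<open>E (H (X i) * H (X j))\<close> with up to \<open>2 * m\<close>
  different times.  \<open>H\<close> is an alternating sum of projections of \<open>h\<close>, each of which integrates out
  some of the arguments against independent copies; so \<open>E (H (X i) * H (X j))\<close> is a double alternating
  sum of moments \<open>partial_moment v S\<close>, where \<open>S\<close> is the set of coordinates that still carry values of
  the process.  If every \<open>S\<close> is intersected with one fixed pair of coordinates, the alternating sum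
  vanishes, since one of the two factors is then left with at most one coordinate
  (\<open>alternating_alternating_pair_vanishes\<close>).  To get there, coordinates are removed from \<open>S\<close> one by
  one, always the earliest or the latest one, because strong mixing only compares a past with a
  future; removing a coordinate at distance \<open>l\<close> from the others costs \<open>O((l + 1) powr -\<kappa>)\<close> with
  \<open>\<kappa> = \<delta> * \<rho> / (2 * \<rho> + 1) > 1\<close> (\<open>remove_extreme_coordinate\<close>).  Choosing the end with the larger gap,
  the cost is at most the product of the weights \<open>(l + 1) powr (-\<kappa>/2)\<close> of two gaps between different
  pairs of coordinates (\<open>reduction_to_pairs\<close>), and the sum of such products over all tuples is
  \<open>n ^ (2 * m - 2)\<close> times the square of \<open>\<Sum>l<n. (l + 1) powr (-\<kappa>/2) = o(sqrt n)\<close>.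

  The cost of one replacement (\<open>replacement_error\<close>) comes from a discretisation.  The
  range \<open>[-T, T]\<close> of the coordinate \<open>U\<close> is cut into \<open>n\<close> cells of length \<open>d\<close>.  A value drawn afresh
  from the cell of \<open>U\<close> is nearly independent of the other variables \<open>W\<close>, with an error of the order of
  \<open>n\<close> mixing coefficients, and it is within \<open>d\<close> of \<open>U\<close>, so that the change in the kernel is
  controlled by the variation condition.  The total error is of the order \<open>n * \<alpha> l + d + P(\<bar>U\<bar> \<ge> T)\<close>
  with \<open>n\<close> about \<open>2 * T / d\<close>, and \<open>d = l powr -\<kappa>\<close>, \<open>T = l powr (\<kappa> / \<rho>)\<close> balance the three
  terms.  The suprema in the variation condition need not be measurable, and the integral of
  a non-measurable function only bounds the measurable functions below it; a compactness argument
  provides measurable minorants that are large enough (\<open>measurable_minorant_of_sup\<close>).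
\<close>

section \<open>Mixing coefficients and covariances\<close>

text \<open>
  A bound on the strong mixing coefficient between the sigma-algebras generated by \<open>f\<close> and \<open>g\<close>,
  stated for random elements so that it passes to functions of them.  The bound \<open>0\<close> means
  independence.
\<close>
definition alpha_bound ::
    "'a measure \<Rightarrow> 'b measure \<Rightarrow> ('a \<Rightarrow> 'b) \<Rightarrow> 'c measure \<Rightarrow> ('a \<Rightarrow> 'c) \<Rightarrow> real \<Rightarrow> bool" where
  "alpha_bound M N f N' g c \<longleftrightarrow> f \<in> M \<rightarrow>\<^sub>M N \<and> g \<in> M \<rightarrow>\<^sub>M N' \<and>
     (\<forall>A\<in>sets N. \<forall>B\<in>sets N'.
        \<bar>measure M ((f -` A \<inter> space M) \<inter> (g -` B \<inter> space M))
          - measure M (f -` A \<inter> space M) * measure M (g -` B \<inter> space M)\<bar> \<le> c)"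

lemma alpha_bound_compose:
  assumes "alpha_bound M N f N' g c" "\<phi> \<in> N \<rightarrow>\<^sub>M K" "\<psi> \<in> N' \<rightarrow>\<^sub>M K'"
  shows "alpha_bound M K (\<lambda>x. \<phi> (f x)) K' (\<lambda>x. \<psi> (g x)) c"
proof -
  have f: "f \<in> M \<rightarrow>\<^sub>M N" and g: "g \<in> M \<rightarrow>\<^sub>M N'"
    using assms by (auto simp: alpha_bound_def)
  have "(\<lambda>x. \<phi> (f x)) -` A \<inter> space M = f -` (\<phi> -` A \<inter> space N) \<inter> space M" for A
    using measurable_space[OF f] by auto
  moreover have "(\<lambda>x. \<psi> (g x)) -` B \<inter> space M = g -` (\<psi> -` B \<inter> space N') \<inter> space M" for B
    using measurable_space[OF g] by auto
  ultimately have eq: "(\<lambda>x. \<phi> (f x)) -` A \<inter> space M = f -` (\<phi> -` A \<inter> space N) \<inter> space M"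
    "(\<lambda>x. \<psi> (g x)) -` B \<inter> space M = g -` (\<psi> -` B \<inter> space N') \<inter> space M" for A B
    by blast+
  have "\<forall>A\<in>sets N. \<forall>B\<in>sets N'.
        \<bar>measure M ((f -` A \<inter> space M) \<inter> (g -` B \<inter> space M))
          - measure M (f -` A \<inter> space M) * measure M (g -` B \<inter> space M)\<bar> \<le> c"
    using assms(1) unfolding alpha_bound_def by blast
  then show ?thesis
    unfolding alpha_bound_def eq
    using measurable_sets[OF assms(2)] measurable_sets[OF assms(3)]
    by (intro conjI ballI measurable_compose[OF f assms(2)] measurable_compose[OF g assms(3)]) blast
qed

lemma alpha_bound_commute:
  "alpha_bound M N f N' g c \<Longrightarrow> alpha_bound M N' g N f c"
  unfolding alpha_bound_def by (simp add: Int_commute mult.commute)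

context prob_space
begin

lemma alpha_bound_nonneg:
  assumes "alpha_bound M N f N' g c"
  shows "c \<ge> 0"
  using assms unfolding alpha_bound_def by (metis abs_ge_zero order_trans sets.top)

text \<open>
  Rounding \<open>f\<close> and \<open>g\<close> down to multiples of \<open>1/N\<close> turns them into averages of \<open>N\<close> indicators of level
  sets.  The covariance of the averages is the average of \<open>N\<^sup>2\<close> differences that are each at most \<open>c\<close>,
  and rounding costs \<open>4/N\<close>.
\<close>
lemma covariance_unit_interval:
  fixes f g :: "'a \<Rightarrow> real"
  assumes ab: "alpha_bound M borel f borel g c"
    and f: "\<And>x. 0 \<le> f x \<and> f x \<le> 1" and g: "\<And>x. 0 \<le> g x \<and> g x \<le> 1"
  shows "\<bar>expectation (\<lambda>x. f x * g x) - expectation f * expectation g\<bar> \<le> c"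
proof -
  have [measurable]: "f \<in> borel_measurable M" "g \<in> borel_measurable M"
    using ab by (auto simp: alpha_bound_def)
  define q where "q N t = real_of_int \<lfloor>real N * t\<rfloor> / real N" for N :: nat and t :: real
  have qm[measurable]: "q N \<in> borel_measurable borel" for N
    unfolding q_def by measurable
  have q01: "0 \<le> q N t \<and> q N t \<le> 1" and qclose: "\<bar>t - q N t\<bar> \<le> 1 / N"
    if "N > 0" "0 \<le> t \<and> t \<le> 1" for N t
  proof -
    have "real N * t \<le> real N" using that by (simp add: mult_left_le)
    then have "\<lfloor>real N * t\<rfloor> \<le> int N"
      by (metis floor_mono floor_of_nat)
    moreover have "0 \<le> \<lfloor>real N * t\<rfloor>" using that by simp
    ultimately show "0 \<le> q N t \<and> q N t \<le> 1"
      using that unfolding q_def by (simp add: divide_le_eq)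
    have "t = (real N * t) / N" using that by simp
    then have "\<bar>t - q N t\<bar> = \<bar>real N * t - \<lfloor>real N * t\<rfloor>\<bar> / N"
      unfolding q_def using that by (metis abs_divide abs_of_nat diff_divide_distrib)
    also have "\<dots> \<le> 1 / N"
      using that by (intro divide_right_mono) linarith+
    finally show "\<bar>t - q N t\<bar> \<le> 1 / N" .
  qed
  have q_sum: "q N t = (\<Sum>j\<in>{1..N}. indicator {s. real j \<le> N * s} t) / N"
    if "N > 0" "0 \<le> t \<and> t \<le> 1" for N t
  proof -
    have "(\<Sum>j\<in>{1..N}. indicator {s. real j \<le> N * s} t :: real) =
        real (card ({1..N} \<inter> {j. real j \<le> N * t}))"
      by (subst sum.cong[OF refl, where h="\<lambda>j. of_bool (real j \<le> N * t)"])
        (auto simp: indicator_def simp flip: sum_of_bool_eq)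
    also have "{1..N} \<inter> {j. real j \<le> N * t} = {1..nat \<lfloor>real N * t\<rfloor>}"
    proof -
      have "real N * t \<le> real N" using that by (simp add: mult_left_le)
      then have "j \<le> N" if "real j \<le> N * t" for j using that by linarith
      moreover have "(real j \<le> N * t) = (j \<le> nat \<lfloor>real N * t\<rfloor>)" for j
        using that by (metis le_nat_floor nat_floor_neg not_le of_nat_0_le_iff of_nat_floor mult_nonneg_nonneg order_trans of_nat_mono)
      ultimately show ?thesis by auto
    qed
    finally show ?thesis unfolding q_def using that by simp
  qed
  have bound: "\<bar>expectation (\<lambda>x. f x * g x) - expectation f * expectation g\<bar> \<le> c + 4 / N"
    if N: "N > 0" for N :: nat
  proof -
    define F where "F j = f -` {s. real j \<le> N * s} \<inter> space M" for j :: nat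
    define G where "G j = g -` {s. real j \<le> N * s} \<inter> space M" for j :: nat
    have FG[measurable]: "F j \<in> events" "G j \<in> events" for j
      unfolding F_def G_def by measurable
    have Ef: "expectation (\<lambda>x. q N (f x)) = (\<Sum>j\<in>{1..N}. prob (F j)) / N"
    proof -
      have "expectation (\<lambda>x. q N (f x)) = expectation (\<lambda>x. (\<Sum>j\<in>{1..N}. indicator (F j) x) / N)"
        using N f by (intro Bochner_Integration.integral_cong refl, subst q_sum)
          (auto simp: F_def G_def indicator_def intro!: sum.cong)
      moreover have "expectation (\<lambda>x. \<Sum>j\<in>{1..N}. indicator (F j) x) = (\<Sum>j\<in>{1..N}. prob (F j))"
        using FG by (subst Bochner_Integration.integral_sum) (auto intro!: integrable_real_indicator simp: emeasure_eq_measure)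
      ultimately show ?thesis by simp
    qed
    have Eg: "expectation (\<lambda>x. q N (g x)) = (\<Sum>j\<in>{1..N}. prob (G j)) / N"
    proof -
      have "expectation (\<lambda>x. q N (g x)) = expectation (\<lambda>x. (\<Sum>j\<in>{1..N}. indicator (G j) x) / N)"
        using N g by (intro Bochner_Integration.integral_cong refl, subst q_sum)
          (auto simp: F_def G_def indicator_def intro!: sum.cong)
      moreover have "expectation (\<lambda>x. \<Sum>j\<in>{1..N}. indicator (G j) x) = (\<Sum>j\<in>{1..N}. prob (G j))"
        using FG by (subst Bochner_Integration.integral_sum) (auto intro!: integrable_real_indicator simp: emeasure_eq_measure)
      ultimately show ?thesis by simp
    qed
    have Efg: "expectation (\<lambda>x. q N (f x) * q N (g x)) =
        (\<Sum>j\<in>{1..N}. \<Sum>k\<in>{1..N}. prob (F j \<inter> G k)) / (N * N)"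
    proof -
      have qf: "q N (f x) = (\<Sum>j\<in>{1..N}. indicator (F j) x) / N"
        and qg: "q N (g x) = (\<Sum>j\<in>{1..N}. indicator (G j) x) / N" if "x \<in> space M" for x
        using that N f g by (subst q_sum; simp add: F_def G_def indicator_def)+
      have "expectation (\<lambda>x. q N (f x) * q N (g x)) =
          expectation (\<lambda>x. (\<Sum>j\<in>{1..N}. \<Sum>k\<in>{1..N}. indicator (F j \<inter> G k) x) / (N * N))"
        unfolding indicator_inter_arith
        by (intro Bochner_Integration.integral_cong refl) (simp only: qf qg sum_product times_divide_times_eq of_nat_mult)
      moreover have "expectation (\<lambda>x. \<Sum>j\<in>{1..N}. \<Sum>k\<in>{1..N}. indicator (F j \<inter> G k) x) =
          (\<Sum>j\<in>{1..N}. \<Sum>k\<in>{1..N}. prob (F j \<inter> G k))"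
        using FG by (subst Bochner_Integration.integral_sum)
          (auto intro!: integrable_real_indicator sum.cong Bochner_Integration.integrable_sum
            Bochner_Integration.integral_sum[THEN trans] simp: emeasure_eq_measure)
      ultimately show ?thesis by simp
    qed
    have "\<bar>expectation (\<lambda>x. q N (f x) * q N (g x)) - expectation (\<lambda>x. q N (f x)) * expectation (\<lambda>x. q N (g x))\<bar>
      = \<bar>\<Sum>j\<in>{1..N}. \<Sum>k\<in>{1..N}. prob (F j \<inter> G k) - prob (F j) * prob (G k)\<bar> / (N * N)"
      unfolding Ef Eg Efg using N
      by (simp add: sum_product sum_subtractf diff_divide_distrib[symmetric] abs_divide)
    also have "\<dots> \<le> (\<Sum>j\<in>{1..N}. \<Sum>k\<in>{1..N}. c) / (N * N)"
    proof (intro divide_right_mono order_trans[OF sum_abs] sum_mono)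
      fix j k
      show "\<bar>prob (F j \<inter> G k) - prob (F j) * prob (G k)\<bar> \<le> c"
      proof -
        have "{s. real j \<le> real N * s} \<in> sets borel" for j by measurable
        then show ?thesis using ab unfolding alpha_bound_def F_def G_def by blast
      qed
    qed simp
    also have "\<dots> = c" using N by simp
    finally have main: "\<bar>expectation (\<lambda>x. q N (f x) * q N (g x)) - expectation (\<lambda>x. q N (f x)) * expectation (\<lambda>x. q N (g x))\<bar> \<le> c" .
    have int: "integrable M (\<lambda>x. f x)" "integrable M (\<lambda>x. g x)" "integrable M (\<lambda>x. f x * g x)"
      "integrable M (\<lambda>x. q N (f x))" "integrable M (\<lambda>x. q N (g x))" "integrable M (\<lambda>x. q N (f x) * q N (g x))"
      using f g q01[OF N]
      by (auto intro!: integrable_const_bound[where B=1] simp: abs_mult mult_le_one)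
    have 1: "\<bar>expectation f - expectation (\<lambda>x. q N (f x))\<bar> \<le> 1 / N"
    proof -
      have "\<bar>expectation (\<lambda>x. f x - q N (f x))\<bar> \<le> expectation (\<lambda>x. \<bar>f x - q N (f x)\<bar>)"
        by (rule integral_abs_bound)
      also have "\<dots> \<le> expectation (\<lambda>x. 1 / N)"
        using int qclose[OF N f] by (intro integral_mono) auto
      finally show ?thesis using int by (simp add: prob_space)
    qed
    have 2: "\<bar>expectation g - expectation (\<lambda>x. q N (g x))\<bar> \<le> 1 / N"
    proof -
      have "\<bar>expectation (\<lambda>x. g x - q N (g x))\<bar> \<le> expectation (\<lambda>x. \<bar>g x - q N (g x)\<bar>)"
        by (rule integral_abs_bound)
      also have "\<dots> \<le> expectation (\<lambda>x. 1 / N)"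
        using int qclose[OF N g] by (intro integral_mono) auto
      finally show ?thesis using int by (simp add: prob_space)
    qed
    have prod_close: "\<bar>a * b - a' * b'\<bar> \<le> 2 / N"
      if "0 \<le> a \<and> a \<le> 1" "0 \<le> b' \<and> b' \<le> 1" "\<bar>a - a'\<bar> \<le> 1 / N" "\<bar>b - b'\<bar> \<le> 1 / N" for a b a' b' :: real
    proof -
      have "a * b - a' * b' = a * (b - b') + (a - a') * b'" by (simp add: algebra_simps)
      also have "\<bar>\<dots>\<bar> \<le> \<bar>a\<bar> * \<bar>b - b'\<bar> + \<bar>a - a'\<bar> * \<bar>b'\<bar>"
        by (metis abs_mult abs_triangle_ineq)
      also have "\<dots> \<le> 1 * (1 / N) + 1 / N * 1"
        using that by (intro add_mono mult_mono) auto
      finally show ?thesis by simp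
    qed
    have 3: "\<bar>expectation (\<lambda>x. f x * g x) - expectation (\<lambda>x. q N (f x) * q N (g x))\<bar> \<le> 2 / N"
    proof -
      have "\<bar>expectation (\<lambda>x. f x * g x - q N (f x) * q N (g x))\<bar> \<le> expectation (\<lambda>x. \<bar>f x * g x - q N (f x) * q N (g x)\<bar>)"
        by (rule integral_abs_bound)
      also have "\<dots> \<le> expectation (\<lambda>x. 2 / N)"
        using int f q01[OF N g] qclose[OF N f] qclose[OF N g]
        by (intro integral_mono prod_close integrable_abs Bochner_Integration.integrable_diff) auto
      finally show ?thesis using int by (simp add: prob_space)
    qed
    have E01: "0 \<le> expectation f \<and> expectation f \<le> 1"
      "0 \<le> expectation (\<lambda>x. q N (g x)) \<and> expectation (\<lambda>x. q N (g x)) \<le> 1"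
      using f q01[OF N g] int integral_le_const[OF int(1), of 1] integral_le_const[OF int(5), of 1]
      by (auto intro!: integral_nonneg)
    have 4: "\<bar>expectation f * expectation g - expectation (\<lambda>x. q N (f x)) * expectation (\<lambda>x. q N (g x))\<bar> \<le> 2 / N"
      using E01 1 2 by (intro prod_close) auto
    show ?thesis using main 3 4 by argo
  qed
  show ?thesis
  proof (rule field_le_epsilon)
    fix e :: real assume e: "e > 0"
    then obtain N :: nat where "N > 0" "4 / e < N"
      by (metis less_trans of_nat_0_less_iff reals_Archimedean2 zero_less_divide_iff zero_less_numeral)
    then have "4 / N \<le> e" using e by (simp add: field_simps)
    with bound[OF \<open>N > 0\<close>] show "\<bar>expectation (\<lambda>x. f x * g x) - expectation f * expectation g\<bar> \<le> c + e"
      by linarith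
  qed
qed

text \<open>
  The functions are mapped to the unit interval by affine maps, which explains the factor \<open>4\<close>.
\<close>
lemma covariance_bound:
  fixes f g :: "'a \<Rightarrow> real"
  assumes ab: "alpha_bound M borel f borel g c"
    and f: "\<And>x. \<bar>f x\<bar> \<le> a" and g: "\<And>x. \<bar>g x\<bar> \<le> b"
  shows "\<bar>expectation (\<lambda>x. f x * g x) - expectation f * expectation g\<bar> \<le> 4 * a * b * c"
proof (cases "a > 0 \<and> b > 0")
  case True
  have [measurable]: "f \<in> borel_measurable M" "g \<in> borel_measurable M"
    using ab by (auto simp: alpha_bound_def)
  let ?f = "\<lambda>x. (f x + a) / (2 * a)" and ?g = "\<lambda>x. (g x + b) / (2 * b)"
  have "alpha_bound M borel ?f borel ?g c"
    by (rule alpha_bound_compose[OF ab]) measurable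
  then have le: "\<bar>expectation (\<lambda>x. ?f x * ?g x) - expectation ?f * expectation ?g\<bar> \<le> c"
  proof (rule covariance_unit_interval)
    fix x show "0 \<le> ?f x \<and> ?f x \<le> 1" using f[of x] True by (auto simp: abs_le_iff)
    show "0 \<le> ?g x \<and> ?g x \<le> 1" using g[of x] True by (auto simp: abs_le_iff)
  qed
  have int: "integrable M f" "integrable M g" "integrable M (\<lambda>x. f x * g x)"
    subgoal using f by (intro integrable_const_bound[where B=a]) auto
    subgoal using g by (intro integrable_const_bound[where B=b]) auto
    subgoal using f g True
      by (intro integrable_const_bound[where B="a*b"]) (auto simp: abs_mult intro!: mult_mono)
    done
  have "expectation (\<lambda>x. ?f x * ?g x) = expectation (\<lambda>x. (f x * g x + a * g x + b * f x + a * b) / (4 * a * b))"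
    by (simp add: algebra_simps)
  also have "\<dots> = (expectation (\<lambda>x. f x * g x) + a * expectation g + b * expectation f + a * b) / (4 * a * b)"
    using int by (simp add: prob_space)
  finally have 1: "expectation (\<lambda>x. ?f x * ?g x) = (expectation (\<lambda>x. f x * g x) + a * expectation g + b * expectation f + a * b) / (4 * a * b)" .
  have 2: "expectation ?f = (expectation f + a) / (2 * a)" "expectation ?g = (expectation g + b) / (2 * b)"
    using int by (simp_all add: prob_space)
  have "expectation (\<lambda>x. ?f x * ?g x) - expectation ?f * expectation ?g =
     (expectation (\<lambda>x. f x * g x) - expectation f * expectation g) / (4 * a * b)"
    unfolding 1 2 using True by (simp add: field_simps)
  then have "\<bar>expectation (\<lambda>x. f x * g x) - expectation f * expectation g\<bar> / (4 * a * b) \<le> c"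
    using le True by (simp add: abs_divide abs_mult)
  then show ?thesis using True by (simp add: field_simps)
next
  case False
  have ab0: "a \<ge> 0" "b \<ge> 0" using f[of undefined] g[of undefined] by linarith+
  with False have "a = 0 \<or> b = 0" by auto
  then have "f = (\<lambda>_. 0) \<or> g = (\<lambda>_. 0)" using f g by fastforce
  then show ?thesis using \<open>a = 0 \<or> b = 0\<close> by (elim disjE) simp_all
qed

lemma covariance_bound_complex:
  fixes f g :: "'a \<Rightarrow> complex"
  assumes ab: "alpha_bound M borel f borel g c"
    and f: "\<And>x. norm (f x) \<le> 1" and g: "\<And>x. norm (g x) \<le> 1"
  shows "norm (expectation (\<lambda>x. f x * g x) - expectation f * expectation g) \<le> 16 * c"
proof -
  have [measurable]: "f \<in> borel_measurable M" "g \<in> borel_measurable M"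
    using ab by (auto simp: alpha_bound_def)
  have int: "integrable M f" "integrable M g" "integrable M (\<lambda>x. f x * g x)"
    using f g by (auto intro!: integrable_const_bound[where B=1] simp: norm_mult mult_le_one)
  have R: "\<bar>Re (f x)\<bar> \<le> 1" "\<bar>Im (f x)\<bar> \<le> 1" "\<bar>Re (g x)\<bar> \<le> 1" "\<bar>Im (g x)\<bar> \<le> 1" for x
    using f[of x] g[of x] abs_Re_le_cmod[of "f x"] abs_Im_le_cmod[of "f x"]
      abs_Re_le_cmod[of "g x"] abs_Im_le_cmod[of "g x"] by linarith+
  have c: "\<bar>expectation (\<lambda>x. u (f x) * v (g x)) - expectation (\<lambda>x. u (f x)) * expectation (\<lambda>x. v (g x))\<bar> \<le> 4 * c"
    if "u = Re \<or> u = Im" "v = Re \<or> v = Im" for u v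
  proof -
    have m: "u \<in> borel_measurable borel" "v \<in> borel_measurable borel" using that by auto
    show ?thesis
      using covariance_bound[OF alpha_bound_compose[OF ab m], of 1 1] that R by auto
  qed
  have i2: "integrable M (\<lambda>x. Re (f x))" "integrable M (\<lambda>x. Im (f x))"
    "integrable M (\<lambda>x. Re (g x))" "integrable M (\<lambda>x. Im (g x))"
    "integrable M (\<lambda>x. Re (f x) * Re (g x))" "integrable M (\<lambda>x. Im (f x) * Im (g x))"
    "integrable M (\<lambda>x. Re (f x) * Im (g x))" "integrable M (\<lambda>x. Im (f x) * Re (g x))"
    using R by (auto intro!: integrable_const_bound[where B=1] simp: abs_mult mult_le_one)
  let ?D = "expectation (\<lambda>x. f x * g x) - expectation f * expectation g"
  have "\<bar>Re ?D\<bar> \<le> 8 * c"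
  proof -
    have "Re ?D = (expectation (\<lambda>x. Re (f x) * Re (g x)) - expectation (\<lambda>x. Re (f x)) * expectation (\<lambda>x. Re (g x)))
       - (expectation (\<lambda>x. Im (f x) * Im (g x)) - expectation (\<lambda>x. Im (f x)) * expectation (\<lambda>x. Im (g x)))"
      using int i2 by (simp flip: integral_Re integral_Im)
    then show ?thesis using c[of Re Re] c[of Im Im] by simp
  qed
  moreover have "\<bar>Im ?D\<bar> \<le> 8 * c"
  proof -
    have "Im ?D = (expectation (\<lambda>x. Re (f x) * Im (g x)) - expectation (\<lambda>x. Re (f x)) * expectation (\<lambda>x. Im (g x)))
       + (expectation (\<lambda>x. Im (f x) * Re (g x)) - expectation (\<lambda>x. Im (f x)) * expectation (\<lambda>x. Re (g x)))"
      using int i2 by (simp flip: integral_Re integral_Im)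
    then show ?thesis using c[of Re Im] c[of Im Re] by simp
  qed
  ultimately show ?thesis using cmod_le[of ?D] by linarith
qed

lemma expectation_product_law:
  fixes G :: "'b \<times> 'c \<Rightarrow> real"
  assumes [measurable]: "S \<in> M \<rightarrow>\<^sub>M N" "T \<in> M \<rightarrow>\<^sub>M N'" "S' \<in> M \<rightarrow>\<^sub>M N" "T' \<in> M \<rightarrow>\<^sub>M N'"
    and law: "distr M (N \<Otimes>\<^sub>M N') (\<lambda>\<omega>. (S' \<omega>, T' \<omega>)) = distr M N S \<Otimes>\<^sub>M distr M N' T"
    and [measurable]: "G \<in> borel_measurable (N \<Otimes>\<^sub>M N')"
  shows "expectation (\<lambda>\<omega>. G (S' \<omega>, T' \<omega>)) = (\<integral>z. G (S (fst z), T (snd z)) \<partial>(M \<Otimes>\<^sub>M M))"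
proof -
  have eq: "distr M N S \<Otimes>\<^sub>M distr M N' T = distr (M \<Otimes>\<^sub>M M) (N \<Otimes>\<^sub>M N') (\<lambda>(x, y). (S x, T y))"
    by (intro pair_measure_distr) (auto intro!: prob_space_imp_sigma_finite prob_space_distr)
  have "expectation (\<lambda>\<omega>. G (S' \<omega>, T' \<omega>)) = integral\<^sup>L (distr M (N \<Otimes>\<^sub>M N') (\<lambda>\<omega>. (S' \<omega>, T' \<omega>))) G"
    by (subst integral_distr) auto
  also have "\<dots> = (\<integral>z. G (S (fst z), T (snd z)) \<partial>(M \<Otimes>\<^sub>M M))"
    unfolding law eq by (subst integral_distr) (auto simp: case_prod_beta)
  finally show ?thesis .
qed

lemma alpha_bound_iff_indicator:
  assumes f: "f \<in> M \<rightarrow>\<^sub>M N" and g: "g \<in> M \<rightarrow>\<^sub>M N'"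
  shows "alpha_bound M N f N' g c \<longleftrightarrow> (\<forall>A\<in>sets N. \<forall>B\<in>sets N'.
     \<bar>expectation (\<lambda>\<omega>. indicator A (f \<omega>) * indicator B (g \<omega>)) -
       expectation (\<lambda>\<omega>. indicator A (f \<omega>)) * expectation (\<lambda>\<omega>. indicator B (g \<omega>))\<bar> \<le> c)"
proof -
  have 1: "expectation (\<lambda>\<omega>. indicator A (f \<omega>)) = prob (f -` A \<inter> space M)" for A
    by (subst Bochner_Integration.integral_cong[OF refl, where g="indicator (f -` A \<inter> space M)"])
      (auto simp: indicator_def)
  have 2: "expectation (\<lambda>\<omega>. indicator B (g \<omega>)) = prob (g -` B \<inter> space M)" for B
    by (subst Bochner_Integration.integral_cong[OF refl, where g="indicator (g -` B \<inter> space M)"])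
      (auto simp: indicator_def)
  have 3: "expectation (\<lambda>\<omega>. indicator A (f \<omega>) * indicator B (g \<omega>)) =
      prob ((f -` A \<inter> space M) \<inter> (g -` B \<inter> space M))" for A B
    by (subst Bochner_Integration.integral_cong[OF refl,
          where g="indicator ((f -` A \<inter> space M) \<inter> (g -` B \<inter> space M))"])
      (auto simp: indicator_def Int_assoc Int_left_commute)
  show ?thesis unfolding alpha_bound_def 1 2 3 using f g by blast
qed

text \<open>
  An independent variable \<open>T\<close> that enters only the second element does not spoil the dependence bound:
  conditionally on \<open>T\<close> the bound holds by assumption, and the conditional differences are averaged.
  Independent copies of the process enter the proof in this way, and so does a frozen path of the
  process when the copies are the random part.
\<close>
lemma alpha_bound_independent_parameter:
  assumes S[measurable]: "S \<in> M \<rightarrow>\<^sub>M NS" and T[measurable]: "T \<in> M \<rightarrow>\<^sub>M NT"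
    and law: "distr M (NS \<Otimes>\<^sub>M NT) (\<lambda>\<omega>. (S \<omega>, T \<omega>)) = distr M NS S \<Otimes>\<^sub>M distr M NT T"
    and u[measurable]: "u \<in> NS \<rightarrow>\<^sub>M N" and w[measurable]: "w \<in> NS \<Otimes>\<^sub>M NT \<rightarrow>\<^sub>M N'"
    and param: "\<And>\<tau>. \<tau> \<in> space NT \<Longrightarrow> alpha_bound M N (\<lambda>\<omega>. u (S \<omega>)) N' (\<lambda>\<omega>. w (S \<omega>, \<tau>)) c"
  shows "alpha_bound M N (\<lambda>\<omega>. u (S \<omega>)) N' (\<lambda>\<omega>. w (S \<omega>, T \<omega>)) c"
proof (subst alpha_bound_iff_indicator)
  show "(\<lambda>\<omega>. u (S \<omega>)) \<in> M \<rightarrow>\<^sub>M N" "(\<lambda>\<omega>. w (S \<omega>, T \<omega>)) \<in> M \<rightarrow>\<^sub>M N'" by measurable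
  show "\<forall>A\<in>sets N. \<forall>B\<in>sets N'.
     \<bar>expectation (\<lambda>\<omega>. indicator A (u (S \<omega>)) * indicator B (w (S \<omega>, T \<omega>))) -
       expectation (\<lambda>\<omega>. indicator A (u (S \<omega>))) * expectation (\<lambda>\<omega>. indicator B (w (S \<omega>, T \<omega>)))\<bar> \<le> c"
  proof (intro ballI)
    fix A B assume [measurable]: "A \<in> sets N" "B \<in> sets N'"
    interpret PP: pair_prob_space M M ..
    let ?P = "M \<Otimes>\<^sub>M M"
    let ?f = "\<lambda>\<omega>. indicator A (u (S \<omega>)) :: real"
    let ?g = "\<lambda>\<omega> \<omega>'. indicator B (w (S \<omega>, T \<omega>')) :: real"
    have int2: "integrable ?P (\<lambda>(x, y). ?g x y)" "integrable ?P (\<lambda>(x, y). ?f x * ?g x y)"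
      by (intro PP.P.integrable_const_bound[where B=1]; force simp: indicator_def)+
    have int1: "integrable M (\<lambda>y. expectation (\<lambda>x. ?g x y))" "integrable M (\<lambda>y. expectation (\<lambda>x. ?f x * ?g x y))"
      using PP.integrable_snd[OF int2(1)] PP.integrable_snd[OF int2(2)] by simp_all
    have "expectation (\<lambda>\<omega>. ?f \<omega> * ?g \<omega> \<omega>) = expectation (\<lambda>y. expectation (\<lambda>x. ?f x * ?g x y))"
      using expectation_product_law[OF S T S T law, of "\<lambda>z. indicator A (u (fst z)) * indicator B (w z)"]
        PP.integral_snd[OF int2(2)] by (simp add: case_prod_beta')
    moreover have "expectation (\<lambda>\<omega>. ?g \<omega> \<omega>) = expectation (\<lambda>y. expectation (\<lambda>x. ?g x y))"
      using expectation_product_law[OF S T S T law, of "\<lambda>z. indicator B (w z)"]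
        PP.integral_snd[OF int2(1)] by (simp add: case_prod_beta')
    ultimately have "\<bar>expectation (\<lambda>\<omega>. ?f \<omega> * ?g \<omega> \<omega>) - expectation ?f * expectation (\<lambda>\<omega>. ?g \<omega> \<omega>)\<bar>
       = \<bar>expectation (\<lambda>y. expectation (\<lambda>x. ?f x * ?g x y) - expectation ?f * expectation (\<lambda>x. ?g x y))\<bar>"
      using int1 by simp
    also have "\<dots> \<le> expectation (\<lambda>y. \<bar>expectation (\<lambda>x. ?f x * ?g x y) - expectation ?f * expectation (\<lambda>x. ?g x y)\<bar>)"
      by (rule integral_abs_bound)
    also have "\<dots> \<le> expectation (\<lambda>_. c)"
    proof (rule integral_mono)
      show "integrable M (\<lambda>y. \<bar>expectation (\<lambda>x. ?f x * ?g x y) - expectation ?f * expectation (\<lambda>x. ?g x y)\<bar>)"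
        using int1 by simp
      fix y assume "y \<in> space M"
      then have t: "T y \<in> space NT" using T by (rule measurable_space[rotated])
      have "(\<lambda>\<omega>. u (S \<omega>)) \<in> M \<rightarrow>\<^sub>M N" "(\<lambda>\<omega>. w (S \<omega>, T y)) \<in> M \<rightarrow>\<^sub>M N'" using t by measurable
      from alpha_bound_iff_indicator[OF this, of c] param[OF t]
      show "\<bar>expectation (\<lambda>x. ?f x * ?g x y) - expectation ?f * expectation (\<lambda>x. ?g x y)\<bar> \<le> c" by simp
    qed simp
    finally show "\<bar>expectation (\<lambda>\<omega>. ?f \<omega> * ?g \<omega> \<omega>) - expectation ?f * expectation (\<lambda>\<omega>. ?g \<omega> \<omega>)\<bar> \<le> c"
      by (simp add: prob_space)
  qed
qed

lemma alpha_bound_0_imp_product_law: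
  assumes "alpha_bound M N f N' g 0"
  shows "distr M (N \<Otimes>\<^sub>M N') (\<lambda>\<omega>. (f \<omega>, g \<omega>)) = distr M N f \<Otimes>\<^sub>M distr M N' g"
proof -
  have [measurable]: "f \<in> M \<rightarrow>\<^sub>M N" "g \<in> M \<rightarrow>\<^sub>M N'" using assms by (auto simp: alpha_bound_def)
  show ?thesis
  proof (rule pair_measure_eqI[symmetric])
    fix A B assume AB: "A \<in> sets (distr M N f)" "B \<in> sets (distr M N' g)"
    then have [measurable]: "A \<in> sets N" "B \<in> sets N'" by auto
    have "(\<lambda>\<omega>. (f \<omega>, g \<omega>)) -` (A \<times> B) \<inter> space M = (f -` A \<inter> space M) \<inter> (g -` B \<inter> space M)" by auto
    then show "emeasure (distr M N f) A * emeasure (distr M N' g) B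
        = emeasure (distr M (N \<Otimes>\<^sub>M N') (\<lambda>\<omega>. (f \<omega>, g \<omega>))) (A \<times> B)"
      using assms by (simp add: emeasure_distr alpha_bound_def emeasure_eq_measure flip: ennreal_mult)
  qed (auto intro!: prob_space_imp_sigma_finite prob_space_distr)
qed

lemma indep_var_imp_alpha_bound_0:
  assumes "indep_var N f N' g"
  shows "alpha_bound M N f N' g 0"
  unfolding alpha_bound_def
proof (intro conjI ballI)
  show "f \<in> M \<rightarrow>\<^sub>M N" "g \<in> M \<rightarrow>\<^sub>M N'"
    using indep_var_rv1[OF assms] indep_var_rv2[OF assms] by auto
  fix A B assume AB: "A \<in> sets N" "B \<in> sets N'"
  have eq: "(\<lambda>x. (f x, g x)) -` (A \<times> B) \<inter> space M = (f -` A \<inter> space M) \<inter> (g -` B \<inter> space M)" by blast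
  show "\<bar>prob ((f -` A \<inter> space M) \<inter> (g -` B \<inter> space M)) -
      prob (f -` A \<inter> space M) * prob (g -` B \<inter> space M)\<bar> \<le> 0"
    using indep_varD[OF assms AB] unfolding eq by simp
qed

lemma expectation_abs_le_sqrt:
  assumes "integrable M Z" "integrable M (\<lambda>\<omega>. (Z \<omega>)\<^sup>2)"
  shows "expectation (\<lambda>\<omega>. \<bar>Z \<omega>\<bar>) \<le> sqrt (expectation (\<lambda>\<omega>. (Z \<omega>)\<^sup>2))"
proof -
  have "variance (\<lambda>\<omega>. \<bar>Z \<omega>\<bar>) = expectation (\<lambda>\<omega>. \<bar>Z \<omega>\<bar>\<^sup>2) - (expectation (\<lambda>\<omega>. \<bar>Z \<omega>\<bar>))\<^sup>2"
    using assms by (intro variance_eq) auto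
  then have "(expectation (\<lambda>\<omega>. \<bar>Z \<omega>\<bar>))\<^sup>2 \<le> expectation (\<lambda>\<omega>. (Z \<omega>)\<^sup>2)"
    using variance_positive[of "\<lambda>\<omega>. \<bar>Z \<omega>\<bar>"] by simp
  then show ?thesis by (rule real_le_rsqrt)
qed

end

section \<open>Replacing one variable by an independent copy\<close>

text \<open>
  The supremum of \<open>u (x, v)\<close> over \<open>x\<close> need not be measurable in \<open>v\<close>.  Inside each level set
  \<open>{z. j * (b/N) \<le> u z}\<close> there is, by inner regularity, a compact set that misses little mass.  The
  projection of a compact set is compact, hence measurable, so the largest level \<open>j * (b/N)\<close> for which
  \<open>v\<close> lies in the projection is a measurable function of \<open>v\<close>.  It is a value not exceeding
  \<open>u (x, v)\<close> for some \<open>x\<close>, and off the missed mass it is at most one level below \<open>u\<close>.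
\<close>
lemma measurable_minorant_of_sup:
  fixes \<kappa> :: "('x::{complete_space,second_countable_topology} \<times> 'v::{complete_space,second_countable_topology}) measure" and u :: "'x \<times> 'v \<Rightarrow> real"
  assumes fin: "finite_measure \<kappa>" and sets: "sets \<kappa> = sets borel"
    and um[measurable]: "u \<in> borel_measurable borel" and u: "\<And>z. 0 \<le> u z \<and> u z \<le> b"
    and \<epsilon>: "\<epsilon> > 0"
  shows "\<exists>\<phi>\<in>borel_measurable borel. (\<forall>v. 0 \<le> \<phi> v \<and> \<phi> v \<le> b \<and> (\<exists>x. \<phi> v \<le> u (x, v))) \<and>
    measure \<kappa> {z. u z > \<phi> (snd z) + \<epsilon>} \<le> \<epsilon>"
proof -
  interpret finite_measure \<kappa> by fact
  have sp: "space \<kappa> = UNIV" using sets_eq_imp_space_eq[OF sets] by simp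
  have b0: "b \<ge> 0" using u[of undefined] by linarith
  obtain N0 :: nat where N0: "b / \<epsilon> < N0" using reals_Archimedean2 by blast
  define N where "N = Suc N0"
  have N: "N > 0" "b / N \<le> \<epsilon>"
    using N0 \<epsilon> by (auto simp: N_def field_simps)
  define S where "S j = {z. real j * (b / N) \<le> u z}" for j :: nat
  have S[measurable]: "S j \<in> sets borel" for j unfolding S_def by measurable
  have "\<exists>K. K \<subseteq> S j \<and> compact K \<and> measure \<kappa> (S j) \<le> measure \<kappa> K + \<epsilon> / (N + 1)" for j
  proof -
    have "emeasure \<kappa> (S j) = (SUP K \<in> {K. K \<subseteq> S j \<and> compact K}. emeasure \<kappa> K)"
      using inner_regular[of \<kappa> "S j"] sets S by (simp add: emeasure_eq_measure)
    then have "\<exists>K\<in>{K. K \<subseteq> S j \<and> compact K}. emeasure \<kappa> (S j) < emeasure \<kappa> K + ennreal (\<epsilon> / (N + 1))"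
    proof (rule SUP_approx_ennreal[rotated 2])
      show "{K. K \<subseteq> S j \<and> compact K} \<noteq> {}" using compact_empty by blast
      show "0 < \<epsilon> / (N + 1)" using \<epsilon> by simp
      show "emeasure \<kappa> (S j) \<noteq> \<infinity>" by simp
    qed
    then obtain K where K: "K \<subseteq> S j" "compact K" "emeasure \<kappa> (S j) \<le> emeasure \<kappa> K + ennreal (\<epsilon> / (N + 1))"
      by (auto intro: less_imp_le)
    then have "ennreal (measure \<kappa> (S j)) \<le> ennreal (measure \<kappa> K + \<epsilon> / (N + 1))"
      using \<epsilon> by (simp add: emeasure_eq_measure ennreal_plus)
    then show ?thesis using K \<epsilon> by (subst (asm) ennreal_le_iff) auto
  qed
  then obtain K where K: "\<And>j. K j \<subseteq> S j" "\<And>j. compact (K j)"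
      "\<And>j. measure \<kappa> (S j) \<le> measure \<kappa> (K j) + \<epsilon> / (N + 1)"
    by metis
  have Km[measurable]: "K j \<in> sets borel" for j
    using K(2) by (simp add: borel_closed compact_imp_closed)
  define T where "T j = snd ` K j" for j
  have T[measurable]: "T j \<in> sets borel" for j
    unfolding T_def by (intro borel_closed compact_imp_closed compact_continuous_image K(2) continuous_intros)
  define \<phi> where "\<phi> v = Max ((\<lambda>j. real j * (b / N) * indicator (T j) v) ` {..N})" for v
  have \<phi>ge: "real j * (b / N) * indicator (T j) v \<le> \<phi> v" if "j \<le> N" for j v
    unfolding \<phi>_def using that by (intro Max_ge) auto
  have \<phi>in: "\<exists>j\<le>N. \<phi> v = real j * (b / N) * indicator (T j) v" for v
  proof -
    have "\<phi> v \<in> (\<lambda>j. real j * (b / N) * indicator (T j) v) ` {..N}"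
      unfolding \<phi>_def by (rule Max_in) auto
    then show ?thesis by auto
  qed
  have "\<phi> \<in> borel_measurable borel"
    unfolding \<phi>_def by (intro borel_measurable_Max) auto
  moreover have "0 \<le> \<phi> v \<and> \<phi> v \<le> b \<and> (\<exists>x. \<phi> v \<le> u (x, v))" for v
  proof -
    obtain j where j: "j \<le> N" "\<phi> v = real j * (b / N) * indicator (T j) v" using \<phi>in by blast
    have le: "real j * (b / N) \<le> b"
    proof -
      have "real j * (b / N) \<le> real N * (b / N)" using j b0 by (intro mult_right_mono) auto
      then show ?thesis using N by simp
    qed
    show ?thesis
    proof (cases "v \<in> T j")
      case True
      then obtain x where "(x, v) \<in> K j" unfolding T_def by auto
      then have "real j * (b / N) \<le> u (x, v)" using K(1) S_def by blast
      then show ?thesis using j True le b0 by auto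
    next
      case False
      then show ?thesis using j u b0 by auto
    qed
  qed
  moreover have "measure \<kappa> {z. u z > \<phi> (snd z) + \<epsilon>} \<le> \<epsilon>"
  proof -
    have "{z. u z > \<phi> (snd z) + \<epsilon>} \<subseteq> (\<Union>j\<in>{..N}. S j - K j)"
    proof safe
      fix x v assume gt: "\<phi> (snd (x, v)) + \<epsilon> < u (x, v)"
      have "b > 0"
        using gt u[of "(x,v)"] \<epsilon> \<phi>ge[of 0 v] by (auto simp: less_le)
      define j where "j = nat \<lfloor>u (x, v) / (b / N)\<rfloor>"
      have "u (x, v) / (b / N) \<le> real N" using u[of "(x,v)"] \<open>b > 0\<close> N by (simp add: field_simps mult_right_mono)
      moreover have nn: "u (x, v) / (b / N) \<ge> 0" using u[of "(x,v)"] b0 by simp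
      ultimately have jN: "j \<le> N" unfolding j_def by linarith
      have j1: "real j \<le> u (x, v) / (b / N)" and j2: "u (x, v) / (b / N) < real j + 1"
        using nn unfolding j_def by linarith+
      have bN: "b / N > 0" using \<open>b > 0\<close> N by simp
      have zS: "(x, v) \<in> S j" using j1 bN unfolding S_def by (simp only: mem_Collect_eq pos_le_divide_eq)
      have "(x, v) \<notin> K j"
      proof
        assume "(x, v) \<in> K j"
        then have "v \<in> T j" unfolding T_def by force
        then have "real j * (b / N) \<le> \<phi> v" using \<phi>ge[OF jN, of v] by simp
        moreover have "u (x, v) < (real j + 1) * (b / N)"
          using j2 bN by (simp only: pos_divide_less_eq)
        moreover have "(real j + 1) * (b / N) = real j * (b / N) + b / N" by (simp only: distrib_right mult_1)
        ultimately show False using gt N(2) by auto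
      qed
      with zS jN show "(x, v) \<in> (\<Union>j\<in>{..N}. S j - K j)" by auto
    qed
    then have "measure \<kappa> {z. u z > \<phi> (snd z) + \<epsilon>} \<le> measure \<kappa> (\<Union>j\<in>{..N}. S j - K j)"
      by (intro finite_measure_mono) (auto simp: sets)
    also have "\<dots> \<le> (\<Sum>j\<in>{..N}. measure \<kappa> (S j - K j))"
      by (intro measure_subadditive_finite) (auto simp: sets emeasure_eq_measure)
    also have "\<dots> \<le> (\<Sum>j\<in>{..N}. \<epsilon> / (N + 1))"
      using K(1,3) by (intro sum_mono, subst finite_measure_Diff) (auto simp: sets algebra_simps)
    also have "\<dots> = \<epsilon>" by simp
    finally show ?thesis .
  qed
  ultimately show ?thesis by blast
qed

text \<open>
  A variable \<open>U\<close> that is weakly dependent on \<open>W\<close> is replaced in \<open>f (U, W)\<close> by a copy \<open>U'\<close> independent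
  of \<open>W\<close>.  The change of \<open>f\<close> under a change of the first argument is majorised by \<open>u\<close>, which sees \<open>W\<close>
  only through \<open>\<pi> W\<close>: this matters, because the variation condition concerns the joint law of the
  arguments of a single kernel and says nothing about other variables on which the point that nearly attains
  the supremum might depend.  The hypothesis \<open>var\<close> is the variation condition
  in the form that survives without measurability of the supremum.
\<close>
lemma (in prob_space) replacement_error:
  fixes U U' :: "'a \<Rightarrow> real" and W :: "'a \<Rightarrow> 'w" and N :: "'w measure"
    and f :: "real \<times> 'w \<Rightarrow> real" and \<pi> :: "'w \<Rightarrow> 'v::{complete_space,second_countable_topology}"
    and u :: "real \<times> real \<times> 'v \<Rightarrow> real" and d T b K D c :: real and n :: nat
  assumes ab: "alpha_bound M borel U N W c"
    and U'[measurable]: "U' \<in> borel_measurable M"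
    and law: "distr M (borel \<Otimes>\<^sub>M N) (\<lambda>\<omega>. (U' \<omega>, W \<omega>)) = distr M borel U \<Otimes>\<^sub>M distr M N W"
    and f[measurable]: "f \<in> borel_measurable (borel \<Otimes>\<^sub>M N)" and fK: "\<And>z. \<bar>f z\<bar> \<le> K"
    and \<pi>[measurable]: "\<pi> \<in> N \<rightarrow>\<^sub>M borel"
    and u[measurable]: "u \<in> borel_measurable borel" and ub: "\<And>z. 0 \<le> u z \<and> u z \<le> b"
    and fu: "\<And>x y w. \<bar>f (x, w) - f (y, w)\<bar> \<le> u (x, y, \<pi> w)"
    and d: "d > 0" and nT: "2 * T \<le> real n * d"
    and var: "\<And>\<phi>. \<phi> \<in> borel_measurable borel \<Longrightarrow>
        (\<And>z. 0 \<le> \<phi> z) \<Longrightarrow> (\<And>y v. \<exists>x. \<bar>x - y\<bar> \<le> d \<and> \<phi> (y, v) \<le> u (x, y, v)) \<Longrightarrow>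
        expectation (\<lambda>\<omega>. \<phi> (U' \<omega>, \<pi> (W \<omega>))) \<le> D"
  shows "\<bar>expectation (\<lambda>\<omega>. f (U \<omega>, W \<omega>)) - expectation (\<lambda>\<omega>. f (U' \<omega>, W \<omega>))\<bar>
     \<le> D + 4 * real n * (K + b) * c + 2 * K * prob {\<omega>\<in>space M. \<bar>U \<omega>\<bar> \<ge> T}"
proof -
  have [measurable]: "U \<in> borel_measurable M" and W[measurable]: "W \<in> M \<rightarrow>\<^sub>M N"
    using ab by (auto simp: alpha_bound_def)
  have K0: "K \<ge> 0" using fK[of undefined] by linarith
  have b0: "b \<ge> 0" using ub[of undefined] by linarith
  have c0: "c \<ge> 0" using ab by (rule alpha_bound_nonneg)
  interpret PP: pair_prob_space M M ..
  let ?P = "M \<Otimes>\<^sub>M M"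
  have lawPP: "expectation (\<lambda>\<omega>. G (U' \<omega>, W \<omega>)) = PP.expectation (\<lambda>z. G (U (fst z), W (snd z)))"
    if [measurable]: "G \<in> borel_measurable (borel \<Otimes>\<^sub>M N)" for G :: "real \<times> 'w \<Rightarrow> real"
    by (rule expectation_product_law[OF _ _ _ _ law]) measurable
  define I where "I r = {- T + real r * d ..< - T + real (Suc r) * d}" for r :: nat
  have I[measurable]: "I r \<in> sets borel" for r unfolding I_def by simp
  define J where "J = (\<Union>r<n. I r)"
  have J[measurable]: "J \<in> sets borel" unfolding J_def by auto
  have I_disj: "r = s" if "x \<in> I r" "x \<in> I s" for r s x
  proof -
    have "real r * d < real (Suc s) * d" "real s * d < real (Suc r) * d"
      using that unfolding I_def by auto
    then have "r < Suc s" "s < Suc r" using d by (simp_all only: mult_less_cancel_right_pos of_nat_less_iff)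
    then show ?thesis by simp
  qed
  have I_close: "\<bar>x - y\<bar> \<le> d" if "x \<in> I r" "y \<in> I r" for x y r
    using that unfolding I_def by (auto simp: algebra_simps)
  have indJ: "indicator J x = (\<Sum>r<n. indicator (I r) x :: real)" for x
    unfolding J_def
    by (rule indicator_UN_disjoint) (use I_disj in \<open>auto simp: disjoint_family_on_def\<close>)
  have J_cover: "\<bar>x\<bar> \<ge> T" if "x \<notin> J" for x
  proof (rule ccontr)
    assume "\<not> \<bar>x\<bar> \<ge> T"
    then have x: "- T < x" "x < T" by auto
    define r where "r = nat \<lfloor>(x + T) / d\<rfloor>"
    have "(x + T) / d \<ge> 0" using x d by simp
    then have r: "real r \<le> (x + T) / d" "(x + T) / d < real r + 1"
      unfolding r_def by linarith+
    then have "x \<in> I r" using d unfolding I_def by (auto simp: field_simps)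
    moreover have "r < n"
    proof -
      have "real r * d \<le> x + T" using r d by (simp add: field_simps)
      then have "real r * d < real n * d" using x nT by linarith
      then show ?thesis using d by simp
    qed
    ultimately show False using that unfolding J_def by auto
  qed
  define p where "p r = expectation (\<lambda>\<omega>. indicator (I r) (U \<omega>) :: real)" for r
  have p0: "p r \<ge> 0" for r unfolding p_def by (intro Bochner_Integration.integral_nonneg) auto
  define wt where "wt z = (\<Sum>r<n. indicator (I r) (U (fst z)) * indicator (I r) (U (snd z)) / p r)"
    for z :: "'a \<times> 'a"
  have wt0: "wt z \<ge> 0" for z unfolding wt_def using p0 by (intro sum_nonneg) auto
  define cm where "cm = (\<Sum>r<n. 1 / p r)"
  have wtm: "wt z \<le> cm" for z
    unfolding wt_def cm_def using p0
    by (intro sum_mono divide_right_mono) (auto simp: indicator_def)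
  have cm0: "cm \<ge> 0" unfolding cm_def using p0 by (intro sum_nonneg) auto
  have wtmeas[measurable]: "wt \<in> borel_measurable ?P" unfolding wt_def by measurable
  have bint: "integrable ?P G" if "G \<in> borel_measurable ?P" "\<And>z. \<bar>G z\<bar> \<le> B" for G :: "_ \<Rightarrow> real" and B
    using that by (intro PP.P.integrable_const_bound[where B=B]) auto
  have bint1: "integrable M G" if "G \<in> borel_measurable M" "\<And>z. \<bar>G z\<bar> \<le> B" for G :: "_ \<Rightarrow> real" and B
    using that by (intro integrable_const_bound[where B=B]) auto
  have wtb: "\<bar>wt z * t\<bar> \<le> cm * B" if "\<bar>t\<bar> \<le> B" for z t B
    unfolding abs_mult using that wt0[of z] wtm[of z] cm0 by (intro mult_mono) linarith+

  \<comment> \<open>The weight \<open>wt\<close> makes of the product measure (first factor for the copy \<open>y\<close>, second factor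
    for \<open>(U, W)\<close>) a coupling in which \<open>y\<close> is a fresh draw from the cell of \<open>U\<close>.  Its marginal on
    \<open>(U, W)\<close> is the law of \<open>(U, W)\<close> restricted to the cells; cells of probability zero contribute
    nothing on either side, as \<open>1 / p r = 0\<close> there.\<close>
  have marg1: "PP.expectation (\<lambda>z. wt z * g (U (snd z), W (snd z)))
      = expectation (\<lambda>\<omega>. indicator J (U \<omega>) * g (U \<omega>, W \<omega>))"
    if [measurable]: "g \<in> borel_measurable (borel \<Otimes>\<^sub>M N)" and gB: "\<And>z. \<bar>g z\<bar> \<le> B" for g B
  proof -
    have B0: "B \<ge> 0" using gB[of undefined] by linarith
    have intw: "integrable ?P (\<lambda>z. indicator (I r) (U (fst z)) * indicator (I r) (U (snd z)) / p r * g (U (snd z), W (snd z)))" for r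
      using gB p0[of r] B0 by (intro bint[of _ "1 / p r * B"])
        (auto simp: abs_mult indicator_def divide_right_mono)
    have summand: "PP.expectation (\<lambda>z. indicator (I r) (U (fst z)) * indicator (I r) (U (snd z)) / p r * g (U (snd z), W (snd z)))
       = expectation (\<lambda>\<omega>. indicator (I r) (U \<omega>) * g (U \<omega>, W \<omega>))" for r
    proof (cases "p r = 0")
      case True
      have "integrable M (\<lambda>\<omega>. indicator (I r) (U \<omega>) :: real)" by (rule bint1[of _ 1]) (auto simp: indicator_def)
      then have "AE \<omega> in M. indicator (I r) (U \<omega>) = (0::real)"
        using True unfolding p_def by (subst (asm) integral_nonneg_eq_0_iff_AE) auto
      then have "expectation (\<lambda>\<omega>. indicator (I r) (U \<omega>) * g (U \<omega>, W \<omega>)) = expectation (\<lambda>_. 0)"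
        by (intro integral_cong_AE) auto
      then show ?thesis using True by simp
    next
      case False
      have "PP.expectation (\<lambda>z. indicator (I r) (U (fst z)) * indicator (I r) (U (snd z)) / p r * g (U (snd z), W (snd z)))
        = (\<integral>x. (\<integral>y. indicator (I r) (U x) * indicator (I r) (U y) / p r * g (U y, W y) \<partial>M) \<partial>M)"
      proof (subst PP.integral_fst'[symmetric])
        show "integrable ?P (\<lambda>z. indicator (I r) (U (fst z)) * indicator (I r) (U (snd z)) / p r * g (U (snd z), W (snd z)))"
          by (rule intw)
      qed simp
      also have "\<dots> = (\<integral>x. indicator (I r) (U x) * (expectation (\<lambda>\<omega>. indicator (I r) (U \<omega>) * g (U \<omega>, W \<omega>)) / p r) \<partial>M)"
        by (simp add: mult.assoc)
      also have "\<dots> = p r * (expectation (\<lambda>\<omega>. indicator (I r) (U \<omega>) * g (U \<omega>, W \<omega>)) / p r)"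
        unfolding p_def by simp
      finally show ?thesis using False by simp
    qed
    have "PP.expectation (\<lambda>z. wt z * g (U (snd z), W (snd z))) =
       (\<Sum>r<n. PP.expectation (\<lambda>z. indicator (I r) (U (fst z)) * indicator (I r) (U (snd z)) / p r * g (U (snd z), W (snd z))))"
      unfolding wt_def sum_distrib_right by (intro Bochner_Integration.integral_sum intw)
    also have "\<dots> = (\<Sum>r<n. expectation (\<lambda>\<omega>. indicator (I r) (U \<omega>) * g (U \<omega>, W \<omega>)))"
      by (simp only: summand)
    also have "\<dots> = expectation (\<lambda>\<omega>. indicator J (U \<omega>) * g (U \<omega>, W \<omega>))"
      unfolding indJ sum_distrib_right using gB B0
      by (intro Bochner_Integration.integral_sum[symmetric] bint1[of _ B]) (auto simp: indicator_def)
    finally show ?thesis .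
  qed

  \<comment> \<open>Its marginal on \<open>(y, W)\<close> is the product law up to the mixing error of the \<open>n\<close> events that
    \<open>U\<close> lies in a given cell.\<close>
  have marg2: "\<bar>PP.expectation (\<lambda>z. wt z * g (U (fst z), W (snd z)))
      - PP.expectation (\<lambda>z. indicator J (U (fst z)) * g (U (fst z), W (snd z)))\<bar> \<le> 4 * real n * B * c"
    if [measurable]: "g \<in> borel_measurable (borel \<Otimes>\<^sub>M N)" and gB: "\<And>z. \<bar>g z\<bar> \<le> B" for g B
  proof -
    have B0: "B \<ge> 0" using gB[of undefined] by linarith
    let ?w = "\<lambda>r z. indicator (I r) (U (fst z)) * indicator (I r) (U (snd z)) / p r * g (U (fst z), W (snd z))"
    let ?v = "\<lambda>r z. indicator (I r) (U (fst z)) * g (U (fst z), W (snd z))"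
    have intw: "integrable ?P (?w r)" for r
      using gB p0[of r] B0 by (intro bint[of _ "1 / p r * B"])
         (auto simp: abs_mult indicator_def divide_right_mono)
    have intv: "integrable ?P (?v r)" for r
      using gB B0 by (intro bint[of _ B]) (auto simp: indicator_def)
    have summand: "\<bar>PP.expectation (?w r) - PP.expectation (?v r)\<bar> \<le> 4 * B * c" for r
    proof (cases "p r = 0")
      case True
      have "integrable M (\<lambda>\<omega>. indicator (I r) (U \<omega>) :: real)" by (rule bint1[of _ 1]) (auto simp: indicator_def)
      then have "AE \<omega> in M. indicator (I r) (U \<omega>) = (0::real)"
        using True unfolding p_def by (subst (asm) integral_nonneg_eq_0_iff_AE) auto
      then have ae: "AE x in M. (\<integral>y. ?v r (x, y) \<partial>M) = 0"
        by eventually_elim simp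
      have "PP.expectation (?v r) = (\<integral>x. (\<integral>y. ?v r (x, y) \<partial>M) \<partial>M)"
        by (rule PP.integral_fst'[OF intv, symmetric])
      also have "\<dots> = (\<integral>x. 0 \<partial>M)"
        by (rule integral_cong_AE[OF _ _ ae]) auto
      finally show ?thesis using True B0 c0 by simp
    next
      case False
      then have pp: "p r > 0" using p0[of r] by simp
      have cov: "\<bar>(\<integral>y. indicator (I r) (U y) * g (t, W y) \<partial>M) - p r * (\<integral>y. g (t, W y) \<partial>M)\<bar> \<le> 4 * B * c" for t
      proof -
        have "alpha_bound M borel (\<lambda>y. indicator (I r) (U y) :: real) borel (\<lambda>y. g (t, W y)) c"
          by (rule alpha_bound_compose[OF ab]) measurable
        from covariance_bound[OF this, of 1 B] show ?thesis
          unfolding p_def using gB by (auto simp: indicator_def)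
      qed
      let ?E = "\<lambda>x. (((\<integral>y. indicator (I r) (U y) * g (U x, W y) \<partial>M) - p r * (\<integral>y. g (U x, W y) \<partial>M)) / p r)"
      have "PP.expectation (?w r) - PP.expectation (?v r) = PP.expectation (\<lambda>z. ?w r z - ?v r z)"
        using intw intv by simp
      also have "\<dots> = (\<integral>x. (\<integral>y. ?w r (x, y) - ?v r (x, y) \<partial>M) \<partial>M)"
        using intw[of r] intv[of r] by (subst PP.integral_fst'[symmetric]) auto
      also have "\<dots> = (\<integral>x. indicator (I r) (U x) * ?E x \<partial>M)"
      proof (rule Bochner_Integration.integral_cong[OF refl])
        fix x assume x: "x \<in> space M"
        have i: "integrable M (\<lambda>y. indicator (I r) (U y) * g (U x, W y))" "integrable M (\<lambda>y. g (U x, W y))"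
          using gB B0 x by (auto intro!: bint1[of _ B] simp: indicator_def)
        have "(\<integral>y. ?w r (x, y) - ?v r (x, y) \<partial>M) = 
          (\<integral>y. indicator (I r) (U x) / p r * (indicator (I r) (U y) * g (U x, W y)) - indicator (I r) (U x) * g (U x, W y) \<partial>M)"
          by (simp add: mult_ac)
        also have "\<dots> = indicator (I r) (U x) / p r * (\<integral>y. indicator (I r) (U y) * g (U x, W y) \<partial>M) - indicator (I r) (U x) * (\<integral>y. g (U x, W y) \<partial>M)"
          using i by simp
        finally show "(\<integral>y. ?w r (x, y) - ?v r (x, y) \<partial>M) = indicator (I r) (U x) * ?E x"
          using pp by (simp add: field_simps)
      qed
      finally have "\<bar>PP.expectation (?w r) - PP.expectation (?v r)\<bar> = \<bar>\<integral>x. indicator (I r) (U x) * ?E x \<partial>M\<bar>" by simp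
      also have "\<dots> \<le> (\<integral>x. \<bar>indicator (I r) (U x) * ?E x\<bar> \<partial>M)"
        by (rule integral_abs_bound)
      also have "\<dots> \<le> (\<integral>x. indicator (I r) (U x) * (4 * B * c / p r) \<partial>M)"
      proof (rule integral_mono)
        have m: "(\<lambda>x. indicator (I r) (U x) * ?E x) \<in> borel_measurable M"
          by measurable
        have le: "\<bar>indicator (I r) (U x) * ?E x\<bar>
          \<le> indicator (I r) (U x) * (4 * B * c / p r)" for x
          using cov[of "U x"] pp by (auto simp: abs_mult indicator_def divide_right_mono)
        then show "\<bar>indicator (I r) (U x) * ?E x\<bar>
          \<le> indicator (I r) (U x) * (4 * B * c / p r)" for x .
        show i2: "integrable M (\<lambda>x. indicator (I r) (U x) * (4 * B * c / p r))"
          using B0 c0 pp by (intro bint1[of _ "4 * B * c / p r"]) (auto simp: indicator_def)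
        show "integrable M (\<lambda>x. \<bar>indicator (I r) (U x) * ?E x\<bar>)"
        proof (intro integrable_abs bint1[OF m])
          fix x
          have "indicator (I r) (U x) * (4 * B * c / p r) \<le> 1 * (4 * B * c / p r)"
            using B0 c0 pp by (intro mult_right_mono) (auto simp: indicator_def)
          then show "\<bar>indicator (I r) (U x) * ?E x\<bar>
            \<le> 1 * (4 * B * c / p r)"
            using le[of x] by linarith
        qed
      qed
      also have "\<dots> = 4 * B * c" using pp unfolding p_def by simp
      finally show ?thesis .
    qed
    have "PP.expectation (\<lambda>z. wt z * g (U (fst z), W (snd z))) = (\<Sum>r<n. PP.expectation (?w r))"
      unfolding wt_def sum_distrib_right by (rule Bochner_Integration.integral_sum) (rule intw)
    moreover have "PP.expectation (\<lambda>z. indicator J (U (fst z)) * g (U (fst z), W (snd z))) = (\<Sum>r<n. PP.expectation (?v r))"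
      unfolding indJ sum_distrib_right by (rule Bochner_Integration.integral_sum) (rule intv)
    ultimately have "\<bar>PP.expectation (\<lambda>z. wt z * g (U (fst z), W (snd z)))
      - PP.expectation (\<lambda>z. indicator J (U (fst z)) * g (U (fst z), W (snd z)))\<bar> \<le>
       (\<Sum>r<n. \<bar>PP.expectation (?w r) - PP.expectation (?v r)\<bar>)"
      by (simp add: sum_subtractf[symmetric] sum_abs)
    also have "\<dots> \<le> (\<Sum>r<n. 4 * B * c)" by (intro sum_mono summand)
    finally show ?thesis by (simp add: mult_ac)
  qed

  \<comment> \<open>Under the coupling \<open>\<bar>U - y\<bar> \<le> d\<close>, so the oscillation majorant \<open>u\<close> may be cut off outside
    this strip; a measurable minorant \<open>\<phi>\<close> of its supremum depends on \<open>(y, W)\<close> alone and can be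
    integrated against the second marginal.\<close>
  define Z where "Z z = (U (snd z), U (fst z), \<pi> (W (snd z)))" for z :: "'a \<times> 'a"
  have Z[measurable]: "Z \<in> ?P \<rightarrow>\<^sub>M borel"
    unfolding Z_def borel_prod[symmetric] by measurable
  define u1 where "u1 z = (case z of (x, y, v) \<Rightarrow> if \<bar>x - y\<bar> \<le> d then u z else 0)" for z
  have u1m[measurable]: "u1 \<in> borel_measurable borel"
  proof -
    have "u \<in> borel_measurable (borel \<Otimes>\<^sub>M borel \<Otimes>\<^sub>M borel)" by (simp add: borel_prod)
    then have "u1 \<in> borel_measurable (borel \<Otimes>\<^sub>M borel \<Otimes>\<^sub>M borel)"
      unfolding u1_def case_prod_beta by measurable
    then show ?thesis by (simp add: borel_prod)
  qed
  have u1b: "0 \<le> u1 z \<and> u1 z \<le> b" for z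
    using ub[of z] b0 unfolding u1_def by (auto split: prod.split)
  have osc: "PP.expectation (\<lambda>z. wt z * u1 (Z z)) \<le> D + 4 * real n * b * c + \<epsilon> * (1 + cm * b)"
    if \<epsilon>: "\<epsilon> > 0" for \<epsilon>
  proof -
    interpret \<kappa>: prob_space "distr ?P borel Z" by (rule PP.prob_space_distr) simp
    have "\<exists>\<phi>\<in>borel_measurable borel. (\<forall>v. 0 \<le> \<phi> v \<and> \<phi> v \<le> b \<and> (\<exists>x. \<phi> v \<le> u1 (x, v))) \<and>
      measure (distr ?P borel Z) {z. u1 z > \<phi> (snd z) + \<epsilon>} \<le> \<epsilon>"
      by (rule measurable_minorant_of_sup) (use u1b \<epsilon> \<kappa>.finite_measure_axioms in auto)
    then obtain \<phi> where \<phi>m[measurable]: "\<phi> \<in> borel_measurable borel" and \<phi>b: "\<And>v. 0 \<le> \<phi> v \<and> \<phi> v \<le> b"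
      and \<phi>x: "\<And>v. \<exists>x. \<phi> v \<le> u1 (x, v)"
      and bad: "measure (distr ?P borel Z) {z. u1 z > \<phi> (snd z) + \<epsilon>} \<le> \<epsilon>" by blast
    define S where "S = {z. u1 z > \<phi> (snd z) + \<epsilon>}"
    have snd_m: "(snd :: real \<times> real \<times> 'v \<Rightarrow> _) \<in> borel \<rightarrow>\<^sub>M borel"
      by (intro borel_measurable_continuous_onI continuous_intros)
    have \<phi>snd[measurable]: "(\<lambda>z :: real \<times> real \<times> 'v. \<phi> (snd z)) \<in> borel_measurable borel"
      by (rule measurable_compose[OF snd_m \<phi>m])
    have S[measurable]: "S \<in> sets borel"
      using borel_measurable_less[of "\<lambda>z. \<phi> (snd z) + \<epsilon>" borel u1] unfolding S_def by simp
    have SP: "PP.expectation (\<lambda>z. indicator S (Z z)) \<le> \<epsilon>"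
    proof -
      have "PP.expectation (\<lambda>z. indicator S (Z z) :: real) = integral\<^sup>L (distr ?P borel Z) (indicator S)"
        by (subst integral_distr) auto
      also have "\<dots> = measure (distr ?P borel Z) S" by (simp add: \<kappa>.emeasure_eq_measure)
      finally show ?thesis using bad unfolding S_def by simp
    qed
    have \<phi>m2: "(\<lambda>x. \<phi> (fst x, \<pi> (snd x))) \<in> borel_measurable (borel \<Otimes>\<^sub>M N)"
    proof -
      have "\<phi> \<in> borel_measurable (borel \<Otimes>\<^sub>M borel)" by (simp add: borel_prod)
      then show ?thesis by measurable
    qed
    have iw: "integrable ?P wt" by (rule bint[of _ cm]) (use wt0 wtm in auto)
    have iwf: "integrable ?P (\<lambda>z. wt z * \<phi> (snd (Z z)))"
    proof (rule bint[of _ "cm * b"])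
      show "(\<lambda>z. wt z * \<phi> (snd (Z z))) \<in> borel_measurable ?P" by measurable
    qed (use wtb \<phi>b in auto)
    have iS: "integrable ?P (\<lambda>z. indicator S (Z z) :: real)"
      by (rule bint[of _ 1]) (auto simp: indicator_def)
    have wt1: "PP.expectation wt \<le> 1"
    proof -
      have "PP.expectation (\<lambda>z. wt z * (\<lambda>_. 1) (U (snd z), W (snd z)))
      = expectation (\<lambda>\<omega>. indicator J (U \<omega>) * (\<lambda>_. 1) (U \<omega>, W \<omega>))"
        by (rule marg1[of "\<lambda>_. 1" 1]) auto
      also have "\<dots> \<le> expectation (\<lambda>_. 1)"
        by (rule integral_mono) (auto intro!: bint1[of _ 1] simp: indicator_def)
      finally show ?thesis by (simp add: prob_space)
    qed
    have "PP.expectation (\<lambda>z. wt z * u1 (Z z)) \<le>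
       PP.expectation (\<lambda>z. wt z * \<phi> (snd (Z z)) + \<epsilon> * wt z + cm * b * indicator S (Z z))"
    proof (rule integral_mono)
      show "integrable ?P (\<lambda>z. wt z * u1 (Z z))"
        by (rule bint[of _ "cm * b"]) (use wtb u1b in auto)
      show "integrable ?P (\<lambda>z. wt z * \<phi> (snd (Z z)) + \<epsilon> * wt z + cm * b * indicator S (Z z))"
        using iw iwf iS by simp
      fix z
      show "wt z * u1 (Z z) \<le> wt z * \<phi> (snd (Z z)) + \<epsilon> * wt z + cm * b * indicator S (Z z)"
      proof (cases "Z z \<in> S")
        case True
        have "wt z * u1 (Z z) \<le> cm * b" using wt0 wtm cm0 u1b by (intro mult_mono) auto
        moreover have "0 \<le> wt z * \<phi> (snd (Z z))" "0 \<le> \<epsilon> * wt z"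
          using wt0[of z] \<phi>b[of "snd (Z z)"] \<epsilon> by auto
        ultimately show ?thesis using True by simp
      next
        case False
        then have "u1 (Z z) \<le> \<phi> (snd (Z z)) + \<epsilon>" unfolding S_def by auto
        then have "wt z * u1 (Z z) \<le> wt z * (\<phi> (snd (Z z)) + \<epsilon>)" using wt0 by (intro mult_left_mono) auto
        then show ?thesis using False by (simp add: algebra_simps)
      qed
    qed
    also have "\<dots> = PP.expectation (\<lambda>z. wt z * \<phi> (snd (Z z))) + \<epsilon> * PP.expectation wt
        + cm * b * PP.expectation (\<lambda>z. indicator S (Z z))"
      using iw iwf iS by simp
    also have "\<dots> \<le> PP.expectation (\<lambda>z. wt z * \<phi> (snd (Z z))) + \<epsilon> * 1 + cm * b * \<epsilon>"
      using wt1 SP \<epsilon> cm0 b0 by (intro add_mono mult_left_mono) auto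
    also have "PP.expectation (\<lambda>z. wt z * \<phi> (snd (Z z))) \<le> D + 4 * real n * b * c"
    proof -
      have "\<bar>PP.expectation (\<lambda>z. wt z * (\<lambda>x. \<phi> (fst x, \<pi> (snd x))) (U (fst z), W (snd z)))
      - PP.expectation (\<lambda>z. indicator J (U (fst z)) * (\<lambda>x. \<phi> (fst x, \<pi> (snd x))) (U (fst z), W (snd z)))\<bar> \<le> 4 * real n * b * c"
        by (rule marg2[OF \<phi>m2]) (use \<phi>b in auto)
      moreover have "PP.expectation (\<lambda>z. indicator J (U (fst z)) * (\<lambda>x. \<phi> (fst x, \<pi> (snd x))) (U (fst z), W (snd z)))
        \<le> PP.expectation (\<lambda>z. (\<lambda>x. \<phi> (fst x, \<pi> (snd x))) (U (fst z), W (snd z)))"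
        using \<phi>b \<phi>m2 b0 by (intro integral_mono bint[of _ b]) (auto simp: indicator_def)
      moreover have "PP.expectation (\<lambda>z. (\<lambda>x. \<phi> (fst x, \<pi> (snd x))) (U (fst z), W (snd z)))
          = expectation (\<lambda>\<omega>. \<phi> (U' \<omega>, \<pi> (W \<omega>)))"
        using lawPP[OF \<phi>m2] by simp
      moreover have "expectation (\<lambda>\<omega>. \<phi> (U' \<omega>, \<pi> (W \<omega>))) \<le> D"
      proof (rule var)
        fix y v
        obtain x where x: "\<phi> (y, v) \<le> u1 (x, y, v)" using \<phi>x by blast
        show "\<exists>x. \<bar>x - y\<bar> \<le> d \<and> \<phi> (y, v) \<le> u (x, y, v)"
        proof (cases "\<bar>x - y\<bar> \<le> d")
          case True
          then show ?thesis using x unfolding u1_def by auto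
        next
          case False
          then have "\<phi> (y, v) \<le> u (y, y, v)" using x ub[of "(y, y, v)"] unfolding u1_def by simp
          then show ?thesis using d by (intro exI[of _ y]) auto
        qed
      qed (use \<phi>b in auto)
      ultimately show ?thesis unfolding Z_def by simp
    qed
    finally show ?thesis by (simp add: algebra_simps)
  qed
  have osc': "PP.expectation (\<lambda>z. wt z * u1 (Z z)) \<le> D + 4 * real n * b * c"
  proof (rule field_le_epsilon)
    fix e :: real assume "e > 0"
    moreover have "1 + cm * b > 0" using cm0 b0 by (simp add: add_pos_nonneg)
    ultimately show "PP.expectation (\<lambda>z. wt z * u1 (Z z)) \<le> D + 4 * real n * b * c + e"
      using osc[of "e / (1 + cm * b)"] by simp
  qed

  \<comment> \<open>Both expectations are compared with their values under the coupling; what lies outside the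
    cells is bounded by the tail of \<open>U\<close>.\<close>
  let ?fU = "\<lambda>z. f (U (snd z), W (snd z))" and ?fY = "\<lambda>z. f (U (fst z), W (snd z))"
  have ifU: "integrable ?P (\<lambda>z. wt z * ?fU z)" and ifY: "integrable ?P (\<lambda>z. wt z * ?fY z)"
    by (rule bint[of _ "cm * K"]; use wtb fK in auto)+
  have "\<bar>PP.expectation (\<lambda>z. wt z * ?fU z) - PP.expectation (\<lambda>z. wt z * ?fY z)\<bar>
      = \<bar>PP.expectation (\<lambda>z. wt z * ?fU z - wt z * ?fY z)\<bar>"
    using ifU ifY by simp
  also have "\<dots> \<le> PP.expectation (\<lambda>z. \<bar>wt z * ?fU z - wt z * ?fY z\<bar>)"
    by (rule integral_abs_bound)
  also have "\<dots> \<le> PP.expectation (\<lambda>z. wt z * u1 (Z z))"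
  proof (rule integral_mono)
    show "integrable ?P (\<lambda>z. \<bar>wt z * ?fU z - wt z * ?fY z\<bar>)" using ifU ifY by simp
    show "integrable ?P (\<lambda>z. wt z * u1 (Z z))"
      by (rule bint[of _ "cm * b"]) (use wtb u1b in auto)
    fix z
    show "\<bar>wt z * ?fU z - wt z * ?fY z\<bar> \<le> wt z * u1 (Z z)"
    proof (cases "wt z = 0")
      case False
      then obtain r where "indicator (I r) (U (fst z)) * indicator (I r) (U (snd z)) / p r \<noteq> 0"
        unfolding wt_def by (meson sum.neutral)
      then have "\<bar>U (snd z) - U (fst z)\<bar> \<le> d" by (intro I_close[of _ r]) (auto simp: indicator_def split: if_splits)
      then have "\<bar>?fU z - ?fY z\<bar> \<le> u1 (Z z)" unfolding u1_def Z_def by (auto intro: fu)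
      then show ?thesis using wt0[of z] by (simp add: right_diff_distrib[symmetric] abs_mult mult_left_mono)
    qed simp
  qed
  finally have s3: "\<bar>PP.expectation (\<lambda>z. wt z * ?fU z) - PP.expectation (\<lambda>z. wt z * ?fY z)\<bar> \<le> D + 4 * real n * b * c"
    using osc' by linarith
  have s2: "\<bar>PP.expectation (\<lambda>z. wt z * ?fY z) - PP.expectation (\<lambda>z. indicator J (U (fst z)) * ?fY z)\<bar> \<le> 4 * real n * K * c"
    by (rule marg2[OF f fK])
  have s1: "PP.expectation (\<lambda>z. wt z * ?fU z) = expectation (\<lambda>\<omega>. indicator J (U \<omega>) * f (U \<omega>, W \<omega>))"
    by (rule marg1[OF f fK])
  let ?q = "prob {\<omega>\<in>space M. \<bar>U \<omega>\<bar> \<ge> T}"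
  have tail: "expectation (\<lambda>\<omega>. indicator {\<omega>\<in>space M. \<bar>U \<omega>\<bar> \<ge> T} \<omega> :: real) = ?q" by simp
  have tail_int: "integrable M (\<lambda>\<omega>. indicator {\<omega>\<in>space M. \<bar>U \<omega>\<bar> \<ge> T} \<omega> :: real)"
    by (rule bint1[of _ 1]) (auto simp: indicator_def)
  have t1: "\<bar>expectation (\<lambda>\<omega>. f (U \<omega>, W \<omega>)) - expectation (\<lambda>\<omega>. indicator J (U \<omega>) * f (U \<omega>, W \<omega>))\<bar> \<le> K * ?q"
  proof -
    have i: "integrable M (\<lambda>\<omega>. f (U \<omega>, W \<omega>))" "integrable M (\<lambda>\<omega>. indicator J (U \<omega>) * f (U \<omega>, W \<omega>))"
      using fK K0 by (auto intro!: bint1[of _ K] simp: indicator_def)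
    have "\<bar>expectation (\<lambda>\<omega>. f (U \<omega>, W \<omega>)) - expectation (\<lambda>\<omega>. indicator J (U \<omega>) * f (U \<omega>, W \<omega>))\<bar>
      = \<bar>expectation (\<lambda>\<omega>. f (U \<omega>, W \<omega>) - indicator J (U \<omega>) * f (U \<omega>, W \<omega>))\<bar>"
      using i by simp
    also have "\<dots> \<le> expectation (\<lambda>\<omega>. \<bar>f (U \<omega>, W \<omega>) - indicator J (U \<omega>) * f (U \<omega>, W \<omega>)\<bar>)"
      by (rule integral_abs_bound)
    also have "\<dots> \<le> expectation (\<lambda>\<omega>. K * indicator {\<omega>\<in>space M. \<bar>U \<omega>\<bar> \<ge> T} \<omega>)"
      using i tail_int fK K0 J_cover by (intro integral_mono) (auto simp: indicator_def)
    finally show ?thesis using tail by simp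
  qed
  have t2: "\<bar>PP.expectation ?fY - PP.expectation (\<lambda>z. indicator J (U (fst z)) * ?fY z)\<bar> \<le> K * ?q"
  proof -
    have i: "integrable ?P ?fY" "integrable ?P (\<lambda>z. indicator J (U (fst z)) * ?fY z)"
      using fK K0 by (auto intro!: bint[of _ K] simp: indicator_def)
    have "\<bar>PP.expectation ?fY - PP.expectation (\<lambda>z. indicator J (U (fst z)) * ?fY z)\<bar>
      = \<bar>PP.expectation (\<lambda>z. ?fY z - indicator J (U (fst z)) * ?fY z)\<bar>"
      using i by simp
    also have "\<dots> \<le> PP.expectation (\<lambda>z. \<bar>?fY z - indicator J (U (fst z)) * ?fY z\<bar>)"
      by (rule integral_abs_bound)
    also have "\<dots> \<le> PP.expectation (\<lambda>z. K * indicator {x. \<bar>x\<bar> \<ge> T} (U (fst z)))"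
      using i fK K0 J_cover by (intro integral_mono bint[of _ K]) (auto simp: indicator_def)
    also have "\<dots> = (\<integral>x. (\<integral>y. K * indicator {x. \<bar>x\<bar> \<ge> T} (U x) \<partial>M) \<partial>M)"
    proof -
      have "integrable ?P (\<lambda>z. K * indicator {x. \<bar>x\<bar> \<ge> T} (U (fst z)))"
        using K0 by (intro bint[of _ K]) (auto simp: indicator_def)
      from PP.integral_fst'[OF this] show ?thesis by (simp only: fst_conv)
    qed
    also have "\<dots> = (\<integral>x. K * indicator {\<omega>\<in>space M. \<bar>U \<omega>\<bar> \<ge> T} x \<partial>M)"
      by (intro Bochner_Integration.integral_cong) (auto simp: indicator_def prob_space)
    finally show ?thesis using tail by simp
  qed
  have "expectation (\<lambda>\<omega>. f (U' \<omega>, W \<omega>)) = PP.expectation ?fY" by (rule lawPP[OF f])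
  then show ?thesis using s1 s2 s3 t1 t2 by (simp add: algebra_simps abs_le_iff)
qed

section \<open>Stationary mixing processes and projections of the kernel\<close>

lemma vec_if_measurable:
  fixes f g :: "'b \<Rightarrow> nat \<Rightarrow> real" and t s :: "nat \<Rightarrow> nat" and e :: real
  assumes f: "\<And>i. (\<lambda>z. f z i) \<in> borel_measurable N" and g: "\<And>i. (\<lambda>z. g z i) \<in> borel_measurable N"
  shows "(\<lambda>z j. if j \<in> A then f z (t j) else if j \<in> B then g z (s j) else e) \<in> N \<rightarrow>\<^sub>M borel"
proof (rule measurable_coordinatewise_then_product)
  fix j
  show "(\<lambda>z. if j \<in> A then f z (t j) else if j \<in> B then g z (s j) else e) \<in> borel_measurable N"
    using f g by (cases "j \<in> A"; cases "j \<in> B") simp_all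
qed

text \<open>
  In this locale and its extensions, paths are made total by the value \<open>0\<close> at index \<open>0\<close>, so that they
  are elements of the Polish space \<^typ>\<open>nat \<Rightarrow> real\<close> with its Borel sets.
\<close>
locale stationary_process = prob_space M for M :: "'a measure" +
  fixes X :: "nat \<Rightarrow> 'a \<Rightarrow> real"
  assumes stationary: "stationary M X"
begin

lemma X_measurable: "n \<ge> 1 \<Longrightarrow> X n \<in> borel_measurable M"
  using stationary by (simp add: stationary_def)

definition shifted :: "nat \<Rightarrow> 'a \<Rightarrow> nat \<Rightarrow> real" where
  "shifted k \<omega> = (\<lambda>i. if 1 \<le> i then X (i + k) \<omega> else 0)"

lemma path_measurable: "path (\<lambda>i. X (i + k)) \<in> M \<rightarrow>\<^sub>M Pi\<^sub>M {1..} (\<lambda>_. borel)"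
  unfolding path_def by (rule measurable_restrict) (auto intro: X_measurable)

lemma shifted_measurable[measurable]: "shifted k \<in> borel_measurable M"
  unfolding shifted_def
proof (rule measurable_coordinatewise_then_product)
  fix i show "(\<lambda>\<omega>. if 1 \<le> i then X (i + k) \<omega> else 0) \<in> borel_measurable M"
    by (cases "1 \<le> i") (auto intro: X_measurable)
qed

lemma extension_measurable:
  "(\<lambda>f i. if i \<in> I then f (g i) else 0 :: real) \<in> Pi\<^sub>M J (\<lambda>_. borel) \<rightarrow>\<^sub>M borel"
  if "g ` I \<subseteq> J" for I :: "nat set" and g :: "nat \<Rightarrow> nat"
proof (rule measurable_coordinatewise_then_product)
  fix i show "(\<lambda>f. if i \<in> I then f (g i) else 0 :: real) \<in> borel_measurable (Pi\<^sub>M J (\<lambda>_. borel))"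
    using that by (cases "i \<in> I") (auto intro!: measurable_component_singleton)
qed

lemma shifted_law: "distr M borel (shifted k) = distr M borel (shifted 0)"
proof -
  let ?e = "\<lambda>(f :: nat \<Rightarrow> real) i. if i \<in> {1..} then f (id i) else 0"
  have e: "?e \<in> Pi\<^sub>M {1..} (\<lambda>_. borel) \<rightarrow>\<^sub>M borel"
    by (rule extension_measurable) auto
  have "distr M borel (shifted k) =
      distr (distr M (Pi\<^sub>M {1..} (\<lambda>_. borel)) (path (\<lambda>i. X (i + k)))) borel ?e" for k
    unfolding distr_distr[OF e path_measurable]
    by (rule distr_cong) (auto simp: shifted_def path_def)
  then show ?thesis
    using stationary by (simp add: stationary_def)
qed

lemma expectation_shift:
  fixes \<Phi> :: "(nat \<Rightarrow> real) \<Rightarrow> 'b::{banach, second_countable_topology}"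
  assumes [measurable]: "\<Phi> \<in> borel_measurable borel"
  shows "expectation (\<lambda>\<omega>. \<Phi> (shifted k \<omega>)) = expectation (\<lambda>\<omega>. \<Phi> (shifted 0 \<omega>))"
proof -
  have "expectation (\<lambda>\<omega>. \<Phi> (shifted k \<omega>)) = integral\<^sup>L (distr M borel (shifted k)) \<Phi>" for k
    by (rule integral_distr[symmetric]) auto
  then show ?thesis using shifted_law by metis
qed

lemma expectation_shift_one:
  fixes \<Phi> :: "real \<Rightarrow> 'b::{banach, second_countable_topology}"
  assumes "\<Phi> \<in> borel_measurable borel" "n \<ge> 1"
  shows "expectation (\<lambda>\<omega>. \<Phi> (X n \<omega>)) = expectation (\<lambda>\<omega>. \<Phi> (X 1 \<omega>))"
proof -
  have [measurable]: "\<Phi> \<in> borel_measurable borel" by fact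
  have "(\<lambda>\<xi>. \<Phi> (\<xi> (1::nat))) \<in> borel_measurable borel" by measurable
  from expectation_shift[OF this, of "n - 1"] show ?thesis
    using assms by (simp add: shifted_def)
qed

text \<open>
  The sigma-algebra \<^const>\<open>gen_field\<close> as a measure, so that measurability with respect to it can be
  composed.
\<close>
definition field_of :: "nat set \<Rightarrow> 'a measure" where
  "field_of I = sigma (space M) (\<Union>i\<in>I. {X i -` S \<inter> space M | S. S \<in> sets borel})"

lemma sets_field_of: "sets (field_of I) = gen_field M X I"
  unfolding field_of_def gen_field_def by (rule sets_measure_of) auto

lemma space_field_of[simp]: "space (field_of I) = space M"
  unfolding field_of_def by (rule space_measure_of) auto

lemma X_field_of: "i \<in> I \<Longrightarrow> X i \<in> field_of I \<rightarrow>\<^sub>M borel"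
  by (rule measurableI) (auto simp: sets_field_of gen_field_def)

lemma field_of_mono:
  assumes "f \<in> field_of I \<rightarrow>\<^sub>M N" "I \<subseteq> J" shows "f \<in> field_of J \<rightarrow>\<^sub>M N"
proof -
  have "sets (field_of I) \<subseteq> sets (field_of J)"
    unfolding sets_field_of gen_field_def using assms(2) by (intro sigma_sets_mono') auto
  then show ?thesis using assms(1) by (auto simp: measurable_def)
qed

lemma field_of_measurable:
  assumes "f \<in> field_of I \<rightarrow>\<^sub>M N" "I \<subseteq> {1..}" shows "f \<in> M \<rightarrow>\<^sub>M N"
proof -
  have "sets (field_of I) \<subseteq> sets M"
    unfolding sets_field_of gen_field_def using assms(2)
    by (intro sets.sigma_sets_subset) (auto intro!: measurable_sets[OF X_measurable])
  then show ?thesis using assms(1) by (auto simp: measurable_def)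
qed

lemma mixing_difference_le_1: "\<bar>prob (A \<inter> B) - prob A * prob B\<bar> \<le> 1"
proof -
  have "0 \<le> prob A * prob B" "prob A * prob B \<le> 1" by (auto intro: mult_le_one)
  then show ?thesis using prob_le_1[of "A \<inter> B"] measure_nonneg[of M "A \<inter> B"] by linarith
qed

lemma gen_field_nonempty: "gen_field M X I \<noteq> {}"
  unfolding gen_field_def using sigma_sets.Empty by blast

lemma mixing_inner_le_1:
  "(SUP (A, B) \<in> gen_field M X I \<times> gen_field M X J. \<bar>prob (A \<inter> B) - prob A * prob B\<bar>) \<le> 1"
  using gen_field_nonempty mixing_difference_le_1 by (intro cSUP_least) auto

lemma mixing_coeff_le_1: "mixing_coeff M X k \<le> 1"
  unfolding mixing_coeff_def by (intro cSUP_least mixing_inner_le_1) auto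

lemma alpha_bound_past_future:
  assumes n: "n \<ge> 1" and f: "f \<in> field_of {1..n} \<rightarrow>\<^sub>M N" and g: "g \<in> field_of {n + k..} \<rightarrow>\<^sub>M N'"
  shows "alpha_bound M N f N' g (mixing_coeff M X k)"
  unfolding alpha_bound_def
proof (intro conjI ballI)
  show "f \<in> M \<rightarrow>\<^sub>M N" using f by (rule field_of_measurable) auto
  show "g \<in> M \<rightarrow>\<^sub>M N'" using g n by (intro field_of_measurable[OF g]) auto
  fix A B assume "A \<in> sets N" "B \<in> sets N'"
  let ?A = "f -` A \<inter> space M" and ?B = "g -` B \<inter> space M"
  have A: "?A \<in> gen_field M X {1..n}" and B: "?B \<in> gen_field M X {n + k..}"
    using measurable_sets[OF f \<open>A \<in> sets N\<close>] measurable_sets[OF g \<open>B \<in> sets N'\<close>]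
    by (simp_all add: sets_field_of)
  let ?\<alpha> = "\<lambda>n. SUP (A, B) \<in> gen_field M X {1..n} \<times> gen_field M X {n + k..}. \<bar>prob (A \<inter> B) - prob A * prob B\<bar>"
  have "\<bar>prob (?A \<inter> ?B) - prob ?A * prob ?B\<bar> \<le> ?\<alpha> n"
    by (rule cSUP_upper2[where x="(?A, ?B)"]) (use A B mixing_difference_le_1 in \<open>auto intro!: bdd_aboveI2\<close>)
  also have "?\<alpha> n \<le> mixing_coeff M X k"
    unfolding mixing_coeff_def
    by (rule cSUP_upper) (use n mixing_inner_le_1 in \<open>auto intro!: bdd_aboveI2[where M=1]\<close>)
  finally show "\<bar>prob (?A \<inter> ?B) - prob ?A * prob ?B\<bar> \<le> mixing_coeff M X k" .
qed

lemma mixing_coeff_nonneg: "mixing_coeff M X k \<ge> 0"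
proof -
  have "alpha_bound M borel (\<lambda>_. 0::real) borel (\<lambda>_. 0::real) (mixing_coeff M X k)"
    by (rule alpha_bound_past_future[of 1]) auto
  then show ?thesis by (rule alpha_bound_nonneg)
qed

text \<open>
  The asymptotic bound holds from the lag \<open>1\<close> on after enlarging the constant, as the coefficients never
  exceed \<open>1\<close>.
\<close>
lemma mixing_polynomial_bound:
  assumes "mixing_coeff M X \<in> O(\<lambda>l. real l powr (- \<delta>))" and "\<delta> > 0"
  shows "\<exists>C>0. \<forall>l\<ge>1. mixing_coeff M X l \<le> C * real l powr (- \<delta>)"
proof -
  obtain c where c: "c > 0" "eventually (\<lambda>l. norm (mixing_coeff M X l) \<le> c * norm (real l powr (- \<delta>))) at_top"
    using landau_o.bigE[OF assms(1)] by blast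
  then obtain N where N: "\<And>l. l \<ge> N \<Longrightarrow> norm (mixing_coeff M X l) \<le> c * norm (real l powr (- \<delta>))"
    unfolding eventually_at_top_linorder by blast
  let ?C = "max c (real (Suc N) powr \<delta>)"
  have "mixing_coeff M X l \<le> ?C * real l powr (- \<delta>)" if l: "l \<ge> 1" for l
  proof (cases "l \<ge> N")
    case True
    then have "mixing_coeff M X l \<le> c * real l powr (- \<delta>)" using N[of l] by simp
    also have "\<dots> \<le> ?C * real l powr (- \<delta>)" by (intro mult_right_mono) auto
    finally show ?thesis .
  next
    case False
    have "1 = real l powr \<delta> * real l powr (- \<delta>)" using l by (simp add: powr_add[symmetric])
    also have "\<dots> \<le> ?C * real l powr (- \<delta>)"
      using l False assms(2) by (intro mult_right_mono) (auto intro!: max.coboundedI2 powr_mono2)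
    finally show ?thesis using mixing_coeff_le_1[of l] by linarith
  qed
  then show ?thesis using c(1) by (intro exI[of _ ?C]) auto
qed

end

locale u_statistic_setup = stationary_process M X for M :: "'a measure" and X +
  fixes Y :: "nat \<Rightarrow> 'a \<Rightarrow> real" and h :: "(nat \<Rightarrow> real) \<Rightarrow> real" and m :: nat
  assumes m_ge_2: "m \<ge> 2"
    and iid: "iid_copies M X Y"
    and symmetric: "symmetric_kernel m h"
    and bounded: "bounded_kernel m h"
begin

text \<open>
  Any positive bound of the kernel; a fixed one keeps it out of the statements.
\<close>
definition hbound :: real where
  "hbound = (SOME B. B > 0 \<and> (\<forall>x\<in>space (borel_vec m). \<bar>h x\<bar> \<le> B))"

lemma hbound: "hbound > 0" "x \<in> space (borel_vec m) \<Longrightarrow> \<bar>h x\<bar> \<le> hbound"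
proof -
  obtain B where B: "B > 0" "\<And>y. y \<in> h ` space (borel_vec m) \<Longrightarrow> norm y \<le> B"
    using bounded unfolding bounded_kernel_def bounded_pos by blast
  have "hbound > 0 \<and> (\<forall>x\<in>space (borel_vec m). \<bar>h x\<bar> \<le> hbound)"
    unfolding hbound_def by (rule someI[of _ B]) (use B in auto)
  then show "hbound > 0" "x \<in> space (borel_vec m) \<Longrightarrow> \<bar>h x\<bar> \<le> hbound" by auto
qed

text \<open>
  The kernel on total vectors, which form a Polish space, as the compactness argument requires.
\<close>
definition hh :: "(nat \<Rightarrow> real) \<Rightarrow> real" where
  "hh w = h (restrict w {1..m})"

lemma hh_measurable[measurable]: "hh \<in> borel_measurable borel"
proof -
  have "(\<lambda>w. restrict w {1..m}) \<in> borel \<rightarrow>\<^sub>M borel_vec m"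
    by (rule measurable_restrict) measurable
  moreover have "h \<in> borel_measurable (borel_vec m)"
    using symmetric by (simp add: symmetric_kernel_def)
  ultimately show ?thesis unfolding hh_def by (rule measurable_compose)
qed

lemma hh_bound: "\<bar>hh w\<bar> \<le> hbound"
  unfolding hh_def by (rule hbound(2)) (auto simp: space_PiM)

lemma hh_cong: "(\<And>j. 1 \<le> j \<Longrightarrow> j \<le> m \<Longrightarrow> w j = w' j) \<Longrightarrow> hh w = hh w'"
  unfolding hh_def by (rule arg_cong[where f=h]) (auto simp: restrict_def fun_eq_iff)

lemma hh_permute:
  assumes "p permutes {1..m}" shows "hh (w \<circ> p) = hh w"
proof -
  have "restrict (w \<circ> p) {1..m} = restrict w {1..m} \<circ> p"
    using permutes_in_image[OF assms] by (auto simp: fun_eq_iff restrict_def)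
  moreover have "restrict w {1..m} \<in> space (borel_vec m)" by (auto simp: space_PiM)
  ultimately show ?thesis
    using symmetric assms unfolding hh_def symmetric_kernel_def by metis
qed

definition yvec :: "(nat \<Rightarrow> nat) \<Rightarrow> 'a \<Rightarrow> nat \<Rightarrow> real" where
  "yvec \<tau> \<omega> = (\<lambda>j. if j \<in> {1..m} then Y (\<tau> j) \<omega> else 0)"

lemma Y_measurable: "n \<ge> 1 \<Longrightarrow> Y n \<in> borel_measurable M"
  using iid unfolding iid_copies_def indep_vars_def by auto

lemma yvec_measurable:
  assumes "\<tau> ` {1..m} \<subseteq> {1..}" shows "yvec \<tau> \<in> borel_measurable M"
  unfolding yvec_def
proof (rule measurable_coordinatewise_then_product)
  fix i show "(\<lambda>\<omega>. if i \<in> {1..m} then Y (\<tau> i) \<omega> else 0) \<in> borel_measurable M"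
  proof (cases "i \<in> {1..m}")
    case True
    then have "1 \<le> \<tau> i" using assms by (auto simp: image_subset_iff)
    then show ?thesis using True Y_measurable by simp
  next
    case False
    then show ?thesis by (simp only: if_False) simp
  qed
qed

lemma yvec_id_measurable[measurable]: "yvec id \<in> borel_measurable M"
  by (rule yvec_measurable) auto

lemma path_Y_measurable: "path Y \<in> M \<rightarrow>\<^sub>M Pi\<^sub>M {1..} (\<lambda>_. borel)"
  unfolding path_def by (rule measurable_restrict) (auto intro: Y_measurable)

text \<open>
  The copies are independent and identically distributed, so any selection of \<open>m\<close> different ones has
  the same joint law.
\<close>
lemma yvec_law:
  assumes \<tau>: "inj_on \<tau> {1..m}" "\<tau> ` {1..m} \<subseteq> {1..}"
  shows "distr M borel (yvec \<tau>) = distr M borel (yvec id)"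
proof -
  define \<mu> where "\<mu> = distr M borel (X 1)"
  interpret \<mu>: prob_space \<mu> unfolding \<mu>_def by (rule prob_space_distr) (simp add: X_measurable)
  have s\<mu>: "sets \<mu> = sets borel" unfolding \<mu>_def by simp
  have law: "distr M (Pi\<^sub>M {1..} (\<lambda>_. borel)) (path Y) = Pi\<^sub>M {1..} (\<lambda>_. \<mu>)"
  proof -
    have "indep_vars (\<lambda>_. borel) Y {1..}" using iid by (simp add: iid_copies_def)
    then have "distr M (Pi\<^sub>M {1..} (\<lambda>_. borel)) (path Y) = Pi\<^sub>M {1..} (\<lambda>i. distr M borel (Y i))"
      unfolding path_def by (subst (asm) indep_vars_iff_distr_eq_PiM') (auto intro: Y_measurable)
    also have "\<dots> = Pi\<^sub>M {1..} (\<lambda>_. \<mu>)"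
      using iid unfolding \<mu>_def by (intro PiM_cong) (auto simp: iid_copies_def)
    finally show ?thesis .
  qed
  let ?e = "\<lambda>(f :: nat \<Rightarrow> real) i. if i \<in> {1..m} then f (id i) else 0"
  have sP: "sets (Pi\<^sub>M J (\<lambda>_. \<mu>)) = sets (Pi\<^sub>M J (\<lambda>_. borel))" for J :: "nat set"
    by (intro sets_PiM_cong) (auto simp: s\<mu>)
  have e: "?e \<in> Pi\<^sub>M {1..m} (\<lambda>_. \<mu>) \<rightarrow>\<^sub>M borel"
    unfolding measurable_cong_sets[OF sP refl] by (rule extension_measurable) auto
  have *: "distr M borel (yvec \<tau>) = distr (Pi\<^sub>M {1..m} (\<lambda>_. \<mu>)) borel ?e"
    if \<tau>: "inj_on \<tau> {1..m}" "\<tau> ` {1..m} \<subseteq> {1..}" for \<tau>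
  proof -
    let ?r = "\<lambda>f. \<lambda>n\<in>{1..m}. f (\<tau> n)"
    have r: "?r \<in> Pi\<^sub>M {1..} (\<lambda>_. \<mu>) \<rightarrow>\<^sub>M Pi\<^sub>M {1..m} (\<lambda>_. \<mu>)"
      using \<tau>(2) by (intro measurable_restrict measurable_component_singleton) (auto simp: image_subset_iff)
    have pY: "path Y \<in> M \<rightarrow>\<^sub>M Pi\<^sub>M {1..} (\<lambda>_. \<mu>)"
      unfolding measurable_cong_sets[OF refl sP] by (rule path_Y_measurable)
    have "distr (Pi\<^sub>M {1..} (\<lambda>_. \<mu>)) (Pi\<^sub>M {1..m} (\<lambda>_. \<mu>)) ?r = Pi\<^sub>M {1..m} (\<lambda>_. \<mu>)"
      using distr_PiM_reindex[of "{1..}" "\<lambda>_. \<mu>" \<tau> "{1..m}"] \<tau> \<mu>.prob_space_axioms by auto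
    moreover have "distr M (Pi\<^sub>M {1..} (\<lambda>_. \<mu>)) (path Y) = Pi\<^sub>M {1..} (\<lambda>_. \<mu>)"
      unfolding law[symmetric] by (rule distr_cong) (simp_all add: sP)
    ultimately have "distr (Pi\<^sub>M {1..m} (\<lambda>_. \<mu>)) borel ?e
        = distr (distr (distr M (Pi\<^sub>M {1..} (\<lambda>_. \<mu>)) (path Y)) (Pi\<^sub>M {1..m} (\<lambda>_. \<mu>)) ?r) borel ?e"
      by (simp only:)
    also have "\<dots> = distr (distr M (Pi\<^sub>M {1..m} (\<lambda>_. \<mu>)) (?r \<circ> path Y)) borel ?e"
      by (simp only: distr_distr[OF r pY])
    also have "\<dots> = distr M borel (?e \<circ> (?r \<circ> path Y))"
      by (rule distr_distr[OF e measurable_comp[OF pY r]])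
    also have "?e \<circ> (?r \<circ> path Y) = yvec \<tau>"
    proof (intro ext)
      fix \<omega> j
      have "1 \<le> \<tau> j" if "j \<in> {1..m}" using \<tau>(2) that by (auto simp: image_subset_iff)
      then show "(?e \<circ> (?r \<circ> path Y)) \<omega> j = yvec \<tau> \<omega> j" by (simp add: yvec_def path_def)
    qed
    finally show ?thesis by simp
  qed
  have "inj_on id {1..m}" "id ` {1..m} \<subseteq> {1..}" by auto
  from *[OF this] show ?thesis using *[OF \<tau>] by (simp only:)
qed

lemma independent_shifted_yvec:
  assumes \<tau>: "\<tau> ` {1..m} \<subseteq> {1..}"
  shows "indep_var borel (shifted k) borel (yvec \<tau>)"
proof -
  have ind: "indep_var (Pi\<^sub>M {1..} (\<lambda>_. borel)) (path X) (Pi\<^sub>M {1..} (\<lambda>_. borel)) (path Y)"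
    using iid by (simp add: iid_copies_def)
  let ?s = "\<lambda>(f :: nat \<Rightarrow> real) i. if i \<in> {1..} then f ((\<lambda>i. i + k) i) else 0"
  let ?r = "\<lambda>(f :: nat \<Rightarrow> real) i. if i \<in> {1..m} then f (\<tau> i) else 0"
  have "?s \<in> Pi\<^sub>M {1..} (\<lambda>_. borel) \<rightarrow>\<^sub>M borel" by (rule extension_measurable) auto
  moreover have "?r \<in> Pi\<^sub>M {1..} (\<lambda>_. borel) \<rightarrow>\<^sub>M borel" by (rule extension_measurable) (rule \<tau>)
  ultimately have "indep_var borel (?s \<circ> path X) borel (?r \<circ> path Y)"
    by (rule indep_var_compose[OF ind])
  moreover have "?s \<circ> path X = shifted k" by (intro ext) (simp add: shifted_def path_def)
  moreover have "?r \<circ> path Y = yvec \<tau>"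
  proof (intro ext)
    fix \<omega> j
    have "1 \<le> \<tau> j" if "j \<in> {1..m}" using \<tau> that by (auto simp: image_subset_iff)
    then show "(?r \<circ> path Y) \<omega> j = yvec \<tau> \<omega> j" by (simp add: yvec_def path_def)
  qed
  ultimately show ?thesis by (simp only:)
qed

text \<open>
  Process and copies are independent, and each of the two laws is invariant: that of the process by
  stationarity, that of the copies by exchangeability.
\<close>
lemma joint_law:
  assumes \<tau>: "inj_on \<tau> {1..m}" "\<tau> ` {1..m} \<subseteq> {1..}"
  shows "distr M (borel \<Otimes>\<^sub>M borel) (\<lambda>\<omega>. (shifted k \<omega>, yvec \<tau> \<omega>)) =
    distr M borel (shifted 0) \<Otimes>\<^sub>M distr M borel (yvec id)"
proof -
  have "distr M borel (shifted k) \<Otimes>\<^sub>M distr M borel (yvec \<tau>) =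
      distr M (borel \<Otimes>\<^sub>M borel) (\<lambda>\<omega>. (shifted k \<omega>, yvec \<tau> \<omega>))"
    using independent_shifted_yvec[OF \<tau>(2), of k] unfolding indep_var_distribution_eq by blast
  then show ?thesis
    unfolding shifted_law[of k] yvec_law[OF \<tau>] by (rule sym)
qed

lemma id_image: "id ` {1..m} \<subseteq> {1..}" by auto

lemmas product_law = joint_law[OF inj_on_id id_image, of 0]

lemma alpha_bound_shifted_yvec: "alpha_bound M borel (shifted 0) borel (yvec id) 0"
  by (rule indep_var_imp_alpha_bound_0[OF independent_shifted_yvec[OF id_image]])

lemmas product_law' = alpha_bound_0_imp_product_law[OF alpha_bound_commute[OF alpha_bound_shifted_yvec]]

lemma vec_mix_measurable:
  fixes f g :: "'b \<Rightarrow> nat \<Rightarrow> real" and t s :: "nat \<Rightarrow> nat"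
  assumes f: "f \<in> N \<rightarrow>\<^sub>M borel" and g: "g \<in> N \<rightarrow>\<^sub>M borel"
  shows "(\<lambda>z j. if j \<in> A then f z (t j) else g z (s j) :: real) \<in> N \<rightarrow>\<^sub>M borel"
proof (rule measurable_coordinatewise_then_product)
  fix j
  show "(\<lambda>z. if j \<in> A then f z (t j) else g z (s j)) \<in> borel_measurable N"
    using measurable_product_then_coordinatewise[OF f] measurable_product_then_coordinatewise[OF g]
    by (cases "j \<in> A") simp_all
qed

text \<open>
  The Hoeffding projection of the kernel on the coordinates in \<open>A\<close>, without centring.
\<close>
definition proj :: "nat set \<Rightarrow> (nat \<Rightarrow> real) \<Rightarrow> real" where
  "proj A x = expectation (\<lambda>\<omega>. hh (\<lambda>j. if j \<in> A then x j else yvec id \<omega> j))"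

lemma proj_measurable[measurable]: "proj A \<in> borel_measurable borel"
  unfolding proj_def
proof (rule borel_measurable_lebesgue_integral)
  have "(\<lambda>z j. if j \<in> A then fst z j else yvec id (snd z) j) \<in> (borel :: (nat \<Rightarrow> real) measure) \<Otimes>\<^sub>M M \<rightarrow>\<^sub>M borel"
    by (rule vec_mix_measurable) measurable
  then have "(\<lambda>z. hh (\<lambda>j. if j \<in> A then fst z j else yvec id (snd z) j)) \<in> borel_measurable (borel \<Otimes>\<^sub>M M)"
    by (rule measurable_compose[OF _ hh_measurable])
  then show "(\<lambda>(x, \<omega>). hh (\<lambda>j. if j \<in> A then x j else yvec id \<omega> j)) \<in> borel_measurable (borel \<Otimes>\<^sub>M M)"
    by (simp add: case_prod_beta')
qed

lemma proj_bound: "\<bar>proj A x\<bar> \<le> hbound"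
proof -
  have "\<bar>proj A x\<bar> \<le> expectation (\<lambda>\<omega>. \<bar>hh (\<lambda>j. if j \<in> A then x j else yvec id \<omega> j)\<bar>)"
    unfolding proj_def by (rule integral_abs_bound)
  also have "\<dots> \<le> hbound"
  proof (rule integral_le_const)
    have "(\<lambda>\<omega> j. if j \<in> A then (\<lambda>_. x) \<omega> j else yvec id \<omega> j) \<in> M \<rightarrow>\<^sub>M borel"
      by (rule vec_mix_measurable) measurable
    then have "(\<lambda>\<omega>. hh (\<lambda>j. if j \<in> A then x j else yvec id \<omega> j)) \<in> borel_measurable M"
      by (rule measurable_compose[OF _ hh_measurable])
    then show "integrable M (\<lambda>\<omega>. \<bar>hh (\<lambda>j. if j \<in> A then x j else yvec id \<omega> j)\<bar>)"
      by (intro integrable_abs integrable_const_bound[where B=hbound]) (auto simp: hh_bound)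
  qed (auto simp: hh_bound)
  finally show ?thesis .
qed

lemma proj_cong: "(\<And>j. j \<in> A \<Longrightarrow> 1 \<le> j \<Longrightarrow> j \<le> m \<Longrightarrow> x j = x' j) \<Longrightarrow> proj A x = proj A x'"
  unfolding proj_def by (intro Bochner_Integration.integral_cong refl hh_cong) auto

text \<open>
  Fubini's theorem: the copies are independent of the process and occur in the first factor only.
\<close>
lemma expectation_proj:
  assumes [measurable]: "Q \<in> borel_measurable borel" and Q: "\<And>\<xi>. \<bar>Q \<xi>\<bar> \<le> B"
  shows "expectation (\<lambda>\<omega>. proj A (\<lambda>j. shifted 0 \<omega> (t j)) * Q (shifted 0 \<omega>)) =
    expectation (\<lambda>\<omega>. hh (\<lambda>j. if j \<in> A then shifted 0 \<omega> (t j) else yvec id \<omega> j) * Q (shifted 0 \<omega>))"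
proof -
  interpret PP: pair_prob_space M M ..
  define G where "G z = hh (\<lambda>j. if j \<in> A then fst z (t j) else snd z j) * Q (fst z)" for z
  have [measurable]: "(\<lambda>z. hh (\<lambda>j. if j \<in> A then fst z (t j) else snd z j)) \<in> borel_measurable (borel \<Otimes>\<^sub>M borel)"
    by (rule measurable_compose[OF _ hh_measurable], rule vec_mix_measurable) measurable
  have G[measurable]: "G \<in> borel_measurable (borel \<Otimes>\<^sub>M borel)" unfolding G_def by measurable
  have "integrable (M \<Otimes>\<^sub>M M) (\<lambda>z. G (shifted 0 (fst z), yvec id (snd z)))"
    using hh_bound Q hbound(1) by (intro PP.P.integrable_const_bound[where B="hbound * B"])
      (auto simp: G_def abs_mult intro!: mult_mono)
  note int = PP.integral_fst'[OF this]
  have "expectation (\<lambda>\<omega>. G (shifted 0 \<omega>, yvec id \<omega>)) = (\<integral>z. G (shifted 0 (fst z), yvec id (snd z)) \<partial>(M \<Otimes>\<^sub>M M))"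
    by (rule expectation_product_law[OF _ _ _ _ product_law]) measurable
  also have "\<dots> = expectation (\<lambda>x. expectation (\<lambda>y. G (shifted 0 x, yvec id y)))"
    using int by simp
  finally show ?thesis unfolding G_def proj_def fst_conv snd_conv by simp
qed

end

section \<open>The variation condition for arbitrary arrangements of coordinates\<close>

locale u_statistic_mixing = u_statistic_setup M X Y h m
  for M :: "'a measure" and X Y :: "nat \<Rightarrow> 'a \<Rightarrow> real" and h :: "(nat \<Rightarrow> real) \<Rightarrow> real" and m :: nat +
  fixes \<rho> \<delta> :: real
  assumes variation: "extended_variation_condition M X Y m h"
    and \<rho>_pos: "\<rho> > 0"
    and moment: "integrable M (\<lambda>\<omega>. \<bar>X 1 \<omega>\<bar> powr \<rho>)"
    and \<delta>: "\<delta> > (2 * \<rho> + 1) / \<rho>"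
    and mixing_rate: "mixing_coeff M X \<in> O(\<lambda>l. real l powr (- \<delta>))"
begin

text \<open>
  The two parts of the extended variation condition in one form.  For \<open>k = 1\<close> no value of the process is
  involved, and moving the first coordinate by \<open>d\<close> is a special case of moving the vector by \<open>d\<close>.
\<close>
lemma one_coordinate_variation:
  "\<exists>L d0. L > 0 \<and> d0 > 0 \<and> (\<forall>d k i.
     0 < d \<and> d < d0 \<and> 1 \<le> k \<and> k \<le> m \<and> i ` {1..m} \<subseteq> {1..} \<and> strict_mono_on {1..m} i \<and>
     (k = 1 \<longrightarrow> i = id) \<longrightarrow>
       (\<integral>\<^sup>+\<omega>. (SUP x\<in>{x. \<bar>x - Y (i 1) \<omega>\<bar> \<le> d}.
                 ennreal \<bar>h (mixed_arg m k i X Y \<omega> x)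
                          - h (mixed_arg m k i X Y \<omega> (Y (i 1) \<omega>))\<bar>) \<partial>M) \<le> ennreal (L * d))"
proof -
  obtain L1 \<epsilon>0 where \<epsilon>0: "\<epsilon>0 > 0" and vc: "\<And>\<epsilon>. 0 < \<epsilon> \<Longrightarrow> \<epsilon> < \<epsilon>0 \<Longrightarrow>
        (\<integral>\<^sup>+\<omega>. (SUP x\<in>{x \<in> space (borel_vec m). L2_set (\<lambda>j. x j - Y j \<omega>) {1..m} \<le> \<epsilon>}.
                 ennreal \<bar>h x - h (\<lambda>j\<in>{1..m}. Y j \<omega>)\<bar>) \<partial>M) \<le> ennreal (L1 * \<epsilon>)"
    using variation unfolding extended_variation_condition_def variation_condition_def by blast
  obtain L2 \<delta>0 where L2: "L2 > 0" "\<delta>0 > 0" and evc: "\<And>\<delta> k i.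
        0 < \<delta> \<and> \<delta> < \<delta>0 \<and> 2 \<le> k \<and> k \<le> m \<and> i ` {1..m} \<subseteq> {1..} \<and> strict_mono_on {1..m} i \<longrightarrow>
        (\<integral>\<^sup>+\<omega>. (SUP x\<in>{x. \<bar>x - Y (i 1) \<omega>\<bar> \<le> \<delta>}.
                 ennreal \<bar>h (mixed_arg m k i X Y \<omega> x)
                          - h (mixed_arg m k i X Y \<omega> (Y (i 1) \<omega>))\<bar>) \<partial>M) \<le> ennreal (L2 * \<delta>)"
    using variation unfolding extended_variation_condition_def by blast
  have "(\<integral>\<^sup>+\<omega>. (SUP x\<in>{x. \<bar>x - Y (i 1) \<omega>\<bar> \<le> d}.
                 ennreal \<bar>h (mixed_arg m k i X Y \<omega> x)
                          - h (mixed_arg m k i X Y \<omega> (Y (i 1) \<omega>))\<bar>) \<partial>M) \<le> ennreal (max L1 L2 * d)"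
    if A: "0 < d" "d < min \<epsilon>0 \<delta>0" "1 \<le> k" "k \<le> m" "i ` {1..m} \<subseteq> {1..}" "strict_mono_on {1..m} i"
      "k = 1 \<longrightarrow> i = id" for d k i
  proof (cases "k = 1")
    case False
    have "(\<integral>\<^sup>+\<omega>. (SUP x\<in>{x. \<bar>x - Y (i 1) \<omega>\<bar> \<le> d}.
                 ennreal \<bar>h (mixed_arg m k i X Y \<omega> x)
                          - h (mixed_arg m k i X Y \<omega> (Y (i 1) \<omega>))\<bar>) \<partial>M) \<le> ennreal (L2 * d)"
      using evc[of d k i] A False by simp
    also have "\<dots> \<le> ennreal (max L1 L2 * d)"
      using A by (intro ennreal_leI mult_right_mono) auto
    finally show ?thesis .
  next
    case True
    then have i: "i = id" using A by simp
    let ?v = "\<lambda>\<omega> x. \<lambda>j\<in>{1..m}. if j = 1 then x else Y j \<omega>"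
    have mx: "mixed_arg m k i X Y \<omega> x = ?v \<omega> x" for \<omega> x
      unfolding mixed_arg_def True i by (auto simp: fun_eq_iff restrict_def)
    have my: "mixed_arg m k i X Y \<omega> (Y (i 1) \<omega>) = (\<lambda>j\<in>{1..m}. Y j \<omega>)" for \<omega>
      unfolding mixed_arg_def True i by (auto simp: fun_eq_iff restrict_def)
    have "(\<integral>\<^sup>+\<omega>. (SUP x\<in>{x. \<bar>x - Y (i 1) \<omega>\<bar> \<le> d}.
                 ennreal \<bar>h (mixed_arg m k i X Y \<omega> x)
                          - h (mixed_arg m k i X Y \<omega> (Y (i 1) \<omega>))\<bar>) \<partial>M)
       \<le> (\<integral>\<^sup>+\<omega>. (SUP x\<in>{x \<in> space (borel_vec m). L2_set (\<lambda>j. x j - Y j \<omega>) {1..m} \<le> d}.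
                 ennreal \<bar>h x - h (\<lambda>j\<in>{1..m}. Y j \<omega>)\<bar>) \<partial>M)"
    proof (intro nn_integral_mono SUP_least)
      fix \<omega> x assume "x \<in> {x. \<bar>x - Y (i 1) \<omega>\<bar> \<le> d}"
      then have x: "\<bar>x - Y 1 \<omega>\<bar> \<le> d" using i by simp
      have "L2_set (\<lambda>j. ?v \<omega> x j - Y j \<omega>) {1..m} = L2_set (\<lambda>j. if j = 1 then x - Y 1 \<omega> else 0) {1..m}"
        by (rule L2_set_cong) auto
      also have "\<dots> = sqrt (\<Sum>j\<in>{1..m}. if j = 1 then (x - Y 1 \<omega>)\<^sup>2 else 0)"
        unfolding L2_set_def by (intro arg_cong[where f=sqrt] sum.cong) auto
      also have "\<dots> = \<bar>x - Y 1 \<omega>\<bar>" using m_ge_2 by simp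
      finally have "?v \<omega> x \<in> {x \<in> space (borel_vec m). L2_set (\<lambda>j. x j - Y j \<omega>) {1..m} \<le> d}"
        using x by (auto simp: space_PiM)
      then show "ennreal \<bar>h (mixed_arg m k i X Y \<omega> x) - h (mixed_arg m k i X Y \<omega> (Y (i 1) \<omega>))\<bar>
         \<le> (SUP x\<in>{x \<in> space (borel_vec m). L2_set (\<lambda>j. x j - Y j \<omega>) {1..m} \<le> d}.
                 ennreal \<bar>h x - h (\<lambda>j\<in>{1..m}. Y j \<omega>)\<bar>)"
        unfolding my unfolding mx by (intro SUP_upper2[where i="?v \<omega> x"]) auto
    qed
    also have "\<dots> \<le> ennreal (L1 * d)" using vc[of d] A by simp
    also have "\<dots> \<le> ennreal (max L1 L2 * d)"
      using A by (intro ennreal_leI mult_right_mono) auto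
    finally show ?thesis .
  qed
  then show ?thesis using L2 \<epsilon>0
    by (intro exI[of _ "max L1 L2"] exI[of _ "min \<epsilon>0 \<delta>0"]) auto
qed

text \<open>
  A rearrangement of the arguments that puts the coordinate \<open>c\<close> first, the other coordinates of \<open>A\<close> next
  in their order, and the rest last.
\<close>
lemma arrangement_permutation:
  assumes A: "A \<subseteq> {1..m}" "c \<in> A"
  obtains p where "p permutes {1..m}" "p 1 = c" "p ` {2..card A} = A - {c}"
    "strict_mono_on {2..card A} p"
proof -
  have fin: "finite A" using A finite_subset by blast
  define k where "k = card A"
  have k: "1 \<le> k" "k \<le> m"
    using A fin card_mono[of "{1..m}" A] card_gt_0_iff[of A] unfolding k_def by (auto simp: Suc_le_eq)
  have cA: "card (A - {c}) = k - 1" using A fin k_def by simp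
  obtain q where q: "bij_betw q {..<k - 1} (A - {c})" "strict_mono_on {..<k - 1} q"
    using ex_bij_betw_strict_mono_card[of "A - {c}"] fin cA by auto
  have "card {k + 1..m} = card ({1..m} - A)" using A fin k by (simp add: card_Diff_subset k_def)
  then obtain r where r: "bij_betw r {k + 1..m} ({1..m} - A)"
    using finite_same_card_bij[of "{k + 1..m}" "{1..m} - A"] by auto
  have q2: "bij_betw (\<lambda>j. q (j - 2)) {2..k} (A - {c})"
  proof -
    have "bij_betw (\<lambda>j. j - 2) {2..k} {..<k - 1}"
      by (rule bij_betw_byWitness[where f'="\<lambda>j. j + 2"]) auto
    from bij_betw_trans[OF this q(1)] show ?thesis by (simp add: comp_def)
  qed
  define p where "p j = (if j = 1 then c else if j \<in> {2..k} then q (j - 2) else if j \<in> {k + 1..m} then r j else j)" for j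
  have b1: "bij_betw p {1} {c}" by (auto simp: bij_betw_def p_def)
  have b2: "bij_betw p {2..k} (A - {c})"
    using q2 by (rule bij_betw_cong[THEN iffD1, rotated]) (auto simp: p_def)
  have b3: "bij_betw p {k + 1..m} ({1..m} - A)"
    using r by (rule bij_betw_cong[THEN iffD1, rotated]) (use k in \<open>auto simp: p_def\<close>)
  have "bij_betw p ({1} \<union> {2..k}) ({c} \<union> (A - {c}))" by (rule bij_betw_combine[OF b1 b2]) auto
  then have "bij_betw p (({1} \<union> {2..k}) \<union> {k + 1..m}) (({c} \<union> (A - {c})) \<union> ({1..m} - A))"
    by (rule bij_betw_combine[OF _ b3]) (use A in auto)
  moreover have "({1} \<union> {2..k}) \<union> {k + 1..m} = {1..m}" using k by auto
  moreover have "({c} \<union> (A - {c})) \<union> ({1..m} - A) = {1..m}" using A by auto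
  ultimately have "bij_betw p {1..m} {1..m}" by simp
  then have "p permutes {1..m}" by (rule bij_imp_permutes) (use k in \<open>auto simp: p_def\<close>)
  moreover have "strict_mono_on {2..k} p"
  proof (rule strict_mono_onI)
    fix a b assume ab: "a \<in> {2..k}" "b \<in> {2..k}" "a < b"
    then have "q (a - 2) < q (b - 2)" by (intro strict_mono_onD[OF q(2)]) auto
    then show "p a < p b" using ab unfolding p_def by auto
  qed
  moreover have "p ` {2..k} = A - {c}" using b2 by (simp add: bij_betw_def)
  ultimately show ?thesis using that[of p] unfolding k_def by (simp add: p_def)
qed

text \<open>
  The hypothesis speaks about increasing times of which the first belongs to the varying copy.  A
  coordinate \<open>c\<close> in any position among the times \<open>t\<close> is covered as well: by symmetry of the kernel the
  arguments may be rearranged, and by stationarity and exchangeability the joint law of the varying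
  copy, the process values and the other copies does not depend on the position.  Equality of laws may be used
  because \<open>\<phi>\<close> is measurable, unlike the supremum in the hypothesis.
\<close>
lemma variation_transfer:
  "\<exists>L d0. L > 0 \<and> d0 > 0 \<and> (\<forall>A c t d \<phi>.
     A \<subseteq> {1..m} \<and> c \<in> A \<and> strict_mono_on {1..m} t \<and> (\<forall>j\<in>{1..m}. 1 \<le> t j) \<and> 0 < d \<and> d < d0 \<and>
     \<phi> \<in> borel_measurable borel \<and> (\<forall>z. 0 \<le> \<phi> z) \<and>
     (\<forall>y w. \<exists>x. \<bar>x - y\<bar> \<le> d \<and> \<phi> (y, w) \<le> hbound * \<bar>hh (w(c := x)) - hh (w(c := y))\<bar>) \<longrightarrow>
     expectation (\<lambda>\<omega>. \<phi> (yvec id \<omega> c, \<lambda>j. if j \<in> A - {c} then shifted 0 \<omega> (t j) else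
        if j \<in> {1..m} - {c} then yvec id \<omega> j else 0)) \<le> hbound * (L * d))"
proof -
  from one_coordinate_variation obtain L d0 where L: "L > 0" "d0 > 0" and var: "\<forall>d k i.
     0 < d \<and> d < d0 \<and> 1 \<le> k \<and> k \<le> m \<and> i ` {1..m} \<subseteq> {1..} \<and> strict_mono_on {1..m} i \<and>
     (k = 1 \<longrightarrow> i = id) \<longrightarrow>
       (\<integral>\<^sup>+\<omega>. (SUP x\<in>{x. \<bar>x - Y (i 1) \<omega>\<bar> \<le> d}.
                 ennreal \<bar>h (mixed_arg m k i X Y \<omega> x)
                          - h (mixed_arg m k i X Y \<omega> (Y (i 1) \<omega>))\<bar>) \<partial>M) \<le> ennreal (L * d)"
    by (elim exE conjE)
  have "expectation (\<lambda>\<omega>. \<phi> (yvec id \<omega> c, \<lambda>j. if j \<in> A - {c} then shifted 0 \<omega> (t j) else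
        if j \<in> {1..m} - {c} then yvec id \<omega> j else 0)) \<le> hbound * (L * d)"
    if A: "A \<subseteq> {1..m}" "c \<in> A" and t: "strict_mono_on {1..m} t" "\<And>j. j \<in> {1..m} \<Longrightarrow> 1 \<le> t j"
      and d: "0 < d" "d < d0" and \<phi>[measurable]: "\<phi> \<in> borel_measurable borel" and \<phi>0: "\<And>z. 0 \<le> \<phi> z"
      and \<phi>x: "\<And>y w. \<exists>x. \<bar>x - y\<bar> \<le> d \<and> \<phi> (y, w) \<le> hbound * \<bar>hh (w(c := x)) - hh (w(c := y))\<bar>"
    for A c t d \<phi>
  proof -
    obtain p where p: "p permutes {1..m}" "p 1 = c" "p ` {2..card A} = A - {c}"
      "strict_mono_on {2..card A} p" by (rule arrangement_permutation[OF A])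
    define k where "k = card A"
    have fin: "finite A" using A finite_subset by blast
    have k: "1 \<le> k" "k \<le> m"
      using A fin card_mono[of "{1..m}" A] card_gt_0_iff[of A] unfolding k_def by (auto simp: Suc_le_eq)
    have pin: "p j \<in> {1..m} \<longleftrightarrow> j \<in> {1..m}" for j using permutes_in_image[OF p(1)] .
    have pinv: "inv p (p j) = j" "p (inv p j) = j" for j using permutes_inverses[OF p(1)] by auto
    have pinvin: "inv p j \<in> {1..m} \<longleftrightarrow> j \<in> {1..m}" for j using pin[of "inv p j"] pinv by simp
    have pA: "p j \<in> A - {c} \<longleftrightarrow> j \<in> {2..k}" for j
    proof
      assume "p j \<in> A - {c}"
      then have "p j \<in> p ` {2..k}" using p(3) unfolding k_def by simp
      then obtain j' where "j' \<in> {2..k}" "p j = p j'" by blast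
      then show "j \<in> {2..k}" using pinv by metis
    qed (use p(3) k_def in auto)
    have cm: "c \<in> {1..m}" using A by auto
    \<comment> \<open>Times for which the hypothesis speaks about the same joint law: the process is shifted by one
      to make room for the index \<open>1\<close> of the varying copy, and the remaining copies get late indices.\<close>
    define i where "i j = (if k = 1 then j else if j = 1 then 1 else if j \<le> k then t (p j) + 1 else t m + 1 + j)" for j
    have imono: "strict_mono_on {1..m} i"
    proof (rule strict_mono_onI)
      fix a b assume ab: "a \<in> {1..m}" "b \<in> {1..m}" "a < b"
      have pa: "p a \<in> {1..m}" "p b \<in> {1..m}" using ab pin by auto
      have tp: "t (p a) < t (p b)" if "a \<in> {2..k}" "b \<in> {2..k}"
      proof -
        have "p a < p b" by (rule strict_mono_onD[OF p(4)]) (use that ab k_def in simp_all)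
        then show ?thesis by (rule strict_mono_onD[OF t(1) pa])
      qed
      have tm: "t j \<le> t m" if "j \<in> {1..m}" for j
        using strict_mono_on_leD[OF t(1), of j m] that by simp
      consider "k = 1" | "k \<noteq> 1" "a = 1" "b \<le> k" | "k \<noteq> 1" "a = 1" "b > k"
        | "k \<noteq> 1" "a \<noteq> 1" "b \<le> k" | "k \<noteq> 1" "a \<noteq> 1" "a \<le> k" "b > k" | "k \<noteq> 1" "a \<noteq> 1" "a > k"
        using not_le_imp_less by metis
      then show "i a < i b"
      proof cases
        case 2
        then show ?thesis using t(2)[OF pa(2)] ab unfolding i_def by simp
      next
        case 4
        then have "t (p a) < t (p b)" using ab by (intro tp) auto
        then show ?thesis using 4 ab unfolding i_def by simp
      next
        case 5
        then show ?thesis using tm[OF pa(1)] ab unfolding i_def by simp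
      qed (use ab in \<open>simp_all add: i_def\<close>)
    qed
    have iin: "i ` {1..m} \<subseteq> {1..}" unfolding i_def by auto
    have k1: "k = 1 \<Longrightarrow> i = id" unfolding i_def by auto
    define \<Theta> where "\<Theta> z = (snd z 1, \<lambda>j. if j \<in> A - {c} then fst z (t j) else
        if j \<in> {1..m} - {c} then snd z (inv p j) else 0)" for z :: "(nat \<Rightarrow> real) \<times> (nat \<Rightarrow> real)"
    have \<Theta>m[measurable]: "\<Theta> \<in> borel \<Otimes>\<^sub>M borel \<rightarrow>\<^sub>M borel"
    proof -
      have "(\<lambda>z :: (nat \<Rightarrow> real) \<times> (nat \<Rightarrow> real). \<lambda>j. if j \<in> A - {c} then fst z (t j) else
        if j \<in> {1..m} - {c} then snd z (inv p j) else 0) \<in> borel \<Otimes>\<^sub>M borel \<rightarrow>\<^sub>M borel"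
        by (intro vec_if_measurable measurable_product_then_coordinatewise[OF measurable_fst]
          measurable_product_then_coordinatewise[OF measurable_snd])
      moreover have "(\<lambda>z :: (nat \<Rightarrow> real) \<times> (nat \<Rightarrow> real). snd z 1) \<in> borel \<Otimes>\<^sub>M borel \<rightarrow>\<^sub>M borel"
        by (rule measurable_product_then_coordinatewise[OF measurable_snd])
      ultimately show ?thesis
        unfolding \<Theta>_def borel_prod[symmetric] by (rule measurable_Pair[rotated])
    qed
    have pimg: "p ` {1..m} \<subseteq> {1..}" "inj_on p {1..m}"
      using p(1) permutes_image[OF p(1)] by (auto simp: permutes_inj_on)
    have iinj: "inj_on i {1..m}" using imono by (rule strict_mono_on_imp_inj_on)
    note yp = yvec_measurable[OF pimg(1)] and yi = yvec_measurable[OF iin]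
    define \<psi> where "\<psi> \<omega> = \<phi> (\<Theta> (shifted 1 \<omega>, yvec i \<omega>)) / hbound" for \<omega>
    have \<psi>m: "\<psi> \<in> borel_measurable M" unfolding \<psi>_def using yi by measurable
    have \<Theta>p: "\<Theta> (shifted 0 \<omega>, yvec p \<omega>) = (yvec id \<omega> c, \<lambda>j. if j \<in> A - {c} then shifted 0 \<omega> (t j) else
        if j \<in> {1..m} - {c} then yvec id \<omega> j else 0)" for \<omega>
    proof -
      have "yvec p \<omega> 1 = yvec id \<omega> c" using cm m_ge_2 p(2) by (simp add: yvec_def)
      moreover have "yvec p \<omega> (inv p j) = yvec id \<omega> j" for j
        using pinvin[of j] pinv by (simp add: yvec_def)
      ultimately show ?thesis unfolding \<Theta>_def fst_conv snd_conv by (simp only:)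
    qed
    have "expectation (\<lambda>\<omega>. \<phi> (\<Theta> (shifted 0 \<omega>, yvec p \<omega>))) = expectation (\<lambda>\<omega>. \<phi> (\<Theta> (shifted 1 \<omega>, yvec i \<omega>)))"
    proof -
      have "expectation (\<lambda>\<omega>. \<phi> (\<Theta> (shifted k' \<omega>, yvec \<tau> \<omega>))) =
         integral\<^sup>L (distr M borel (shifted 0) \<Otimes>\<^sub>M distr M borel (yvec id)) (\<lambda>z. \<phi> (\<Theta> z))"
        if \<tau>: "inj_on \<tau> {1..m}" "\<tau> ` {1..m} \<subseteq> {1..}" for k' \<tau>
      proof -
        have [measurable]: "yvec \<tau> \<in> borel_measurable M" by (rule yvec_measurable[OF \<tau>(2)])
        show ?thesis unfolding joint_law[OF \<tau>, of k', symmetric] by (subst integral_distr) auto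
      qed
      from this[OF pimg(2,1), of 0] this[OF iinj iin, of 1] show ?thesis by (simp only:)
    qed
    also have "\<dots> = hbound * expectation \<psi>" unfolding \<psi>_def using hbound(1) by simp
    also have "expectation \<psi> \<le> L * d"
    proof -
      have "(\<integral>\<^sup>+\<omega>. ennreal (\<psi> \<omega>) \<partial>M) \<le> (\<integral>\<^sup>+\<omega>. (SUP x\<in>{x. \<bar>x - Y (i 1) \<omega>\<bar> \<le> d}.
                 ennreal \<bar>h (mixed_arg m k i X Y \<omega> x)
                          - h (mixed_arg m k i X Y \<omega> (Y (i 1) \<omega>))\<bar>) \<partial>M)"
      proof (rule nn_integral_mono)
        fix \<omega>
        obtain y w where yw: "\<Theta> (shifted 1 \<omega>, yvec i \<omega>) = (y, w)" by fastforce
        then have y': "y = yvec i \<omega> 1" and w: "w = (\<lambda>j. if j \<in> A - {c} then shifted 1 \<omega> (t j) else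
        if j \<in> {1..m} - {c} then yvec i \<omega> (inv p j) else 0)"
          unfolding \<Theta>_def fst_conv snd_conv by (simp_all only: prod.inject)
        have y: "y = Y (i 1) \<omega>" using m_ge_2 y' by (simp add: yvec_def)
        obtain x where x: "\<bar>x - y\<bar> \<le> d" "\<phi> (y, w) \<le> hbound * \<bar>hh (w(c := x)) - hh (w(c := y))\<bar>"
          using \<phi>x by blast
        have hm: "hh (w(c := s)) = h (mixed_arg m k i X Y \<omega> s)" for s
        proof -
          have "hh (w(c := s)) = hh ((w(c := s)) \<circ> p)" by (rule hh_permute[OF p(1), symmetric])
          also have "restrict ((w(c := s)) \<circ> p) {1..m} = mixed_arg m k i X Y \<omega> s"
          proof
            fix j
            show "restrict ((w(c := s)) \<circ> p) {1..m} j = mixed_arg m k i X Y \<omega> s j"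
            proof (cases "j \<in> {1..m}")
              case True
              show ?thesis
              proof (cases "j = 1")
                case False
                then have pc: "p j \<noteq> c" using p(2) pinv by metis
                have pm: "p j \<in> {1..m}" using True pin by simp
                have lhs: "restrict ((w(c := s)) \<circ> p) {1..m} j = w (p j)" using True pc by simp
                show ?thesis
                proof (cases "j \<le> k")
                  case jk: True
                  have j2: "j \<in> {2..k}" using jk True False by auto
                  then have "p j \<in> A - {c}" using pA by blast
                  then have "w (p j) = X (t (p j) + 1) \<omega>"
                    using t(2)[OF pm] unfolding w by (simp add: shifted_def)
                  also have "t (p j) + 1 = i j" using j2 False unfolding i_def by simp
                  finally show ?thesis unfolding lhs using True False jk by (simp add: mixed_arg_def)
                next
                  case jk: False
                  then have "p j \<notin> A - {c}" using pA[of j] by simp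
                  then have "w (p j) = yvec i \<omega> j"
                    using pm pc pinv(1)[of j] unfolding w by simp
                  also have "\<dots> = Y (i j) \<omega>" using True by (simp add: yvec_def)
                  finally show ?thesis unfolding lhs using True False jk by (simp add: mixed_arg_def)
                qed
              next
                case j1: True
                then show ?thesis using True p(2) by (simp add: mixed_arg_def)
              qed
            next
              case False
              then show ?thesis unfolding mixed_arg_def restrict_def by (simp only: if_False)
            qed
          qed
          then have "hh ((w(c := s)) \<circ> p) = h (mixed_arg m k i X Y \<omega> s)" unfolding hh_def by (simp only:)
          finally show ?thesis .
        qed
        have "\<psi> \<omega> \<le> \<bar>h (mixed_arg m k i X Y \<omega> x) - h (mixed_arg m k i X Y \<omega> (Y (i 1) \<omega>))\<bar>"
          unfolding \<psi>_def yw using x(2) hbound(1) unfolding hm y by (simp add: field_simps)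
        then show "ennreal (\<psi> \<omega>) \<le> (SUP x\<in>{x. \<bar>x - Y (i 1) \<omega>\<bar> \<le> d}.
                 ennreal \<bar>h (mixed_arg m k i X Y \<omega> x)
                          - h (mixed_arg m k i X Y \<omega> (Y (i 1) \<omega>))\<bar>)"
          using x(1) unfolding y by (intro SUP_upper2[where i=x] ennreal_leI) auto
      qed
      also have "\<dots> \<le> ennreal (L * d)" using var d k iin imono k1 by blast
      finally have "(\<integral>\<^sup>+\<omega>. ennreal (\<psi> \<omega>) \<partial>M) \<le> ennreal (L * d)" .
      moreover have "expectation \<psi> = enn2real (\<integral>\<^sup>+\<omega>. ennreal (\<psi> \<omega>) \<partial>M)"
        using \<psi>m \<phi>0 hbound(1) by (intro integral_eq_nn_integral) (auto simp: \<psi>_def)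
      ultimately show ?thesis using L d by (auto intro!: enn2real_leI)
    qed
    finally show ?thesis using hbound(1) unfolding \<Theta>p by simp
  qed
  then have "\<forall>A c t d \<phi>.
     A \<subseteq> {1..m} \<and> c \<in> A \<and> strict_mono_on {1..m} t \<and> (\<forall>j\<in>{1..m}. 1 \<le> t j) \<and> 0 < d \<and> d < d0 \<and>
     \<phi> \<in> borel_measurable borel \<and> (\<forall>z. 0 \<le> \<phi> z) \<and>
     (\<forall>y w. \<exists>x. \<bar>x - y\<bar> \<le> d \<and> \<phi> (y, w) \<le> hbound * \<bar>hh (w(c := x)) - hh (w(c := y))\<bar>) \<longrightarrow>
     expectation (\<lambda>\<omega>. \<phi> (yvec id \<omega> c, \<lambda>j. if j \<in> A - {c} then shifted 0 \<omega> (t j) else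
        if j \<in> {1..m} - {c} then yvec id \<omega> j else 0)) \<le> hbound * (L * d)"
    by (intro allI impI) blast
  with L show ?thesis by (intro exI conjI)
qed

end

section \<open>The cost of one replacement\<close>

context stationary_process
begin

lemma law_one:
  assumes "n \<ge> 1" shows "distr M borel (X n) = distr M borel (X 1)"
proof -
  have m: "(\<lambda>\<xi>. \<xi> (1::nat)) \<in> borel_measurable (borel :: (nat \<Rightarrow> real) measure)" by measurable
  have "distr M borel (\<lambda>\<omega>. shifted k \<omega> 1) = distr (distr M borel (shifted k)) borel (\<lambda>\<xi>. \<xi> 1)" for k
    by (subst distr_distr[OF m]) (auto simp: comp_def)
  then have "distr M borel (\<lambda>\<omega>. shifted (n - 1) \<omega> 1) = distr M borel (\<lambda>\<omega>. shifted 0 \<omega> 1)"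
    using shifted_law by metis
  moreover have "(\<lambda>\<omega>. shifted (n - 1) \<omega> 1) = X n" "(\<lambda>\<omega>. shifted 0 \<omega> 1) = X 1"
    using assms by (simp_all add: shifted_def)
  ultimately show ?thesis by simp
qed

lemma tail_bound:
  assumes r: "\<rho> > 0" and int: "integrable M (\<lambda>\<omega>. \<bar>X 1 \<omega>\<bar> powr \<rho>)" and n: "n \<ge> 1" and T: "T > 0"
  shows "prob {\<omega> \<in> space M. \<bar>X n \<omega>\<bar> \<ge> T} \<le> expectation (\<lambda>\<omega>. \<bar>X 1 \<omega>\<bar> powr \<rho>) * T powr (- \<rho>)"
proof -
  have [measurable]: "X n \<in> borel_measurable M" "X (Suc 0) \<in> borel_measurable M" using X_measurable n by simp_all
  let ?S = "{x :: real. \<bar>x\<bar> \<ge> T}"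
  have "prob {\<omega> \<in> space M. \<bar>X n \<omega>\<bar> \<ge> T} = measure (distr M borel (X n)) ?S"
    by (subst measure_distr) (auto intro!: arg_cong[where f=prob])
  also have "\<dots> = measure (distr M borel (X 1)) ?S" by (simp only: law_one[OF n])
  also have "\<dots> = prob {\<omega> \<in> space M. \<bar>X 1 \<omega>\<bar> \<ge> T}"
    by (subst measure_distr) (auto intro!: arg_cong[where f=prob])
  also have "\<dots> \<le> prob {\<omega> \<in> space M. \<bar>X 1 \<omega>\<bar> powr \<rho> \<ge> T powr \<rho>}"
    using T r by (intro finite_measure_mono) (auto intro!: powr_mono2)
  also have "\<dots> \<le> expectation (\<lambda>\<omega>. \<bar>X 1 \<omega>\<bar> powr \<rho>) / T powr \<rho>"
    using T by (intro order_trans[OF _ integral_Markov_inequality_measure[OF int, where A="{}"]]) auto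
  finally show ?thesis by (simp add: powr_minus divide_inverse)
qed

end

context u_statistic_setup
begin

lemma yvec_split_independent:
  assumes c: "c \<in> {1..m}" and w: "w \<in> borel \<rightarrow>\<^sub>M N"
  shows "alpha_bound M borel (\<lambda>\<omega>. yvec id \<omega> c) N (\<lambda>\<omega>. w (\<lambda>j. if j \<in> {1..m} - {c} then yvec id \<omega> j else 0)) 0"
proof -
  have iv: "indep_vars (\<lambda>_. borel) Y {1..}" using iid by (simp add: iid_copies_def)
  have "indep_var (Pi\<^sub>M {c} (\<lambda>_. borel)) (\<lambda>\<omega>. \<lambda>i\<in>{c}. Y i \<omega>) (Pi\<^sub>M ({1..} - {c}) (\<lambda>_. borel)) (\<lambda>\<omega>. \<lambda>i\<in>{1..} - {c}. Y i \<omega>)"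
    by (rule indep_var_restrict[OF iv]) (use c in auto)
  then have ab: "alpha_bound M (Pi\<^sub>M {c} (\<lambda>_. borel)) (\<lambda>\<omega>. \<lambda>i\<in>{c}. Y i \<omega>) (Pi\<^sub>M ({1..} - {c}) (\<lambda>_. borel)) (\<lambda>\<omega>. \<lambda>i\<in>{1..} - {c}. Y i \<omega>) 0"
    by (rule indep_var_imp_alpha_bound_0)
  have e: "(\<lambda>f i. if i \<in> {1..m} - {c} then f (id i) else 0 :: real) \<in> Pi\<^sub>M ({1..} - {c}) (\<lambda>_. borel) \<rightarrow>\<^sub>M borel"
    by (rule extension_measurable) auto
  have u: "(\<lambda>f. f c :: real) \<in> Pi\<^sub>M {c} (\<lambda>_. borel) \<rightarrow>\<^sub>M borel"
    by (rule measurable_component_singleton) simp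
  have eq1: "(\<lambda>i\<in>{c}. Y i \<omega>) c = yvec id \<omega> c" for \<omega> using c by (simp add: yvec_def)
  have eq2: "(\<lambda>i. if i \<in> {1..m} - {c} then (\<lambda>i\<in>{1..} - {c}. Y i \<omega>) (id i) else 0)
      = (\<lambda>j. if j \<in> {1..m} - {c} then yvec id \<omega> j else 0)" for \<omega>
    by (intro ext) (simp add: yvec_def)
  show ?thesis
    using alpha_bound_compose[OF ab u measurable_compose[OF e w]] unfolding eq1 eq2 .
qed

end

context u_statistic_mixing
begin

text \<open>
  The general replacement bound for the value of the process at time \<open>t c\<close>, given that all other times
  involved, collected in \<open>I\<close>, lie at distance at least \<open>l\<close> on one side.
\<close>
lemma replacement_error_process:
  assumes A: "A \<subseteq> {1..m}" "c \<in> A" and t1: "\<forall>j\<in>{1..m}. 1 \<le> t j"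
    and Q[measurable]: "Q \<in> borel_measurable borel" and Qb: "\<And>\<xi>. \<bar>Q \<xi>\<bar> \<le> hbound"
    and tI: "t ` (A - {c}) \<subseteq> I" and QI: "(\<lambda>\<omega>. Q (shifted 0 \<omega>)) \<in> field_of I \<rightarrow>\<^sub>M borel"
    and I: "I \<subseteq> {1..}" "I \<noteq> {}" and far: "(\<forall>i\<in>I. t c + l \<le> i) \<or> (\<forall>i\<in>I. i + l \<le> t c)"
    and d: "d > 0" and nT: "2 * T \<le> real n * d"
    and var: "\<And>\<phi>. \<phi> \<in> borel_measurable borel \<Longrightarrow> (\<And>z. 0 \<le> \<phi> z) \<Longrightarrow>
       (\<And>y w. \<exists>x. \<bar>x - y\<bar> \<le> d \<and> \<phi> (y, w) \<le> hbound * \<bar>hh (w(c := x)) - hh (w(c := y))\<bar>) \<Longrightarrow>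
       expectation (\<lambda>\<omega>. \<phi> (yvec id \<omega> c, \<lambda>j. if j \<in> A - {c} then shifted 0 \<omega> (t j) else
        if j \<in> {1..m} - {c} then yvec id \<omega> j else 0)) \<le> D"
  shows "\<bar>expectation (\<lambda>\<omega>. proj A (\<lambda>j. shifted 0 \<omega> (t j)) * Q (shifted 0 \<omega>)) -
          expectation (\<lambda>\<omega>. proj (A - {c}) (\<lambda>j. shifted 0 \<omega> (t j)) * Q (shifted 0 \<omega>))\<bar>
     \<le> D + 4 * real n * (hbound * hbound + 2 * hbound * hbound) * mixing_coeff M X l + 2 * (hbound * hbound) * prob {\<omega>\<in>space M. \<bar>X (t c) \<omega>\<bar> \<ge> T}"
proof -
  have cm: "c \<in> {1..m}" using A by auto
  have tc: "t c \<ge> 1" using t1 cm by blast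
  define W1 where "W1 \<xi> \<eta> = (\<lambda>j. if j \<in> A - {c} then \<xi> (t j) else if j \<in> {1..m} - {c} then \<eta> j else 0 :: real)"
    for \<xi> \<eta> :: "nat \<Rightarrow> real"
  have W1m: "(\<lambda>z. W1 (f z) (g z)) \<in> N \<rightarrow>\<^sub>M borel"
    if "f \<in> N \<rightarrow>\<^sub>M borel" "g \<in> N \<rightarrow>\<^sub>M borel" for f g and N :: "'z measure"
    unfolding W1_def
    by (rule vec_if_measurable[OF measurable_product_then_coordinatewise[OF that(1)] measurable_product_then_coordinatewise[OF that(2)]])
  let ?N = "borel \<Otimes>\<^sub>M borel :: ((nat \<Rightarrow> real) \<times> real) measure"
  define U where "U \<omega> = shifted 0 \<omega> (t c)" for \<omega>
  define U' where "U' \<omega> = yvec id \<omega> c" for \<omega>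
  define W where "W \<omega> = (W1 (shifted 0 \<omega>) (yvec id \<omega>), Q (shifted 0 \<omega>))" for \<omega>
  have sX: "(\<lambda>\<omega>. shifted 0 \<omega> j) = X j" if "1 \<le> j" for j
    using that by (simp add: shifted_def)
  have UX: "U = X (t c)" using sX[OF tc] unfolding U_def[abs_def] .
  have Um[measurable]: "U \<in> borel_measurable M" unfolding UX using X_measurable tc by simp
  have U'm[measurable]: "U' \<in> borel_measurable M"
    unfolding U'_def by (rule measurable_product_then_coordinatewise[OF yvec_id_measurable])
  have wm: "(\<lambda>z. (W1 (fst z) (snd z), Q (fst z))) \<in> borel \<Otimes>\<^sub>M borel \<rightarrow>\<^sub>M ?N"
    by (rule measurable_Pair[OF W1m[OF measurable_fst measurable_snd] measurable_compose[OF measurable_fst Q]])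
  have wm': "(\<lambda>z. (W1 (snd z) (fst z), Q (snd z))) \<in> borel \<Otimes>\<^sub>M borel \<rightarrow>\<^sub>M ?N"
    by (rule measurable_Pair[OF W1m[OF measurable_snd measurable_fst] measurable_compose[OF measurable_snd Q]])
  \<comment> \<open>For frozen values of the independent copies, \<open>W\<close> is a function of process values at times
    in \<open>I\<close>, all on one side of \<open>t c\<close>; so strong mixing applies.\<close>
  have ab: "alpha_bound M borel U ?N W (mixing_coeff M X l)"
  proof -
    have slice: "alpha_bound M borel (\<lambda>\<omega>. shifted 0 \<omega> (t c)) ?N (\<lambda>\<omega>. (W1 (shifted 0 \<omega>) \<eta>, Q (shifted 0 \<omega>))) (mixing_coeff M X l)" for \<eta>
    proof -
      have f: "(\<lambda>\<omega>. shifted 0 \<omega> (t c)) \<in> field_of J \<rightarrow>\<^sub>M borel" if "t c \<in> J" for J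
        using X_field_of[OF that] unfolding sX[OF tc] .
      have g: "(\<lambda>\<omega>. (W1 (shifted 0 \<omega>) \<eta>, Q (shifted 0 \<omega>))) \<in> field_of I \<rightarrow>\<^sub>M ?N"
      proof (rule measurable_Pair[OF _ QI])
        show "(\<lambda>\<omega>. W1 (shifted 0 \<omega>) \<eta>) \<in> field_of I \<rightarrow>\<^sub>M borel"
        proof (rule measurable_coordinatewise_then_product)
          fix j
          show "(\<lambda>\<omega>. W1 (shifted 0 \<omega>) \<eta> j) \<in> borel_measurable (field_of I)"
          proof (cases "j \<in> A - {c}")
            case True
            then have "t j \<in> I" "1 \<le> t j" using tI t1 A by auto
            then have "(\<lambda>\<omega>. shifted 0 \<omega> (t j)) \<in> borel_measurable (field_of I)"
              using X_field_of[of "t j" I] unfolding sX[OF \<open>1 \<le> t j\<close>] by blast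
            then show ?thesis using True unfolding W1_def by (simp only: if_True)
          next
            case False
            then show ?thesis unfolding W1_def by (simp only: if_False) simp
          qed
        qed
      qed
      show ?thesis using far
      proof
        assume fut: "\<forall>i\<in>I. t c + l \<le> i"
        have "I \<subseteq> {t c + l..}" using fut by auto
        then show ?thesis
          using tc by (intro alpha_bound_past_future[OF tc f field_of_mono[OF g]]) auto
      next
        assume past: "\<forall>i\<in>I. i + l \<le> t c"
        obtain i where i: "i \<in> I" using I by auto
        then have n: "1 \<le> t c - l" using past[rule_format, OF i] I(1) by auto
        have "alpha_bound M ?N (\<lambda>\<omega>. (W1 (shifted 0 \<omega>) \<eta>, Q (shifted 0 \<omega>))) borel (\<lambda>\<omega>. shifted 0 \<omega> (t c)) (mixing_coeff M X l)"
        proof (rule alpha_bound_past_future[OF n field_of_mono[OF g] f])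
          show "I \<subseteq> {1..t c - l}"
          proof
            fix i assume "i \<in> I"
            then show "i \<in> {1..t c - l}" using past[rule_format, of i] I(1) by auto
          qed
          show "t c \<in> {t c - l + l..}" using n by simp
        qed
        then show ?thesis by (rule alpha_bound_commute)
      qed
    qed
    have um: "(\<lambda>\<xi>. \<xi> (t c)) \<in> borel_measurable (borel :: (nat \<Rightarrow> real) measure)" by measurable
    have "alpha_bound M borel (\<lambda>\<omega>. shifted 0 \<omega> (t c)) ?N
        (\<lambda>\<omega>. (W1 (fst (shifted 0 \<omega>, yvec id \<omega>)) (snd (shifted 0 \<omega>, yvec id \<omega>)), Q (fst (shifted 0 \<omega>, yvec id \<omega>)))) (mixing_coeff M X l)"
      by (rule alpha_bound_independent_parameter[OF shifted_measurable yvec_id_measurable product_law um wm])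
        (unfold fst_conv snd_conv, rule slice)
    then show ?thesis unfolding U_def W_def fst_conv snd_conv .
  qed
  \<comment> \<open>For a frozen path of the process, \<open>W\<close> is a function of the copies other than \<open>U'\<close>.\<close>
  have ab0: "alpha_bound M borel U' ?N W 0"
  proof -
    have um: "(\<lambda>\<xi>. \<xi> c) \<in> borel_measurable (borel :: (nat \<Rightarrow> real) measure)" by measurable
    have slice: "alpha_bound M borel (\<lambda>\<omega>. yvec id \<omega> c) ?N (\<lambda>\<omega>. (W1 \<xi> (yvec id \<omega>), Q \<xi>)) 0" for \<xi>
    proof -
      have "(\<lambda>\<eta>. (W1 \<xi> \<eta>, Q \<xi>)) \<in> borel \<rightarrow>\<^sub>M ?N"
        by (rule measurable_Pair[OF W1m[OF measurable_const measurable_ident_sets] measurable_const]) simp_all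
      from yvec_split_independent[OF cm this]
      have "alpha_bound M borel (\<lambda>\<omega>. yvec id \<omega> c) ?N
        (\<lambda>\<omega>. (W1 \<xi> (\<lambda>j. if j \<in> {1..m} - {c} then yvec id \<omega> j else 0), Q \<xi>)) 0" .
      moreover have "W1 \<xi> (\<lambda>j. if j \<in> {1..m} - {c} then yvec id \<omega> j else 0) = W1 \<xi> (yvec id \<omega>)" for \<omega>
        unfolding W1_def by (intro ext) simp
      ultimately show ?thesis by (simp only:)
    qed
    have "alpha_bound M borel (\<lambda>\<omega>. yvec id \<omega> c) ?N
        (\<lambda>\<omega>. (W1 (snd (yvec id \<omega>, shifted 0 \<omega>)) (fst (yvec id \<omega>, shifted 0 \<omega>)), Q (snd (yvec id \<omega>, shifted 0 \<omega>)))) 0"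
      by (rule alpha_bound_independent_parameter[OF yvec_id_measurable shifted_measurable product_law' um wm'])
        (unfold fst_conv snd_conv, rule slice)
    then show ?thesis unfolding U'_def W_def fst_conv snd_conv .
  qed
  have lawU: "distr M borel U' = distr M borel U"
  proof -
    have "U' = Y c" unfolding U'_def using cm by (intro ext) (simp add: yvec_def)
    then show ?thesis using iid cm law_one[OF tc] unfolding UX by (simp add: iid_copies_def)
  qed
  have law: "distr M (borel \<Otimes>\<^sub>M ?N) (\<lambda>\<omega>. (U' \<omega>, W \<omega>)) = distr M borel U \<Otimes>\<^sub>M distr M ?N W"
    using alpha_bound_0_imp_product_law[OF ab0] unfolding lawU .
  \<comment> \<open>The bound on the second factor is needed at every point, not only on the range of \<open>Q\<close>.\<close>
  define clamp where "clamp q = max (- hbound) (min hbound q)" for q :: real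
  have clamp: "\<bar>clamp q\<bar> \<le> hbound" "\<bar>q\<bar> \<le> hbound \<Longrightarrow> clamp q = q" for q
    using hbound(1) unfolding clamp_def by auto
  have clampm[measurable]: "clamp \<in> borel_measurable borel" unfolding clamp_def by measurable
  define f where "f z = hh ((fst (snd z))(c := fst z)) * clamp (snd (snd z))" for z :: "real \<times> (nat \<Rightarrow> real) \<times> real"
  have fm: "f \<in> borel_measurable (borel \<Otimes>\<^sub>M ?N)"
  proof -
    have "(\<lambda>z :: real \<times> (nat \<Rightarrow> real) \<times> real. (fst (snd z))(c := fst z)) \<in> borel \<Otimes>\<^sub>M ?N \<rightarrow>\<^sub>M borel"
    proof (rule measurable_coordinatewise_then_product)
      fix j
      have "(\<lambda>z :: real \<times> (nat \<Rightarrow> real) \<times> real. fst (snd z)) \<in> borel \<Otimes>\<^sub>M ?N \<rightarrow>\<^sub>M borel" by measurable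
      note measurable_product_then_coordinatewise[OF this, of j]
      then show "(\<lambda>z :: real \<times> (nat \<Rightarrow> real) \<times> real. ((fst (snd z))(c := fst z)) j) \<in> borel_measurable (borel \<Otimes>\<^sub>M ?N)"
        by (cases "j = c") simp_all
    qed
    then have "(\<lambda>z :: real \<times> (nat \<Rightarrow> real) \<times> real. hh ((fst (snd z))(c := fst z))) \<in> borel_measurable (borel \<Otimes>\<^sub>M ?N)"
      by (rule measurable_compose[OF _ hh_measurable])
    then show ?thesis unfolding f_def by measurable
  qed
  have fb: "\<bar>f z\<bar> \<le> hbound * hbound" for z
    unfolding f_def abs_mult using hh_bound clamp(1) hbound(1) by (intro mult_mono) auto
  define u where "u z = hbound * \<bar>hh ((snd (snd z))(c := fst z)) - hh ((snd (snd z))(c := fst (snd z)))\<bar>"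
    for z :: "real \<times> real \<times> (nat \<Rightarrow> real)"
  have um: "u \<in> borel_measurable borel"
  proof -
    have "(\<lambda>z :: real \<times> real \<times> (nat \<Rightarrow> real). (snd (snd z))(c := s z)) \<in> borel \<Otimes>\<^sub>M borel \<Otimes>\<^sub>M borel \<rightarrow>\<^sub>M borel"
      if [measurable]: "s \<in> borel_measurable (borel \<Otimes>\<^sub>M borel \<Otimes>\<^sub>M borel)" for s
    proof (rule measurable_coordinatewise_then_product)
      fix j
      have "(\<lambda>z :: real \<times> real \<times> (nat \<Rightarrow> real). snd (snd z)) \<in> borel \<Otimes>\<^sub>M borel \<Otimes>\<^sub>M borel \<rightarrow>\<^sub>M borel" by measurable
      note measurable_product_then_coordinatewise[OF this, of j]
      then show "(\<lambda>z :: real \<times> real \<times> (nat \<Rightarrow> real). ((snd (snd z))(c := s z)) j) \<in> borel_measurable (borel \<Otimes>\<^sub>M borel \<Otimes>\<^sub>M borel)"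
        using that by (cases "j = c") simp_all
    qed
    note m = measurable_compose[OF this hh_measurable]
    have "u \<in> borel_measurable (borel \<Otimes>\<^sub>M borel \<Otimes>\<^sub>M borel)"
      unfolding u_def by (intro borel_measurable_times borel_measurable_abs borel_measurable_diff m) simp_all
    then show ?thesis by (simp only: borel_prod)
  qed
  have ub: "0 \<le> u z \<and> u z \<le> 2 * hbound * hbound" for z
  proof -
    have "\<bar>hh ((snd (snd z))(c := fst z)) - hh ((snd (snd z))(c := fst (snd z)))\<bar> \<le> 2 * hbound"
      using hh_bound[of "(snd (snd z))(c := fst z)"] hh_bound[of "(snd (snd z))(c := fst (snd z))"] by linarith
    then have "u z \<le> hbound * (2 * hbound)" unfolding u_def using hbound(1) by (intro mult_left_mono) auto
    then show ?thesis using hbound(1) unfolding u_def by (auto simp: mult_ac)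
  qed
  have fu: "\<bar>f (x, w) - f (y, w)\<bar> \<le> u (x, y, fst w)" for x y w
  proof -
    have "f (x, w) - f (y, w) = (hh ((fst w)(c := x)) - hh ((fst w)(c := y))) * clamp (snd w)"
      unfolding f_def by (simp add: left_diff_distrib)
    then have "\<bar>f (x, w) - f (y, w)\<bar> = \<bar>hh ((fst w)(c := x)) - hh ((fst w)(c := y))\<bar> * \<bar>clamp (snd w)\<bar>"
      by (simp add: abs_mult)
    also have "\<dots> \<le> \<bar>hh ((fst w)(c := x)) - hh ((fst w)(c := y))\<bar> * hbound"
      using clamp(1) by (intro mult_left_mono) auto
    finally show ?thesis unfolding u_def by (simp add: mult.commute)
  qed
  have pim: "(fst :: (nat \<Rightarrow> real) \<times> real \<Rightarrow> _) \<in> ?N \<rightarrow>\<^sub>M borel" by measurable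
  have main: "\<bar>expectation (\<lambda>\<omega>. f (U \<omega>, W \<omega>)) - expectation (\<lambda>\<omega>. f (U' \<omega>, W \<omega>))\<bar>
     \<le> D + 4 * real n * (hbound * hbound + 2 * hbound * hbound) * mixing_coeff M X l + 2 * (hbound * hbound) * prob {\<omega>\<in>space M. \<bar>U \<omega>\<bar> \<ge> T}"
  proof (rule replacement_error[OF ab U'm law fm fb pim um ub fu d nT])
    fix \<phi> :: "real \<times> (nat \<Rightarrow> real) \<Rightarrow> real"
    assume "\<phi> \<in> borel_measurable borel" "\<And>z. 0 \<le> \<phi> z" "\<And>y v. \<exists>x. \<bar>x - y\<bar> \<le> d \<and> \<phi> (y, v) \<le> u (x, y, v)"
    from var[OF this[unfolded u_def fst_conv snd_conv]]
    show "expectation (\<lambda>\<omega>. \<phi> (U' \<omega>, fst (W \<omega>))) \<le> D"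
      unfolding U'_def W_def W1_def fst_conv .
  qed
  have E1: "expectation (\<lambda>\<omega>. f (U \<omega>, W \<omega>)) = expectation (\<lambda>\<omega>. proj A (\<lambda>j. shifted 0 \<omega> (t j)) * Q (shifted 0 \<omega>))"
  proof -
    have "f (U \<omega>, W \<omega>) = hh (\<lambda>j. if j \<in> A then shifted 0 \<omega> (t j) else yvec id \<omega> j) * Q (shifted 0 \<omega>)" for \<omega>
    proof -
      have "hh ((W1 (shifted 0 \<omega>) (yvec id \<omega>))(c := U \<omega>)) = hh (\<lambda>j. if j \<in> A then shifted 0 \<omega> (t j) else yvec id \<omega> j)"
        using A by (intro hh_cong) (auto simp: W1_def U_def)
      then show ?thesis unfolding f_def W_def fst_conv snd_conv using clamp(2)[OF Qb] by simp
    qed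
    then show ?thesis by (simp only: expectation_proj[OF Q Qb])
  qed
  have E2: "expectation (\<lambda>\<omega>. f (U' \<omega>, W \<omega>)) = expectation (\<lambda>\<omega>. proj (A - {c}) (\<lambda>j. shifted 0 \<omega> (t j)) * Q (shifted 0 \<omega>))"
  proof -
    have "f (U' \<omega>, W \<omega>) = hh (\<lambda>j. if j \<in> A - {c} then shifted 0 \<omega> (t j) else yvec id \<omega> j) * Q (shifted 0 \<omega>)" for \<omega>
    proof -
      have "hh ((W1 (shifted 0 \<omega>) (yvec id \<omega>))(c := U' \<omega>)) = hh (\<lambda>j. if j \<in> A - {c} then shifted 0 \<omega> (t j) else yvec id \<omega> j)"
        by (intro hh_cong) (auto simp: W1_def U'_def)
      then show ?thesis unfolding f_def W_def fst_conv snd_conv using clamp(2)[OF Qb] by simp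
    qed
    then show ?thesis by (simp only: expectation_proj[OF Q Qb])
  qed
  show ?thesis using main unfolding E1 E2 unfolding UX .
qed

text \<open>
  The exponent of the cost of one replacement.  It exceeds \<open>1\<close> exactly under the assumed lower bound
  on \<open>\<delta>\<close>.
\<close>
definition \<kappa> :: real where "\<kappa> = \<delta> * \<rho> / (2 * \<rho> + 1)"

lemma \<kappa>_gt_1: "\<kappa> > 1"
proof -
  have "2 * \<rho> + 1 < \<delta> * \<rho>" using \<delta> \<rho>_pos by (simp add: pos_divide_less_eq)
  then show ?thesis unfolding \<kappa>_def using \<rho>_pos by (simp add: pos_less_divide_eq)
qed

text \<open>
  The number of cells is of order \<open>l powr (\<kappa> / \<rho> + \<kappa>)\<close>; multiplied by \<open>l powr -\<delta>\<close> it gives the same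
  order as the length of the cells.
\<close>
lemma \<kappa>_balance: "\<kappa> / \<rho> + \<kappa> - \<delta> = - \<kappa>"
proof -
  have "2 * \<rho> + 1 \<noteq> 0" using \<rho>_pos by simp
  then have "\<kappa> * (2 * \<rho> + 1) = \<delta> * \<rho>" unfolding \<kappa>_def by simp
  then show ?thesis using \<rho>_pos by (simp add: field_simps)
qed

lemma \<delta>_gt_2: "\<delta> > 2"
proof -
  have "(2 * \<rho> + 1) / \<rho> = 2 + 1 / \<rho>" using \<rho>_pos by (simp add: field_simps)
  then show ?thesis using \<delta> \<rho>_pos by (smt (verit) zero_less_divide_1_iff)
qed

text \<open>
  The choice of cell length and truncation in \<open>replacement_error_process\<close>.  At lag \<open>0\<close> there is no
  bound on the mixing coefficient, but there the difference is at most twice the bound of the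
  integrands.
\<close>
lemma replacement_step:
  "\<exists>C>0. \<forall>A c t Q l I. A \<subseteq> {1..m} \<and> c \<in> A \<and> strict_mono_on {1..m} t \<and> (\<forall>j\<in>{1..m}. 1 \<le> t j) \<and>
     Q \<in> borel_measurable borel \<and> (\<forall>\<xi>. \<bar>Q \<xi>\<bar> \<le> hbound) \<and> t ` (A - {c}) \<subseteq> I \<and>
     (\<lambda>\<omega>. Q (shifted 0 \<omega>)) \<in> field_of I \<rightarrow>\<^sub>M borel \<and> I \<subseteq> {1..} \<and> I \<noteq> {} \<and>
     ((\<forall>i\<in>I. t c + l \<le> i) \<or> (\<forall>i\<in>I. i + l \<le> t c)) \<longrightarrow>
     \<bar>expectation (\<lambda>\<omega>. proj A (\<lambda>j. shifted 0 \<omega> (t j)) * Q (shifted 0 \<omega>)) -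
          expectation (\<lambda>\<omega>. proj (A - {c}) (\<lambda>j. shifted 0 \<omega> (t j)) * Q (shifted 0 \<omega>))\<bar>
     \<le> C * (real l + 1) powr (- \<kappa>)"
proof -
  from variation_transfer obtain L d0 where L: "L > 0" "d0 > 0" and var: "\<forall>A c t d \<phi>.
     A \<subseteq> {1..m} \<and> c \<in> A \<and> strict_mono_on {1..m} t \<and> (\<forall>j\<in>{1..m}. 1 \<le> t j) \<and> 0 < d \<and> d < d0 \<and>
     \<phi> \<in> borel_measurable borel \<and> (\<forall>z. 0 \<le> \<phi> z) \<and>
     (\<forall>y w. \<exists>x. \<bar>x - y\<bar> \<le> d \<and> \<phi> (y, w) \<le> hbound * \<bar>hh (w(c := x)) - hh (w(c := y))\<bar>) \<longrightarrow>
     expectation (\<lambda>\<omega>. \<phi> (yvec id \<omega> c, \<lambda>j. if j \<in> A - {c} then shifted 0 \<omega> (t j) else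
        if j \<in> {1..m} - {c} then yvec id \<omega> j else 0)) \<le> hbound * (L * d)"
    by (elim exE conjE)
  obtain Ca where Ca: "Ca > 0" "\<And>l. l \<ge> 1 \<Longrightarrow> mixing_coeff M X l \<le> Ca * real l powr (- \<delta>)"
    using mixing_polynomial_bound[OF mixing_rate] \<delta>_gt_2 by auto
  define E\<rho> where "E\<rho> = expectation (\<lambda>\<omega>. \<bar>X 1 \<omega>\<bar> powr \<rho>)"
  have E\<rho>: "E\<rho> \<ge> 0" unfolding E\<rho>_def by (rule Bochner_Integration.integral_nonneg) simp
  define d1 where "d1 = min 1 d0 / 2"
  have d1: "d1 > 0" "d1 < d0" using L(2) unfolding d1_def by auto
  define C0 where "C0 = hbound * L * d1 + 12 * hbound\<^sup>2 * (2 / d1 + 1) * Ca + 2 * hbound\<^sup>2 * E\<rho>"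
  have C0: "C0 > 0" unfolding C0_def using hbound(1) L d1 Ca(1) E\<rho>
    by (intro add_pos_nonneg) auto
  define C where "C = 2 * hbound\<^sup>2 + C0 * 2 powr \<kappa>"
  have C: "C > 0" unfolding C_def using C0 hbound(1) by (intro add_pos_pos) auto
  have "\<bar>expectation (\<lambda>\<omega>. proj A (\<lambda>j. shifted 0 \<omega> (t j)) * Q (shifted 0 \<omega>)) -
          expectation (\<lambda>\<omega>. proj (A - {c}) (\<lambda>j. shifted 0 \<omega> (t j)) * Q (shifted 0 \<omega>))\<bar>
     \<le> C * (real l + 1) powr (- \<kappa>)"
    if A: "A \<subseteq> {1..m}" "c \<in> A" and t: "strict_mono_on {1..m} t" and t1: "\<forall>j\<in>{1..m}. 1 \<le> t j"
      and Q: "Q \<in> borel_measurable borel" and Qb: "\<forall>\<xi>. \<bar>Q \<xi>\<bar> \<le> hbound" and tI: "t ` (A - {c}) \<subseteq> I"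
      and QI: "(\<lambda>\<omega>. Q (shifted 0 \<omega>)) \<in> field_of I \<rightarrow>\<^sub>M borel" and I: "I \<subseteq> {1..}" "I \<noteq> {}"
      and far: "(\<forall>i\<in>I. t c + l \<le> i) \<or> (\<forall>i\<in>I. i + l \<le> t c)" for A c t Q l I
  proof -
    let ?\<Delta> = "\<bar>expectation (\<lambda>\<omega>. proj A (\<lambda>j. shifted 0 \<omega> (t j)) * Q (shifted 0 \<omega>)) -
          expectation (\<lambda>\<omega>. proj (A - {c}) (\<lambda>j. shifted 0 \<omega> (t j)) * Q (shifted 0 \<omega>))\<bar>"
    note step = replacement_error_process[OF A t1 Q Qb[rule_format] tI QI I far]
    show ?thesis
    proof (cases "l = 0")
      case True
      have "\<bar>expectation (\<lambda>\<omega>. proj B (\<lambda>j. shifted 0 \<omega> (t j)) * Q (shifted 0 \<omega>))\<bar> \<le> hbound * hbound" for B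
      proof -
        have b: "\<bar>proj B x * Q \<xi>\<bar> \<le> hbound * hbound" for x \<xi>
          unfolding abs_mult using proj_bound Qb hbound(1) by (intro mult_mono) auto
        have m: "(\<lambda>\<omega>. proj B (\<lambda>j. shifted 0 \<omega> (t j)) * Q (shifted 0 \<omega>)) \<in> borel_measurable M"
        proof -
          have "(\<lambda>\<omega> j. shifted 0 \<omega> (t j)) \<in> M \<rightarrow>\<^sub>M borel"
            by (rule measurable_coordinatewise_then_product)
              (rule measurable_product_then_coordinatewise[OF shifted_measurable])
          note measurable_compose[OF this proj_measurable]
          moreover note measurable_compose[OF shifted_measurable Q]
          ultimately show ?thesis by (rule borel_measurable_times)
        qed
        have "\<bar>expectation (\<lambda>\<omega>. proj B (\<lambda>j. shifted 0 \<omega> (t j)) * Q (shifted 0 \<omega>))\<bar>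
           \<le> expectation (\<lambda>\<omega>. \<bar>proj B (\<lambda>j. shifted 0 \<omega> (t j)) * Q (shifted 0 \<omega>)\<bar>)"
          by (rule integral_abs_bound)
        also have "\<dots> \<le> hbound * hbound"
          by (rule integral_le_const[OF integrable_abs[OF integrable_const_bound[where B="hbound * hbound"]]])
            (use b m in auto)
        finally show ?thesis .
      qed
      from this[of A] this[of "A - {c}"] have "?\<Delta> \<le> 2 * hbound\<^sup>2" by (simp add: power2_eq_square abs_le_iff)
      also have "\<dots> \<le> C" unfolding C_def using C0 by simp
      finally show ?thesis using True by simp
    next
      case False
      then have l: "l \<ge> 1" by simp
      let ?l = "real l"
      \<comment> \<open>With these choices the three errors (cell length, number of cells times the mixing
        coefficient, tail) are all of order \<open>l powr -\<kappa>\<close>.\<close>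
      define d where "d = d1 * ?l powr (- \<kappa>)"
      define T where "T = ?l powr (\<kappa> / \<rho>)"
      define n where "n = nat \<lceil>2 * T / d\<rceil>"
      have l0: "?l > 0" using l by simp
      have lk1: "?l powr (- \<kappa>) \<le> 1" using l \<kappa>_gt_1 powr_mono2'[of "\<kappa>" 1 ?l] by (simp add: powr_mono_both' ge_one_powr_ge_zero powr_minus divide_simps)
      have d: "d > 0" "d < d0"
      proof -
        show "d > 0" unfolding d_def using d1 l0 by simp
        have "d \<le> d1 * 1" unfolding d_def using d1 lk1 by (intro mult_left_mono) auto
        then show "d < d0" using d1 by simp
      qed
      have T: "T > 0" unfolding T_def using l0 by simp
      have nd: "2 * T \<le> real n * d"
      proof -
        have "2 * T / d \<le> real n" unfolding n_def by linarith
        then show ?thesis using d by (simp add: pos_divide_le_eq)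
      qed
      have "?\<Delta> \<le> hbound * (L * d) + 4 * real n * (hbound * hbound + 2 * hbound * hbound) * mixing_coeff M X l + 2 * (hbound * hbound) * prob {\<omega>\<in>space M. \<bar>X (t c) \<omega>\<bar> \<ge> T}"
      proof (rule step[OF d(1) nd])
        fix \<phi> :: "real \<times> (nat \<Rightarrow> real) \<Rightarrow> real"
        assume "\<phi> \<in> borel_measurable borel" "\<And>z. 0 \<le> \<phi> z"
          "\<And>y w. \<exists>x. \<bar>x - y\<bar> \<le> d \<and> \<phi> (y, w) \<le> hbound * \<bar>hh (w(c := x)) - hh (w(c := y))\<bar>"
        then show "expectation (\<lambda>\<omega>. \<phi> (yvec id \<omega> c, \<lambda>j. if j \<in> A - {c} then shifted 0 \<omega> (t j) else
          if j \<in> {1..m} - {c} then yvec id \<omega> j else 0)) \<le> hbound * (L * d)"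
          by (intro var[rule_format] conjI A t t1 d allI)
      qed
      also have "\<dots> \<le> hbound * L * d1 * ?l powr (- \<kappa>) + 12 * hbound\<^sup>2 * (2 / d1 + 1) * Ca * ?l powr (- \<kappa>) + 2 * hbound\<^sup>2 * E\<rho> * ?l powr (- \<kappa>)"
      proof (intro add_mono)
        show "hbound * (L * d) \<le> hbound * L * d1 * ?l powr (- \<kappa>)" unfolding d_def by simp
        have p: "prob {\<omega>\<in>space M. \<bar>X (t c) \<omega>\<bar> \<ge> T} \<le> E\<rho> * T powr (- \<rho>)"
          unfolding E\<rho>_def using A t1 by (intro tail_bound[OF \<rho>_pos moment _ T]) auto
        have "T powr (- \<rho>) = ?l powr (- \<kappa>)" unfolding T_def using \<rho>_pos by (simp add: powr_powr)
        then show "2 * (hbound * hbound) * prob {\<omega>\<in>space M. \<bar>X (t c) \<omega>\<bar> \<ge> T} \<le> 2 * hbound\<^sup>2 * E\<rho> * ?l powr (- \<kappa>)"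
          using mult_left_mono[OF p, of "2 * hbound\<^sup>2"] by (simp add: power2_eq_square mult_ac)
        have n1: "real n \<le> (2 / d1 + 1) * ?l powr (\<kappa> / \<rho> + \<kappa>)"
        proof -
          have "2 * T / d \<ge> 0" using T d by simp
          then have "real n \<le> 2 * T / d + 1" unfolding n_def by linarith
          also have "2 * T / d = 2 / d1 * ?l powr (\<kappa> / \<rho> + \<kappa>)"
            unfolding T_def d_def powr_add powr_minus by (simp add: divide_inverse)
          also have "(1::real) \<le> ?l powr (\<kappa> / \<rho> + \<kappa>)"
            using l \<kappa>_gt_1 \<rho>_pos by (intro ge_one_powr_ge_zero) auto
          finally show ?thesis by (simp add: distrib_right)
        qed
        have "real n * mixing_coeff M X l \<le> ((2 / d1 + 1) * ?l powr (\<kappa> / \<rho> + \<kappa>)) * (Ca * ?l powr (- \<delta>))"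
          using n1 Ca(2)[OF l] d1 by (intro mult_mono mixing_coeff_nonneg) auto
        also have "\<dots> = (2 / d1 + 1) * Ca * (?l powr (\<kappa> / \<rho> + \<kappa>) * ?l powr (- \<delta>))" by simp
        also have "?l powr (\<kappa> / \<rho> + \<kappa>) * ?l powr (- \<delta>) = ?l powr (- \<kappa>)"
        proof -
          have "\<kappa> / \<rho> + \<kappa> + - \<delta> = - \<kappa>" using \<kappa>_balance by simp
          then show ?thesis unfolding powr_add[symmetric] by (rule arg_cong)
        qed
        finally have le: "12 * hbound\<^sup>2 * (real n * mixing_coeff M X l) \<le> 12 * hbound\<^sup>2 * ((2 / d1 + 1) * Ca * ?l powr (- \<kappa>))"
          by (intro mult_left_mono) auto
        show "4 * real n * (hbound * hbound + 2 * hbound * hbound) * mixing_coeff M X l \<le> 12 * hbound\<^sup>2 * (2 / d1 + 1) * Ca * ?l powr (- \<kappa>)"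
        proof -
          have "4 * real n * (hbound * hbound + 2 * hbound * hbound) * mixing_coeff M X l = 12 * hbound\<^sup>2 * (real n * mixing_coeff M X l)"
            by (simp add: power2_eq_square algebra_simps)
          moreover have "12 * hbound\<^sup>2 * (2 / d1 + 1) * Ca * ?l powr (- \<kappa>) = 12 * hbound\<^sup>2 * ((2 / d1 + 1) * Ca * ?l powr (- \<kappa>))"
            by (simp only: mult.assoc)
          ultimately show ?thesis using le by (simp only:)
        qed
      qed
      also have "\<dots> = C0 * ?l powr (- \<kappa>)" unfolding C0_def by (simp add: distrib_right)
      also have "\<dots> \<le> C0 * (2 powr \<kappa> * (?l + 1) powr (- \<kappa>))"
      proof (rule mult_left_mono)
        have "((?l + 1) / 2) powr (- \<kappa>) \<ge> ?l powr (- \<kappa>)"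
          using l \<kappa>_gt_1 by (intro powr_mono2') auto
        moreover have "((?l + 1) / 2) powr (- \<kappa>) = 2 powr \<kappa> * (?l + 1) powr (- \<kappa>)"
          by (simp add: powr_divide powr_minus divide_simps)
        ultimately show "?l powr (- \<kappa>) \<le> 2 powr \<kappa> * (?l + 1) powr (- \<kappa>)" by simp
      qed (use C0 in simp)
      also have "\<dots> \<le> C * (?l + 1) powr (- \<kappa>)"
        unfolding C_def by (simp add: distrib_right)
      finally show ?thesis .
    qed
  qed
  note bound = this
  show ?thesis
    by (rule exI[of _ C], rule conjI[OF C], intro allI impI, elim conjE, rule bound)
qed

end

section \<open>The degenerate part\<close>

definition gap :: "nat \<Rightarrow> nat \<Rightarrow> nat" where
  "gap x y = (x - y) + (y - x)"

lemma sum_PiE_extract: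
  fixes F :: "('i \<Rightarrow> 'b) \<Rightarrow> real"
  assumes "a \<in> J"
  shows "(\<Sum>v\<in>J \<rightarrow>\<^sub>E T. F v) = (\<Sum>u\<in>(J - {a}) \<rightarrow>\<^sub>E T. \<Sum>x\<in>T. F (u(a := x)))"
proof -
  have J: "J = insert a (J - {a})" using assms by auto
  have "J \<rightarrow>\<^sub>E T = (\<lambda>(y, g). g(a := y)) ` (T \<times> ((J - {a}) \<rightarrow>\<^sub>E T))"
    by (subst J) (rule PiE_insert_eq)
  moreover have "inj_on (\<lambda>(y, g). g(a := y)) (T \<times> ((J - {a}) \<rightarrow>\<^sub>E T))"
    by (rule inj_combinator) auto
  ultimately have "(\<Sum>v\<in>J \<rightarrow>\<^sub>E T. F v) = (\<Sum>(x, u)\<in>T \<times> ((J - {a}) \<rightarrow>\<^sub>E T). F (u(a := x)))"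
    by (simp add: sum.reindex case_prod_beta')
  also have "\<dots> = (\<Sum>x\<in>T. \<Sum>u\<in>(J - {a}) \<rightarrow>\<^sub>E T. F (u(a := x)))"
    by (rule sum.cartesian_product[symmetric])
  finally show ?thesis by (subst (asm) sum.swap)
qed

lemma sum_gap_le:
  fixes w :: "nat \<Rightarrow> real"
  assumes w: "\<And>l. w l \<ge> 0" and y: "y \<in> {1..n}"
  shows "(\<Sum>x\<in>{1..n}. w (gap x y)) \<le> 2 * (\<Sum>l<n. w l)"
proof -
  have "(\<Sum>x\<in>{1..n}. w (gap x y)) = (\<Sum>x\<in>{1..y}. w (gap x y)) + (\<Sum>x\<in>{y+1..n}. w (gap x y))"
    using y by (subst sum.union_disjoint[symmetric]) (auto intro!: sum.cong)
  moreover have "(\<Sum>x\<in>{1..y}. w (gap x y)) \<le> (\<Sum>l<n. w l)"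
  proof -
    have "(\<Sum>x\<in>{1..y}. w (gap x y)) = (\<Sum>l\<in>(\<lambda>x. y - x) ` {1..y}. w l)"
      by (subst sum.reindex) (auto simp: inj_on_def gap_def intro!: sum.cong)
    also have "\<dots> \<le> (\<Sum>l<n. w l)" using w y by (intro sum_mono2) auto
    finally show ?thesis .
  qed
  moreover have "(\<Sum>x\<in>{y+1..n}. w (gap x y)) \<le> (\<Sum>l<n. w l)"
  proof -
    have "(\<Sum>x\<in>{y+1..n}. w (gap x y)) = (\<Sum>l\<in>(\<lambda>x. x - y) ` {y+1..n}. w l)"
      by (subst sum.reindex) (auto simp: inj_on_def gap_def intro!: sum.cong)
    also have "\<dots> \<le> (\<Sum>l<n. w l)" using w y by (intro sum_mono2) auto
    finally show ?thesis .
  qed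
  ultimately show ?thesis by linarith
qed

text \<open>
  The coordinate \<open>a\<close> occurs in only one of the two weights, so it can be summed first, uniformly in the
  position of \<open>a'\<close>; then \<open>b\<close> occurs in the remaining weight only.  Each of the two sums costs a factor
  independent of the number of positions, and \<open>card J - 2\<close> coordinates remain free.
\<close>
lemma sum_PiE_two_gaps:
  fixes w :: "nat \<Rightarrow> real"
  assumes w: "\<And>l. w l \<ge> 0" and J: "finite J" "a \<in> J" "a' \<in> J" "b \<in> J" "b' \<in> J"
    and ne: "a \<noteq> a'" "a \<noteq> b" "a \<noteq> b'" "b \<noteq> b'"
  shows "(\<Sum>v\<in>J \<rightarrow>\<^sub>E {1..n}. w (gap (v a) (v a')) * w (gap (v b) (v b')))
    \<le> (2 * (\<Sum>l<n. w l))\<^sup>2 * real n ^ (card J - 2)"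
proof -
  let ?W = "2 * (\<Sum>l<n. w l)"
  have W0: "?W \<ge> 0" using w by (simp add: sum_nonneg)
  have "(\<Sum>v\<in>J \<rightarrow>\<^sub>E {1..n}. w (gap (v a) (v a')) * w (gap (v b) (v b'))) =
     (\<Sum>u\<in>(J - {a}) \<rightarrow>\<^sub>E {1..n}. \<Sum>x\<in>{1..n}. w (gap x (u a')) * w (gap (u b) (u b')))"
    using ne by (subst sum_PiE_extract[OF J(2)]) simp
  also have "\<dots> \<le> (\<Sum>u\<in>(J - {a}) \<rightarrow>\<^sub>E {1..n}. ?W * w (gap (u b) (u b')))"
  proof (rule sum_mono)
    fix u assume "u \<in> (J - {a}) \<rightarrow>\<^sub>E {1..n}"
    then have "u a' \<in> {1..n}" using J ne by (auto simp: PiE_iff)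
    then show "(\<Sum>x\<in>{1..n}. w (gap x (u a')) * w (gap (u b) (u b'))) \<le> ?W * w (gap (u b) (u b'))"
      unfolding sum_distrib_right[symmetric] using w by (intro mult_right_mono sum_gap_le)
  qed
  also have "\<dots> = ?W * (\<Sum>u\<in>(J - {a}) \<rightarrow>\<^sub>E {1..n}. w (gap (u b) (u b')))"
    by (simp add: sum_distrib_left)
  also have "\<dots> \<le> ?W * (real n ^ (card J - 2) * ?W)"
  proof (rule mult_left_mono[OF _ W0])
    have "(\<Sum>u\<in>(J - {a}) \<rightarrow>\<^sub>E {1..n}. w (gap (u b) (u b'))) =
       (\<Sum>u\<in>(J - {a} - {b}) \<rightarrow>\<^sub>E {1..n}. \<Sum>x\<in>{1..n}. w (gap x (u b')))"
      using ne J by (subst sum_PiE_extract[of b]) auto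
    also have "\<dots> \<le> (\<Sum>u\<in>(J - {a} - {b}) \<rightarrow>\<^sub>E {1..n}. ?W)"
    proof (rule sum_mono)
      fix u assume "u \<in> (J - {a} - {b}) \<rightarrow>\<^sub>E {1..n}"
      then have "u b' \<in> {1..n}" using J ne by (auto simp: PiE_iff)
      then show "(\<Sum>x\<in>{1..n}. w (gap x (u b'))) \<le> ?W" by (rule sum_gap_le[OF w])
    qed
    also have "\<dots> = real n ^ (card J - 2) * ?W"
    proof -
      have "card (J - {a} - {b}) = card J - 2" using J ne by (simp add: card_Diff_singleton)
      then show ?thesis using J by (simp add: card_PiE)
    qed
    finally show "(\<Sum>u\<in>(J - {a}) \<rightarrow>\<^sub>E {1..n}. w (gap (u b) (u b'))) \<le> real n ^ (card J - 2) * ?W" .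
  qed
  finally show ?thesis by (simp add: power2_eq_square mult_ac)
qed

lemma finite_arg_extrema:
  fixes v :: "'i \<Rightarrow> nat"
  assumes "finite R" "R \<noteq> {}"
  shows "\<exists>b\<in>R. \<forall>s\<in>R. v s \<le> v b" "\<exists>a\<in>R. \<forall>s\<in>R. v a \<le> v s"
proof -
  have fin: "finite (v ` R)" "v ` R \<noteq> {}" using assms by auto
  obtain b where "b \<in> R" "Max (v ` R) = v b" using Max_in[OF fin] by (elim imageE)
  then show "\<exists>b\<in>R. \<forall>s\<in>R. v s \<le> v b" using Max_ge[OF fin(1)] by (metis imageI)
  obtain a where "a \<in> R" "Min (v ` R) = v a" using Min_in[OF fin] by (elim imageE)
  then show "\<exists>a\<in>R. \<forall>s\<in>R. v a \<le> v s" using Min_le[OF fin(1)] by (metis imageI)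
qed

context u_statistic_mixing
begin

lemma proj_full: "proj {1..m} x = hh x"
proof -
  have "hh (\<lambda>j. if j \<in> {1..m} then x j else yvec id \<omega> j) = hh x" for \<omega>
    by (rule hh_cong) simp
  then show ?thesis unfolding proj_def by (simp add: prob_space)
qed

lemma proj_empty: "proj {} x = theta M m h Y"
  unfolding proj_def theta_def hh_def
  by (intro Bochner_Integration.integral_cong refl arg_cong[where f=h]) (auto simp: yvec_def fun_eq_iff)

text \<open>
  The definition of \<^const>\<open>g1\<close> keeps the first argument; by symmetry of the kernel and exchangeability
  of the copies every argument gives the same function.
\<close>
lemma proj_singleton:
  assumes c: "c \<in> {1..m}"
  shows "proj {c} x = g1 M m h Y (x c) + theta M m h Y"
proof -
  let ?p = "Transposition.transpose 1 c"
  have p: "?p permutes {1..m}" using c m_ge_2 by (intro permutes_swap_id) auto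
  have pin: "inj_on ?p {1..m}" "?p ` {1..m} \<subseteq> {1..}"
    using p permutes_image[OF p] by (auto simp: permutes_inj_on)
  let ?G = "\<lambda>\<eta>. hh (\<lambda>j. if j = 1 then x c else \<eta> j)"
  have G: "?G \<in> borel_measurable borel"
  proof -
    have "(\<lambda>\<eta> (j :: nat). if j = 1 then x c else \<eta> j :: real) \<in> borel \<rightarrow>\<^sub>M borel"
    proof (rule measurable_coordinatewise_then_product)
      fix j :: nat
      show "(\<lambda>\<eta>. if j = 1 then x c else \<eta> j) \<in> borel_measurable borel" by (cases "j = 1") simp_all
    qed
    then show ?thesis by (rule measurable_compose[OF _ hh_measurable])
  qed
  have "proj {c} x = expectation (\<lambda>\<omega>. ?G (yvec ?p \<omega>))"
    unfolding proj_def
  proof (intro Bochner_Integration.integral_cong refl)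
    fix \<omega>
    have "hh (\<lambda>j. if j \<in> {c} then x j else yvec id \<omega> j) =
        hh ((\<lambda>j. if j \<in> {c} then x j else yvec id \<omega> j) \<circ> ?p)"
      by (rule hh_permute[OF p, symmetric])
    also have "\<dots> = ?G (yvec ?p \<omega>)"
    proof (rule hh_cong)
      fix j assume j: "1 \<le> j" "j \<le> m"
      then have "?p j \<in> {1..m}" using permutes_in_image[OF p] by simp
      moreover have "?p j = c \<longleftrightarrow> j = 1"
        by (metis transpose_apply_first transpose_involutory)
      ultimately show "((\<lambda>j. if j \<in> {c} then x j else yvec id \<omega> j) \<circ> ?p) j = (if j = 1 then x c else yvec ?p \<omega> j)"
        using j by (simp add: yvec_def)
    qed
    finally show "hh (\<lambda>j. if j \<in> {c} then x j else yvec id \<omega> j) = ?G (yvec ?p \<omega>)" .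
  qed
  also have "\<dots> = integral\<^sup>L (distr M borel (yvec ?p)) ?G"
    by (rule integral_distr[symmetric, OF yvec_measurable[OF pin(2)] G])
  also have "\<dots> = expectation (\<lambda>\<omega>. ?G (yvec id \<omega>))"
    unfolding yvec_law[OF pin] by (rule integral_distr[OF yvec_id_measurable G])
  also have "\<dots> = (\<integral>\<omega>. h (\<lambda>j\<in>{1..m}. if j = 1 then x c else Y j \<omega>) \<partial>M)"
    unfolding hh_def by (intro Bochner_Integration.integral_cong refl arg_cong[where f=h])
      (auto simp: yvec_def fun_eq_iff)
  finally show ?thesis unfolding g1_def by simp
qed

text \<open>
  The coordinates of a pair of \<open>m\<close>-tuples are indexed by \<^typ>\<open>bool \<times> nat\<close>, the first component telling
  the two tuples apart.
\<close>
definition slice :: "(bool \<times> nat) set \<Rightarrow> bool \<Rightarrow> nat set" where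
  "slice S s = {j \<in> {1..m}. (s, j) \<in> S}"

text \<open>
  The mixed moment of the two kernels in which the coordinates in \<open>S\<close> carry the values of the process at
  the times \<open>v\<close>, and all other coordinates are integrated out independently for the two kernels.
\<close>
definition partial_moment :: "(bool \<times> nat \<Rightarrow> nat) \<Rightarrow> (bool \<times> nat) set \<Rightarrow> real" where
  "partial_moment v S = expectation (\<lambda>\<omega>. proj (slice S True) (\<lambda>j. shifted 0 \<omega> (v (True, j))) *
     proj (slice S False) (\<lambda>j. shifted 0 \<omega> (v (False, j))))"

abbreviation coords :: "(bool \<times> nat) set" where "coords \<equiv> UNIV \<times> {1..m}"

definition admissible :: "(bool \<times> nat \<Rightarrow> nat) \<Rightarrow> bool" where
  "admissible v \<longleftrightarrow> (\<forall>s. strict_mono_on {1..m} (\<lambda>j. v (s, j)) \<and> (\<forall>j\<in>{1..m}. 1 \<le> v (s, j)))"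

lemma proj_reindex_measurable: "(\<lambda>\<xi>. proj A (\<lambda>j. \<xi> (t j))) \<in> borel_measurable borel"
proof -
  have "(\<lambda>\<xi> j. \<xi> (t j) :: real) \<in> borel \<rightarrow>\<^sub>M borel" by (rule measurable_coordinatewise_then_product) simp
  then show ?thesis by (rule measurable_compose[OF _ proj_measurable])
qed

lemma proj_field_of:
  assumes "t ` A \<subseteq> I" "I \<subseteq> {1..}"
  shows "(\<lambda>\<omega>. proj A (\<lambda>j. shifted 0 \<omega> (t j))) \<in> borel_measurable (field_of I)"
proof -
  have "(\<lambda>\<omega> j. if j \<in> A then shifted 0 \<omega> (t j) else 0) \<in> field_of I \<rightarrow>\<^sub>M borel"
  proof (rule measurable_coordinatewise_then_product)
    fix j
    show "(\<lambda>\<omega>. if j \<in> A then shifted 0 \<omega> (t j) else 0) \<in> borel_measurable (field_of I)"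
    proof (cases "j \<in> A")
      case True
      then have tj: "t j \<in> I" "1 \<le> t j" using assms by auto
      have "(\<lambda>\<omega>. shifted 0 \<omega> (t j)) = X (t j)" using tj by (simp add: shifted_def)
      then show ?thesis using X_field_of[OF tj(1)] True by simp
    qed simp
  qed
  note m = measurable_compose[OF this proj_measurable[of A]]
  have "(\<lambda>\<omega>. proj A (\<lambda>j. shifted 0 \<omega> (t j))) = (\<lambda>\<omega>. proj A (\<lambda>j. if j \<in> A then shifted 0 \<omega> (t j) else 0))"
    by (intro ext proj_cong) simp
  with m show ?thesis by (simp only:)
qed

text \<open>
  Only the earliest or the latest coordinate can be removed: strong mixing bounds the dependence between
  a past and a future, but not between a present and the past and future together.
\<close>
lemma remove_extreme_coordinate:
  "\<exists>C>0. \<forall>v S a l. admissible v \<and> S \<subseteq> coords \<and> a \<in> S \<and>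
     ((\<forall>b\<in>S - {a}. v a + l \<le> v b) \<or> (\<forall>b\<in>S - {a}. v b + l \<le> v a)) \<longrightarrow>
     \<bar>partial_moment v S - partial_moment v (S - {a})\<bar> \<le> C * (real l + 1) powr (- \<kappa>)"
proof -
  from replacement_step obtain C where C: "C > 0" and step: "\<forall>A c t Q l I. A \<subseteq> {1..m} \<and> c \<in> A \<and> strict_mono_on {1..m} t \<and> (\<forall>j\<in>{1..m}. 1 \<le> t j) \<and>
     Q \<in> borel_measurable borel \<and> (\<forall>\<xi>. \<bar>Q \<xi>\<bar> \<le> hbound) \<and> t ` (A - {c}) \<subseteq> I \<and>
     (\<lambda>\<omega>. Q (shifted 0 \<omega>)) \<in> field_of I \<rightarrow>\<^sub>M borel \<and> I \<subseteq> {1..} \<and> I \<noteq> {} \<and>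
     ((\<forall>i\<in>I. t c + l \<le> i) \<or> (\<forall>i\<in>I. i + l \<le> t c)) \<longrightarrow>
     \<bar>expectation (\<lambda>\<omega>. proj A (\<lambda>j. shifted 0 \<omega> (t j)) * Q (shifted 0 \<omega>)) -
          expectation (\<lambda>\<omega>. proj (A - {c}) (\<lambda>j. shifted 0 \<omega> (t j)) * Q (shifted 0 \<omega>))\<bar>
     \<le> C * (real l + 1) powr (- \<kappa>)" by (elim exE conjE)
  have "\<bar>partial_moment v S - partial_moment v (S - {a})\<bar> \<le> C * (real l + 1) powr (- \<kappa>)"
    if v: "admissible v" and S: "S \<subseteq> coords" "a \<in> S"
      and far: "(\<forall>b\<in>S - {a}. v a + l \<le> v b) \<or> (\<forall>b\<in>S - {a}. v b + l \<le> v a)" for v S a l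
  proof -
    obtain s c where a: "a = (s, c)" by fastforce
    \<comment> \<open>If \<open>a\<close> is the only coordinate left, any admissible time serves as the distant past or future.\<close>
    define I where "I = (if S - {a} = {} then {v a + l} else v ` (S - {a}))"
    let ?t = "\<lambda>j. v (s, j)"
    let ?A = "slice S s" and ?B = "slice S (\<not> s)"
    let ?Q = "\<lambda>\<xi>. proj ?B (\<lambda>j. \<xi> (v (\<not> s, j)))"
    have c: "c \<in> {1..m}" "c \<in> ?A" using S a by (auto simp: slice_def)
    have v1: "1 \<le> v b" if "b \<in> coords" for b
      using v that unfolding admissible_def by (cases b) auto
    have slices: "slice (S - {a}) s = ?A - {c}" "slice (S - {a}) (\<not> s) = ?B"
      using a by (auto simp: slice_def)
    have sw: "partial_moment v R = expectation (\<lambda>\<omega>. proj (slice R s) (\<lambda>j. shifted 0 \<omega> (v (s, j))) *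
       proj (slice R (\<not> s)) (\<lambda>j. shifted 0 \<omega> (v (\<not> s, j))))" for R
      unfolding partial_moment_def by (cases s) (simp_all add: mult.commute)
    have sub: "v ` (S - {a}) \<subseteq> I" unfolding I_def by auto
    have tI: "?t ` (?A - {c}) \<subseteq> I" using sub a by (auto simp: slice_def)
    have BI: "(\<lambda>j. v (\<not> s, j)) ` ?B \<subseteq> I" using sub a by (auto simp: slice_def)
    have I1: "I \<subseteq> {1..}"
    proof (cases "S - {a} = {}")
      case True
      then show ?thesis using v1[of a] S unfolding I_def by auto
    next
      case False
      have "1 \<le> v b" if "b \<in> S - {a}" for b using v1 S that by blast
      then show ?thesis using False unfolding I_def by auto
    qed
    have Ine: "I \<noteq> {}" unfolding I_def by auto
    have farI: "(\<forall>i\<in>I. ?t c + l \<le> i) \<or> (\<forall>i\<in>I. i + l \<le> ?t c)"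
    proof (cases "S - {a} = {}")
      case False
      then show ?thesis using far unfolding I_def a by auto
    qed (simp add: I_def a)
    have "\<bar>expectation (\<lambda>\<omega>. proj ?A (\<lambda>j. shifted 0 \<omega> (?t j)) * ?Q (shifted 0 \<omega>)) -
          expectation (\<lambda>\<omega>. proj (?A - {c}) (\<lambda>j. shifted 0 \<omega> (?t j)) * ?Q (shifted 0 \<omega>))\<bar>
     \<le> C * (real l + 1) powr (- \<kappa>)"
    proof (rule step[rule_format], intro conjI)
      show "?A \<subseteq> {1..m}" by (auto simp: slice_def)
      show "strict_mono_on {1..m} ?t" "\<forall>j\<in>{1..m}. 1 \<le> ?t j" using v by (auto simp: admissible_def)
      show "?Q \<in> borel_measurable borel" by (rule proj_reindex_measurable)
      show "\<forall>\<xi>. \<bar>?Q \<xi>\<bar> \<le> hbound" using proj_bound by blast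
      show "(\<lambda>\<omega>. ?Q (shifted 0 \<omega>)) \<in> borel_measurable (field_of I)" by (rule proj_field_of[OF BI I1])
    qed (fact c tI I1 Ine farI)+
    then show ?thesis unfolding sw slices .
  qed
  note bound = this
  show ?thesis
    by (rule exI[of _ C], rule conjI[OF C], intro allI impI, elim conjE, rule bound)
qed

text \<open>
  The square root of the cost of one replacement.
\<close>
definition weight :: "nat \<Rightarrow> real" where "weight l = (real l + 1) powr (- \<kappa> / 2)"

lemma weight_pos: "weight l > 0" unfolding weight_def by simp

lemma weight_antimono: "l \<le> l' \<Longrightarrow> weight l' \<le> weight l"
  unfolding weight_def using \<kappa>_gt_1 by (intro powr_mono2') auto

lemma weight_square: "weight l * weight l = (real l + 1) powr (- \<kappa>)"
  unfolding weight_def by (simp add: powr_add[symmetric])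

text \<open>
  Two pairs \<open>{a, a'}\<close> and \<open>{b, b'}\<close> of coordinates such that \<open>a\<close> occurs in the first pair only, as
  needed for \<open>sum_PiE_two_gaps\<close>; \<open>a' = b\<close> and \<open>a' = b'\<close> are possible.
\<close>
definition two_pairs :: "((bool \<times> nat) \<times> (bool \<times> nat) \<times> (bool \<times> nat) \<times> (bool \<times> nat)) set" where
  "two_pairs = {(a, a', b, b'). a \<in> coords \<and> a' \<in> coords \<and> b \<in> coords \<and> b' \<in> coords \<and> a \<noteq> a' \<and> a \<noteq> b \<and> a \<noteq> b' \<and> b \<noteq> b'}"

text \<open>
  The cost of reducing a product to two coordinates, up to a constant factor, as a sum over all places
  where the two decisive gaps may be.
\<close>
definition gap_weight :: "(bool \<times> nat \<Rightarrow> nat) \<Rightarrow> real" where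
  "gap_weight v = (\<Sum>(a, a', b, b')\<in>two_pairs. weight (gap (v a) (v a')) * weight (gap (v b) (v b')))"

lemma finite_two_pairs: "finite two_pairs"
  by (rule finite_subset[of _ "coords \<times> coords \<times> coords \<times> coords"]) (auto simp: two_pairs_def)

lemma gap_weight_ge:
  assumes "(a, a', b, b') \<in> two_pairs"
  shows "weight (gap (v a) (v a')) * weight (gap (v b) (v b')) \<le> gap_weight v"
  unfolding gap_weight_def
  using member_le_sum[OF assms, of "\<lambda>(a, a', b, b'). weight (gap (v a) (v a')) * weight (gap (v b) (v b'))"] finite_two_pairs
  by (auto intro: less_imp_le[OF weight_pos] mult_nonneg_nonneg)

lemma gap_weight_nonneg: "gap_weight v \<ge> 0"
  unfolding gap_weight_def by (intro sum_nonneg) (auto intro!: mult_nonneg_nonneg less_imp_le[OF weight_pos])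

text \<open>
  Induction on the number of coordinates in \<open>S\<close>.  The statement is about all subsets \<open>A\<close> at once, because the
  same pair \<open>P\<close> has to serve for all terms of an alternating sum: a coordinate that is extreme in \<open>S\<close>
  is extreme in \<open>A \<inter> S\<close>, and at least as far from the others.
\<close>
lemma reduction_to_pairs:
  "\<exists>C>0. \<forall>v S. admissible v \<and> S \<subseteq> coords \<and> card S \<ge> 2 \<longrightarrow>
     (\<exists>P\<subseteq>S. card P = 2 \<and> (\<forall>A\<subseteq>coords. \<bar>partial_moment v (A \<inter> S) - partial_moment v (A \<inter> P)\<bar> \<le> real (card S) * C * gap_weight v))"
proof -
  from remove_extreme_coordinate obtain C where C: "C > 0" and step: "\<forall>v S a l. admissible v \<and> S \<subseteq> coords \<and> a \<in> S \<and>
     ((\<forall>b\<in>S - {a}. v a + l \<le> v b) \<or> (\<forall>b\<in>S - {a}. v b + l \<le> v a)) \<longrightarrow>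
     \<bar>partial_moment v S - partial_moment v (S - {a})\<bar> \<le> C * (real l + 1) powr (- \<kappa>)" by (elim exE conjE)
  have "\<exists>P\<subseteq>S. card P = 2 \<and> (\<forall>A\<subseteq>coords. \<bar>partial_moment v (A \<inter> S) - partial_moment v (A \<inter> P)\<bar> \<le> real (card S) * C * gap_weight v)"
    if v: "admissible v" and S: "S \<subseteq> coords" "card S \<ge> 2" for v S
    using S
  proof (induction "card S" arbitrary: S rule: less_induct)
    case less
    have fin: "finite S" by (rule finite_subset[OF less.prems(1)]) simp
    show ?case
    proof (cases "card S = 2")
      case True
      then show ?thesis using C gap_weight_nonneg[of v] by (intro exI[of _ S]) auto
    next
      case False
      have "S \<noteq> {}" using less.prems by auto
      then obtain a where a: "a \<in> S" "\<And>s. s \<in> S \<Longrightarrow> v a \<le> v s"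
        using finite_arg_extrema(2)[OF fin, of v] by blast
      have ca: "card (S - {a}) = card S - 1" using a fin by simp
      then have "card (S - {a}) \<noteq> 0" using less.prems False by linarith
      then have "S - {a} \<noteq> {}" by (metis card.empty)
      then obtain b where b: "b \<in> S - {a}" "\<And>s. s \<in> S - {a} \<Longrightarrow> v s \<le> v b"
        using finite_arg_extrema(1)[of "S - {a}" v] fin by blast
      let ?R = "S - {a} - {b}"
      have "card ?R = card S - 2" using b ca fin by simp
      then have "card ?R \<noteq> 0" using less.prems False by linarith
      then have R: "?R \<noteq> {}" by (metis card.empty)
      obtain a' where a': "a' \<in> ?R" "\<And>s. s \<in> ?R \<Longrightarrow> v a' \<le> v s"
        using finite_arg_extrema(2)[of ?R v] R fin by blast
      obtain b' where b': "b' \<in> ?R" "\<And>s. s \<in> ?R \<Longrightarrow> v s \<le> v b'"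
        using finite_arg_extrema(1)[of ?R v] R fin by blast
      have q: "(a, a', b, b') \<in> two_pairs" using a b a' b' less.prems(1) unfolding two_pairs_def by auto
      have ga: "gap (v a) (v a') = v a' - v a" using a a' unfolding gap_def by auto
      have gb: "gap (v b) (v b') = v b - v b'" using b b' unfolding gap_def by auto
      have fa: "v a + gap (v a) (v a') \<le> v s" if "s \<in> S - {a}" for s
      proof -
        have "v a' \<le> v s"
          using a'(2)[of s] that b(2)[of a'] a'(1) by (cases "s = b") auto
        then show ?thesis unfolding ga using a(2)[of a'] a' by auto
      qed
      have fb: "v s + gap (v b) (v b') \<le> v b" if "s \<in> S - {b}" for s
      proof -
        have "v s \<le> v b'"
          using b'(2)[of s] that a(2)[of b'] b'(1) by (cases "s = a") auto
        then show ?thesis unfolding gb using b(2)[of b'] b' by auto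
      qed
      \<comment> \<open>The end with the larger gap is removed.  The error \<open>(l + 1) powr -\<kappa>\<close> for the larger gap
        \<open>l\<close> is at most the product of the square roots of the errors for the two gaps, and a product
        over two distinct pairs of coordinates is what can be summed over all tuples.\<close>
      have "\<exists>x\<in>S. \<forall>A\<subseteq>coords. \<bar>partial_moment v (A \<inter> S) - partial_moment v (A \<inter> (S - {x}))\<bar> \<le> C * gap_weight v"
      proof -
        define x where "x = (if gap (v b) (v b') \<le> gap (v a) (v a') then a else b)"
        define l where "l = max (gap (v a) (v a')) (gap (v b) (v b'))"
        have xS: "x \<in> S" using a b unfolding x_def by auto
        have far: "(\<forall>s\<in>S - {x}. v x + l \<le> v s) \<or> (\<forall>s\<in>S - {x}. v s + l \<le> v x)"
          using fa fb unfolding x_def l_def by (auto simp: max_def)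
        have err: "C * (real l + 1) powr (- \<kappa>) \<le> C * gap_weight v"
        proof (rule mult_left_mono)
          have "weight l * weight l \<le> weight (gap (v a) (v a')) * weight (gap (v b) (v b'))"
            by (intro mult_mono weight_antimono less_imp_le[OF weight_pos]) (auto simp: l_def)
          then show "(real l + 1) powr (- \<kappa>) \<le> gap_weight v"
            using gap_weight_ge[OF q, of v] unfolding weight_square by linarith
        qed (use C in simp)
        have "\<bar>partial_moment v (A \<inter> S) - partial_moment v (A \<inter> (S - {x}))\<bar> \<le> C * gap_weight v" if A: "A \<subseteq> coords" for A
        proof (cases "x \<in> A")
          case True
          have "\<bar>partial_moment v (A \<inter> S) - partial_moment v (A \<inter> S - {x})\<bar> \<le> C * (real l + 1) powr (- \<kappa>)"
            by (rule step[rule_format]) (use v A True xS far in blast)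
          moreover have "A \<inter> S - {x} = A \<inter> (S - {x})" by blast
          ultimately show ?thesis using err by simp
        next
          case False
          then have "A \<inter> (S - {x}) = A \<inter> S" by blast
          then show ?thesis using C gap_weight_nonneg[of v] by simp
        qed
        then show ?thesis using xS by blast
      qed
      then obtain x where x: "x \<in> S" "\<And>A. A \<subseteq> coords \<Longrightarrow> \<bar>partial_moment v (A \<inter> S) - partial_moment v (A \<inter> (S - {x}))\<bar> \<le> C * gap_weight v"
        by blast
      have cx: "card (S - {x}) = card S - 1" using x fin by simp
      have "\<exists>P\<subseteq>S - {x}. card P = 2 \<and> (\<forall>A\<subseteq>coords. \<bar>partial_moment v (A \<inter> (S - {x})) - partial_moment v (A \<inter> P)\<bar> \<le> real (card (S - {x})) * C * gap_weight v)"
        by (rule less.hyps) (use cx less.prems False in auto)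
      then obtain P where P: "P \<subseteq> S - {x}" "card P = 2"
        "\<And>A. A \<subseteq> coords \<Longrightarrow> \<bar>partial_moment v (A \<inter> (S - {x})) - partial_moment v (A \<inter> P)\<bar> \<le> real (card (S - {x})) * C * gap_weight v" by blast
      have "\<bar>partial_moment v (A \<inter> S) - partial_moment v (A \<inter> P)\<bar> \<le> real (card S) * C * gap_weight v" if A: "A \<subseteq> coords" for A
      proof -
        have "real (card S) * C * gap_weight v = C * gap_weight v + real (card (S - {x})) * C * gap_weight v"
          using cx less.prems by (simp add: of_nat_diff algebra_simps)
        then show ?thesis using x(2)[OF A] P(3)[OF A] by linarith
      qed
      then show ?thesis using P by (intro exI[of _ P]) auto
    qed
  qed
  note bound = this
  show ?thesis
    by (rule exI[of _ C], rule conjI[OF C], intro allI impI, elim conjE, rule bound)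
qed

text \<open>
  The combination of projections that yields the kernel with its constant and linear parts removed.
\<close>
definition alternating :: "(nat set \<Rightarrow> real) \<Rightarrow> real" where
  "alternating \<phi> = \<phi> {1..m} - (\<Sum>c\<in>{1..m}. \<phi> {c}) + (real m - 1) * \<phi> {}"

lemma alternating_diff_bound:
  assumes "\<And>A. A \<subseteq> {1..m} \<Longrightarrow> \<bar>\<phi> A - \<psi> A\<bar> \<le> e"
  shows "\<bar>alternating \<phi> - alternating \<psi>\<bar> \<le> 2 * real m * e"
proof -
  have e: "e \<ge> 0" using assms[of "{}"] by auto
  have "alternating \<phi> - alternating \<psi> = (\<phi> {1..m} - \<psi> {1..m}) - (\<Sum>c\<in>{1..m}. \<phi> {c} - \<psi> {c}) + (real m - 1) * (\<phi> {} - \<psi> {})"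
    unfolding alternating_def by (simp add: sum_subtractf algebra_simps)
  moreover have "\<bar>\<Sum>c\<in>{1..m}. \<phi> {c} - \<psi> {c}\<bar> \<le> (\<Sum>c\<in>{1..m}. e)"
    by (intro order_trans[OF sum_abs] sum_mono assms) auto
  moreover have "\<bar>(real m - 1) * (\<phi> {} - \<psi> {})\<bar> \<le> (real m - 1) * e"
    unfolding abs_mult using assms[of "{}"] m_ge_2 by (intro mult_mono) auto
  moreover have "\<bar>\<phi> {1..m} - \<psi> {1..m}\<bar> \<le> e" by (rule assms) simp
  moreover have "(real m - 1) * e = real m * e - e" by (simp add: algebra_simps)
  ultimately show ?thesis by (simp add: abs_le_iff)
qed

text \<open>
  This is the degeneracy of the residual kernel: its projection on a single coordinate, and on none, is
  zero.
\<close>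
lemma alternating_vanishes:
  assumes T: "T \<subseteq> {1..m}" "card T \<le> 1"
  shows "alternating (\<lambda>A. \<gamma> (A \<inter> T)) = 0"
proof -
  have "finite T" using T finite_subset by blast
  then consider "T = {}" | p where "T = {p}" "p \<in> {1..m}"
    using T card_le_Suc0_iff_eq[of T] by (metis One_nat_def insert_subset is_singletonI' is_singleton_def)
  then show ?thesis
  proof cases
    case 1
    then show ?thesis unfolding alternating_def by (simp add: algebra_simps)
  next
    case 2
    have "(\<Sum>c\<in>{1..m}. \<gamma> ({c} \<inter> T)) = \<gamma> {p} + (\<Sum>c\<in>{1..m} - {p}. \<gamma> {})"
      using 2 by (subst sum.remove[of _ p]) (auto intro!: sum.cong arg_cong[where f=\<gamma>])
    also have "\<dots> = \<gamma> {p} + (real m - 1) * \<gamma> {}"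
      using 2 by (simp add: of_nat_diff)
    finally show ?thesis using 2 unfolding alternating_def by (simp add: insert_absorb Int_absorb1)
  qed
qed

definition residual :: "(nat \<Rightarrow> nat) \<Rightarrow> 'a \<Rightarrow> real" where
  "residual t \<omega> = hh (\<lambda>j. shifted 0 \<omega> (t j)) - (\<Sum>c\<in>{1..m}. g1 M m h Y (shifted 0 \<omega> (t c))) - theta M m h Y"

lemma residual_eq_alternating: "residual t \<omega> = alternating (\<lambda>A. proj A (\<lambda>j. shifted 0 \<omega> (t j)))"
  unfolding residual_def alternating_def proj_full proj_empty
  by (simp add: proj_singleton sum.distrib algebra_simps)

definition join :: "nat set \<Rightarrow> nat set \<Rightarrow> (bool \<times> nat) set" where
  "join A B = {True} \<times> A \<union> {False} \<times> B"

lemma proj_shift_integrable: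
  "integrable M (\<lambda>\<omega>. proj A (\<lambda>j. shifted 0 \<omega> (t j)))"
  "integrable M (\<lambda>\<omega>. proj A (\<lambda>j. shifted 0 \<omega> (t j)) * proj B (\<lambda>j. shifted 0 \<omega> (t' j)))"
proof -
  have m: "(\<lambda>\<omega>. proj A (\<lambda>j. shifted 0 \<omega> (t j))) \<in> borel_measurable M" for A t
    by (rule measurable_compose[OF shifted_measurable proj_reindex_measurable])
  show "integrable M (\<lambda>\<omega>. proj A (\<lambda>j. shifted 0 \<omega> (t j)))"
    by (rule integrable_const_bound[where B=hbound]) (use m proj_bound in auto)
  show "integrable M (\<lambda>\<omega>. proj A (\<lambda>j. shifted 0 \<omega> (t j)) * proj B (\<lambda>j. shifted 0 \<omega> (t' j)))"
    by (rule integrable_const_bound[where B="hbound * hbound"])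
      (use m proj_bound hbound(1) in \<open>auto simp: abs_mult intro!: mult_mono borel_measurable_times\<close>)
qed

lemma alternating_expectation:
  assumes "\<And>A. integrable M (\<lambda>\<omega>. F A \<omega>)"
  shows "integrable M (\<lambda>\<omega>. alternating (\<lambda>A. F A \<omega>))" "expectation (\<lambda>\<omega>. alternating (\<lambda>A. F A \<omega>)) = alternating (\<lambda>A. expectation (F A))"
  unfolding alternating_def using assms by simp_all

lemma alternating_mult_right: "alternating (\<lambda>A. \<phi> A * c) = alternating \<phi> * c"
  unfolding alternating_def sum_distrib_right[symmetric] by (simp add: algebra_simps)

lemma alternating_mult_left: "alternating (\<lambda>A. c * \<phi> A) = c * alternating \<phi>"
  unfolding alternating_def sum_distrib_left[symmetric] by (simp add: algebra_simps)

lemma alternating_cong: "(\<And>A. A \<subseteq> {1..m} \<Longrightarrow> \<phi> A = \<psi> A) \<Longrightarrow> alternating \<phi> = alternating \<psi>"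
  unfolding alternating_def by (intro arg_cong2[where f="(+)"] arg_cong2[where f="(-)"] sum.cong arg_cong2[where f="(*)"] refl) auto

lemma expectation_residual_product:
  "integrable M (\<lambda>\<omega>. residual t \<omega> * residual t' \<omega>)"
  "expectation (\<lambda>\<omega>. residual t \<omega> * residual t' \<omega>) =
     alternating (\<lambda>A. alternating (\<lambda>B. partial_moment (\<lambda>(s, j). if s then t j else t' j) (join A B)))"
proof -
  have eq: "residual t \<omega> * residual t' \<omega> = alternating (\<lambda>A. alternating (\<lambda>B. proj A (\<lambda>j. shifted 0 \<omega> (t j)) * proj B (\<lambda>j. shifted 0 \<omega> (t' j))))" for \<omega>
  proof -
    have "alternating (\<lambda>A. alternating (\<lambda>B. p A * q B)) = alternating p * alternating q" for p q
    proof -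
      have "alternating (\<lambda>B. p A * q B) = p A * alternating q" for A by (rule alternating_mult_left)
      then have "alternating (\<lambda>A. alternating (\<lambda>B. p A * q B)) = alternating (\<lambda>A. p A * alternating q)" by (simp only:)
      also have "\<dots> = alternating p * alternating q" by (rule alternating_mult_right)
      finally show ?thesis .
    qed
    then show ?thesis unfolding residual_eq_alternating by (rule sym)
  qed
  note i = alternating_expectation[OF proj_shift_integrable(2)]
  show "integrable M (\<lambda>\<omega>. residual t \<omega> * residual t' \<omega>)"
    unfolding eq by (rule alternating_expectation(1)) (rule i(1))
  have "expectation (\<lambda>\<omega>. residual t \<omega> * residual t' \<omega>) =
     alternating (\<lambda>A. alternating (\<lambda>B. expectation (\<lambda>\<omega>. proj A (\<lambda>j. shifted 0 \<omega> (t j)) * proj B (\<lambda>j. shifted 0 \<omega> (t' j)))))"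
    unfolding eq by (simp only: alternating_expectation(2)[OF i(1)] i(2))
  also have "\<dots> = alternating (\<lambda>A. alternating (\<lambda>B. partial_moment (\<lambda>(s, j). if s then t j else t' j) (join A B)))"
  proof (intro alternating_cong)
    fix A B assume "A \<subseteq> {1..m}" "B \<subseteq> {1..m}"
    then have "slice (join A B) True = A" "slice (join A B) False = B" by (auto simp: slice_def join_def)
    then show "expectation (\<lambda>\<omega>. proj A (\<lambda>j. shifted 0 \<omega> (t j)) * proj B (\<lambda>j. shifted 0 \<omega> (t' j))) =
       partial_moment (\<lambda>(s, j). if s then t j else t' j) (join A B)" unfolding partial_moment_def by simp
  qed
  finally show "expectation (\<lambda>\<omega>. residual t \<omega> * residual t' \<omega>) =
     alternating (\<lambda>A. alternating (\<lambda>B. partial_moment (\<lambda>(s, j). if s then t j else t' j) (join A B)))" .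
qed

text \<open>
  Of two coordinates, at most one belongs to one of the tuples, or none to the other; in either case one
  factor has at most one coordinate left.
\<close>
lemma alternating_alternating_pair_vanishes:
  assumes P: "P \<subseteq> coords" "card P = 2"
  shows "alternating (\<lambda>A. alternating (\<lambda>B. \<gamma> (join A B \<inter> P))) = 0"
proof -
  have eq: "join A B \<inter> P = join (A \<inter> slice P True) (B \<inter> slice P False)" for A B
    using P(1) by (auto simp: join_def slice_def)
  have sl: "slice P s \<subseteq> {1..m}" for s by (auto simp: slice_def)
  have fin: "finite (slice P s)" for s by (rule finite_subset[OF sl]) simp
  have "P = join (slice P True) (slice P False)"
  proof (rule set_eqI)
    fix x :: "bool \<times> nat"
    obtain s j where x: "x = (s, j)" by fastforce
    have "x \<in> P \<Longrightarrow> j \<in> {1..m}" using P(1) x by auto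
    then show "x \<in> P \<longleftrightarrow> x \<in> join (slice P True) (slice P False)"
      unfolding x join_def slice_def by (cases s) auto
  qed
  then have "card P = card ({True} \<times> slice P True \<union> {False} \<times> slice P False)"
    unfolding join_def by (rule arg_cong)
  also have "\<dots> = card (slice P True) + card (slice P False)"
    using fin by (subst card_Un_disjoint) (auto simp: card_cartesian_product)
  finally have "card (slice P True) \<le> 1 \<or> card (slice P False) \<le> 1" using P(2) by linarith
  then show ?thesis
  proof
    assume "card (slice P True) \<le> 1"
    from alternating_vanishes[OF sl this, of "\<lambda>A. alternating (\<lambda>B. \<gamma> (join A (B \<inter> slice P False)))"]
    show ?thesis unfolding eq .
  next
    assume "card (slice P False) \<le> 1"
    from alternating_vanishes[OF sl this]
    have "alternating (\<lambda>B. \<gamma> (join A (B \<inter> slice P False))) = 0" for A .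
    then have "alternating (\<lambda>A. alternating (\<lambda>B. \<gamma> (join A B \<inter> P))) = alternating (\<lambda>A. 0)" unfolding eq by (simp only:)
    then show ?thesis unfolding alternating_def by simp
  qed
qed

lemma expectation_residual_product_bound:
  "\<exists>C>0. \<forall>t t'. strict_mono_on {1..m} t \<and> strict_mono_on {1..m} t' \<and> (\<forall>j\<in>{1..m}. 1 \<le> t j \<and> 1 \<le> t' j) \<longrightarrow>
     \<bar>expectation (\<lambda>\<omega>. residual t \<omega> * residual t' \<omega>)\<bar> \<le> C * gap_weight (\<lambda>(s, j). if s then t j else t' j)"
proof -
  from reduction_to_pairs obtain C where C: "C > 0" and red: "\<forall>v S. admissible v \<and> S \<subseteq> coords \<and> card S \<ge> 2 \<longrightarrow>
     (\<exists>P\<subseteq>S. card P = 2 \<and> (\<forall>A\<subseteq>coords. \<bar>partial_moment v (A \<inter> S) - partial_moment v (A \<inter> P)\<bar> \<le> real (card S) * C * gap_weight v))"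
    by (elim exE conjE)
  have cJ: "card coords = 2 * m" by (simp add: card_cartesian_product)
  let ?C = "2 * real m * (2 * real m * (real (2 * m) * C))"
  have "\<bar>expectation (\<lambda>\<omega>. residual t \<omega> * residual t' \<omega>)\<bar> \<le> ?C * gap_weight (\<lambda>(s, j). if s then t j else t' j)"
    if t: "strict_mono_on {1..m} t" "strict_mono_on {1..m} t'" "\<forall>j\<in>{1..m}. 1 \<le> t j \<and> 1 \<le> t' j" for t t'
  proof -
    let ?v = "\<lambda>(s, j). if s then t j else t' j"
    have adm: "admissible ?v" unfolding admissible_def
    proof
      fix s show "strict_mono_on {1..m} (\<lambda>j. ?v (s, j)) \<and> (\<forall>j\<in>{1..m}. 1 \<le> ?v (s, j))"
        using t by (cases s) simp_all
    qed
    have "\<exists>P\<subseteq>coords. card P = 2 \<and> (\<forall>A\<subseteq>coords. \<bar>partial_moment ?v (A \<inter> coords) - partial_moment ?v (A \<inter> P)\<bar> \<le> real (card coords) * C * gap_weight ?v)"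
      by (rule red[rule_format]) (use adm cJ m_ge_2 in auto)
    then obtain P where P: "P \<subseteq> coords" "card P = 2"
      and near: "\<And>A. A \<subseteq> coords \<Longrightarrow> \<bar>partial_moment ?v (A \<inter> coords) - partial_moment ?v (A \<inter> P)\<bar> \<le> real (2 * m) * C * gap_weight ?v"
      unfolding cJ by blast
    have "\<bar>alternating (\<lambda>A. alternating (\<lambda>B. partial_moment ?v (join A B))) - alternating (\<lambda>A. alternating (\<lambda>B. partial_moment ?v (join A B \<inter> P)))\<bar>
       \<le> 2 * real m * (2 * real m * (real (2 * m) * C * gap_weight ?v))"
    proof (intro alternating_diff_bound)
      fix A B assume "A \<subseteq> {1..m}" "B \<subseteq> {1..m}"
      then have j: "join A B \<subseteq> coords" by (auto simp: join_def)
      then have "join A B \<inter> coords = join A B" by blast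
      then show "\<bar>partial_moment ?v (join A B) - partial_moment ?v (join A B \<inter> P)\<bar> \<le> real (2 * m) * C * gap_weight ?v"
        using near[OF j] by simp
    qed
    then show ?thesis
      unfolding alternating_alternating_pair_vanishes[OF P] expectation_residual_product(2) by (simp add: mult_ac)
  qed
  note bound = this
  have "?C > 0" using C m_ge_2 by simp
  then show ?thesis
    by (intro exI[of _ ?C] conjI allI impI) (assumption, elim conjE, rule bound)
qed

definition increasing_tuples :: "nat \<Rightarrow> (nat \<Rightarrow> nat) set" where
  "increasing_tuples n = {i \<in> {1..m} \<rightarrow>\<^sub>E {1..n}. strict_mono_on {1..m} i}"

text \<open>
  The square is expanded, and the sum over pairs of increasing tuples is extended to all functions from
  the \<open>2 * m\<close> coordinates to \<open>{1..n}\<close>, as the bounds are nonnegative.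
\<close>
lemma degenerate_second_moment:
  "\<exists>C>0. \<forall>n. expectation (\<lambda>\<omega>. (\<Sum>i\<in>increasing_tuples n. residual i \<omega>)\<^sup>2) \<le>
     C * (\<Sum>l<n. weight l)\<^sup>2 * real n ^ (2 * m - 2)"
proof -
  from expectation_residual_product_bound obtain C where C: "C > 0" and bd: "\<forall>t t'. strict_mono_on {1..m} t \<and> strict_mono_on {1..m} t' \<and> (\<forall>j\<in>{1..m}. 1 \<le> t j \<and> 1 \<le> t' j) \<longrightarrow>
     \<bar>expectation (\<lambda>\<omega>. residual t \<omega> * residual t' \<omega>)\<bar> \<le> C * gap_weight (\<lambda>(s, j). if s then t j else t' j)"
    by (elim exE conjE)
  let ?K = "C * (4 * (real (card two_pairs) + 1))"
  have "expectation (\<lambda>\<omega>. (\<Sum>i\<in>increasing_tuples n. residual i \<omega>)\<^sup>2) \<le> ?K * (\<Sum>l<n. weight l)\<^sup>2 * real n ^ (2 * m - 2)" for n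
  proof -
    let ?I = "increasing_tuples n"
    let ?v = "\<lambda>i i' (s, j). if s then i j else i' j"
    have "expectation (\<lambda>\<omega>. (\<Sum>i\<in>?I. residual i \<omega>)\<^sup>2) = (\<Sum>i\<in>?I. \<Sum>i'\<in>?I. expectation (\<lambda>\<omega>. residual i \<omega> * residual i' \<omega>))"
      unfolding power2_eq_square sum_product
      by (simp add: Bochner_Integration.integral_sum expectation_residual_product(1) Bochner_Integration.integrable_sum)
    also have "\<dots> \<le> (\<Sum>i\<in>?I. \<Sum>i'\<in>?I. C * gap_weight (?v i i'))"
    proof (intro sum_mono)
      fix i i' assume "i \<in> ?I" "i' \<in> ?I"
      then have "strict_mono_on {1..m} i \<and> strict_mono_on {1..m} i' \<and> (\<forall>j\<in>{1..m}. 1 \<le> i j \<and> 1 \<le> i' j)"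
        unfolding increasing_tuples_def by (auto simp: PiE_iff)
      from bd[rule_format, OF this]
      show "expectation (\<lambda>\<omega>. residual i \<omega> * residual i' \<omega>) \<le> C * gap_weight (?v i i')" by linarith
    qed
    also have "\<dots> = C * (\<Sum>(i, i')\<in>?I \<times> ?I. gap_weight (?v i i'))"
      by (simp add: sum_distrib_left sum.cartesian_product case_prod_beta')
    also have "\<dots> \<le> C * (4 * (real (card two_pairs) + 1) * ((\<Sum>l<n. weight l)\<^sup>2 * real n ^ (2 * m - 2)))"
    proof (rule mult_left_mono)
    have "(\<Sum>(i, i')\<in>?I \<times> ?I. gap_weight (?v i i')) \<le> (\<Sum>v\<in>coords \<rightarrow>\<^sub>E {1..n}. gap_weight v)"
    proof -
      let ?r = "\<lambda>(i, i'). restrict (?v i i') coords"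
      have QQr: "gap_weight (restrict v coords) = gap_weight v" for v
        unfolding gap_weight_def
      proof (rule sum.cong[OF refl], clarify)
        fix a1 a2 b1 b2 c1 c2 d1 d2
        assume "((a1, a2), (b1, b2), (c1, c2), (d1, d2)) \<in> two_pairs"
        then have "(a1, a2) \<in> coords" "(b1, b2) \<in> coords" "(c1, c2) \<in> coords" "(d1, d2) \<in> coords"
          unfolding two_pairs_def by blast+
        then show "weight (gap (restrict v coords (a1, a2)) (restrict v coords (b1, b2))) * weight (gap (restrict v coords (c1, c2)) (restrict v coords (d1, d2))) =
          weight (gap (v (a1, a2)) (v (b1, b2))) * weight (gap (v (c1, c2)) (v (d1, d2)))"
          by (simp only: restrict_apply if_True)
      qed
      have inj: "inj_on ?r (?I \<times> ?I)"
      proof (rule inj_onI, clarify)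
        fix i i' k k' assume I: "i \<in> ?I" "i' \<in> ?I" "k \<in> ?I" "k' \<in> ?I"
          and eq: "restrict (?v i i') coords = restrict (?v k k') coords"
        have "i j = k j \<and> i' j = k' j" if "j \<in> {1..m}" for j
          using fun_cong[OF eq, of "(True, j)"] fun_cong[OF eq, of "(False, j)"] that by simp
        note pt = this
        have P: "i \<in> {1..m} \<rightarrow>\<^sub>E {1..n}" "k \<in> {1..m} \<rightarrow>\<^sub>E {1..n}" "i' \<in> {1..m} \<rightarrow>\<^sub>E {1..n}" "k' \<in> {1..m} \<rightarrow>\<^sub>E {1..n}"
          using I unfolding increasing_tuples_def by simp_all
        show "i = k \<and> i' = k'"
          using PiE_ext[OF P(1,2)] PiE_ext[OF P(3,4)] pt by blast
      qed
      have "(\<Sum>(i, i')\<in>?I \<times> ?I. gap_weight (?v i i')) = (\<Sum>p\<in>?I \<times> ?I. gap_weight (?r p))"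
      proof (rule sum.cong[OF refl], clarify)
        fix i i' show "gap_weight (?v i i') = gap_weight (restrict (?v i i') coords)" by (rule QQr[symmetric])
      qed
      also have "\<dots> = (\<Sum>v\<in>?r ` (?I \<times> ?I). gap_weight v)"
        using sum.reindex[OF inj, of gap_weight] unfolding comp_def by (rule sym)
      also have "\<dots> \<le> (\<Sum>v\<in>coords \<rightarrow>\<^sub>E {1..n}. gap_weight v)"
      proof (rule sum_mono2)
        show "?r ` (?I \<times> ?I) \<subseteq> coords \<rightarrow>\<^sub>E {1..n}"
        proof (rule image_subsetI)
          fix p assume "p \<in> ?I \<times> ?I"
          then obtain i i' where p: "p = (i, i')" and I: "i \<in> {1..m} \<rightarrow>\<^sub>E {1..n}" "i' \<in> {1..m} \<rightarrow>\<^sub>E {1..n}"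
            unfolding increasing_tuples_def by blast
          have "?v i i' x \<in> {1..n}" if x: "x \<in> coords" for x
          proof -
            obtain s j where sj: "x = (s, j)" by fastforce
            have "j \<in> {1..m}" using x unfolding sj by blast
            then have "i j \<in> {1..n}" "i' j \<in> {1..n}" using I by (blast dest: PiE_mem)+
            then show ?thesis unfolding sj by (cases s) simp_all
          qed
          then show "?r p \<in> coords \<rightarrow>\<^sub>E {1..n}" unfolding p case_prod_conv[of "\<lambda>i i'. restrict (?v i i') coords"]
            by (intro restrict_PiE_iff[THEN iffD2]) blast
        qed
        show "finite (coords \<rightarrow>\<^sub>E {1..n})" by (intro finite_PiE) simp_all
      qed (rule gap_weight_nonneg)
      finally show ?thesis .
    qed
    also have "(\<Sum>v\<in>coords \<rightarrow>\<^sub>E {1..n}. gap_weight v) = (\<Sum>q\<in>two_pairs. \<Sum>v\<in>coords \<rightarrow>\<^sub>E {1..n}. case q of (a, a', b, b') \<Rightarrow> weight (gap (v a) (v a')) * weight (gap (v b) (v b')))"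
      unfolding gap_weight_def by (rule sum.swap)
    also have "\<dots> \<le> (\<Sum>q\<in>two_pairs. (2 * (\<Sum>l<n. weight l))\<^sup>2 * real n ^ (card coords - 2))"
    proof (rule sum_mono)
      fix q assume q: "q \<in> two_pairs"
      obtain a a' b b' where q': "q = (a, a', b, b')" by (cases q)
      have J: "a \<in> coords" "a' \<in> coords" "b \<in> coords" "b' \<in> coords" and ne: "a \<noteq> a'" "a \<noteq> b" "a \<noteq> b'" "b \<noteq> b'"
        using q unfolding q' two_pairs_def by blast+
      have "finite coords" by simp
      from sum_PiE_two_gaps[where n=n, OF less_imp_le[OF weight_pos] this J ne]
      show "(\<Sum>v\<in>coords \<rightarrow>\<^sub>E {1..n}. case q of (a, a', b, b') \<Rightarrow> weight (gap (v a) (v a')) * weight (gap (v b) (v b')))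
        \<le> (2 * (\<Sum>l<n. weight l))\<^sup>2 * real n ^ (card coords - 2)"
        unfolding q' prod.case .
    qed
    also have "\<dots> = 4 * real (card two_pairs) * ((\<Sum>l<n. weight l)\<^sup>2 * real n ^ (2 * m - 2))"
    proof -
      have "card coords = 2 * m" by (simp add: card_cartesian_product)
      then show ?thesis unfolding sum_constant power_mult_distrib by (simp only:) (simp only: mult_ac, simp)
    qed
    also have "\<dots> \<le> 4 * (real (card two_pairs) + 1) * ((\<Sum>l<n. weight l)\<^sup>2 * real n ^ (2 * m - 2))"
      by (intro mult_right_mono) auto
    finally show "(\<Sum>(i, i')\<in>?I \<times> ?I. gap_weight (?v i i')) \<le> 4 * (real (card two_pairs) + 1) * ((\<Sum>l<n. weight l)\<^sup>2 * real n ^ (2 * m - 2))" .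
    qed (use C in simp)
    also have "\<dots> = ?K * (\<Sum>l<n. weight l)\<^sup>2 * real n ^ (2 * m - 2)" by (simp only: mult.assoc)
    finally show ?thesis .
  qed
  note bound = this
  have K: "?K > 0" using C by simp
  show ?thesis by (rule exI[of _ ?K], rule conjI[OF K], intro allI, rule bound)
qed

end

section \<open>The central limit theorem for the linear part\<close>

lemma cesaro_mean:
  fixes f :: "nat \<Rightarrow> real"
  assumes "f \<longlonglongrightarrow> L"
  shows "(\<lambda>n. (\<Sum>k<n. f k) / real n) \<longlonglongrightarrow> L"
proof -
  have "(\<lambda>n. (\<Sum>k<n. f k - L) / real n) \<longlonglongrightarrow> 0"
  proof (rule LIMSEQ_I)
    fix e :: real assume e: "e > 0"
    then obtain N where N: "\<And>k. k \<ge> N \<Longrightarrow> \<bar>f k - L\<bar> < e / 2"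
      using LIMSEQ_D[OF assms, of "e / 2"] by auto
    define K where "K = (\<Sum>k<N. \<bar>f k - L\<bar>)"
    obtain N' :: nat where N': "2 * K / e < N'" using reals_Archimedean2 by blast
    have "norm ((\<Sum>k<n. f k - L) / real n - 0) < e" if n: "n \<ge> N + N' + 1" for n
    proof -
      have "\<bar>\<Sum>k<n. f k - L\<bar> \<le> (\<Sum>k<n. \<bar>f k - L\<bar>)" by (rule sum_abs)
      also have "\<dots> = K + (\<Sum>k\<in>{N..<n}. \<bar>f k - L\<bar>)"
        unfolding K_def using n by (subst sum.union_disjoint[symmetric]) (auto intro!: sum.cong)
      also have "(\<Sum>k\<in>{N..<n}. \<bar>f k - L\<bar>) \<le> (\<Sum>k\<in>{N..<n}. e / 2)"
        using N by (intro sum_mono) (auto intro: less_imp_le)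
      also have "\<dots> \<le> real n * (e / 2)" using e by (simp add: mult_right_mono)
      finally have 1: "\<bar>\<Sum>k<n. f k - L\<bar> \<le> K + real n * (e / 2)" by simp
      have "2 * K < e * N'" using N' e by (simp add: pos_divide_less_eq mult.commute)
      also have "\<dots> \<le> e * real n" using n e by (intro mult_left_mono) auto
      finally have "\<bar>\<Sum>k<n. f k - L\<bar> < real n * e" using 1 by (simp add: mult.commute)
      then show ?thesis using n by (simp add: abs_divide pos_divide_less_eq mult.commute)
    qed
    then show "\<exists>no. \<forall>n\<ge>no. norm ((\<Sum>k<n. f k - L) / real n - 0) < e" by blast
  qed
  then have "(\<lambda>n. (\<Sum>k<n. f k - L) / real n + L) \<longlonglongrightarrow> 0 + L" by (intro tendsto_intros)
  moreover have "eventually (\<lambda>n. (\<Sum>k<n. f k - L) / real n + L = (\<Sum>k<n. f k) / real n) sequentially"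
    using eventually_gt_at_top[of 0] by eventually_elim (simp add: sum_subtractf diff_divide_distrib)
  ultimately show ?thesis by (simp add: tendsto_cong)
qed

text \<open>
  Quadratic decay of the mixing coefficients makes covariances summable and allows
  gaps between blocks much shorter than \<open>sqrt n\<close>.
\<close>
locale bounded_mixing_functional = stationary_process M X for M :: "'a measure" and X +
  fixes G :: "real \<Rightarrow> real" and b Ca :: real
  assumes G_measurable[measurable]: "G \<in> borel_measurable borel"
    and G_bound: "\<And>x. \<bar>G x\<bar> \<le> b"
    and G_mean: "expectation (\<lambda>\<omega>. G (X 1 \<omega>)) = 0"
    and mixing: "\<And>l. l \<ge> 1 \<Longrightarrow> mixing_coeff M X l \<le> Ca / (real l)\<^sup>2"
begin

lemma b_nonneg: "b \<ge> 0" using G_bound[of 0] by linarith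

lemma Ca_nonneg: "Ca \<ge> 0" using mixing[of 1] mixing_coeff_nonneg[of 1] by simp

definition psum :: "nat set \<Rightarrow> 'a \<Rightarrow> real" where "psum I \<omega> = (\<Sum>i\<in>I. G (X i \<omega>))"

lemma GX_field_of: "i \<in> I \<Longrightarrow> (\<lambda>\<omega>. G (X i \<omega>)) \<in> borel_measurable (field_of I)"
  by (rule measurable_compose[OF X_field_of G_measurable])

lemma psum_field_of: "psum I \<in> borel_measurable (field_of I)"
  unfolding psum_def by (intro borel_measurable_sum GX_field_of)

lemma psum_measurable: "I \<subseteq> {1..} \<Longrightarrow> psum I \<in> borel_measurable M"
  by (rule field_of_measurable[OF psum_field_of])

lemma GX_measurable: "i \<ge> 1 \<Longrightarrow> (\<lambda>\<omega>. G (X i \<omega>)) \<in> borel_measurable M"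
  by (rule measurable_compose[OF X_measurable G_measurable])

lemma psum_bound: "\<bar>psum I \<omega>\<bar> \<le> real (card I) * b"
proof -
  have "\<bar>psum I \<omega>\<bar> \<le> (\<Sum>i\<in>I. \<bar>G (X i \<omega>)\<bar>)" unfolding psum_def by (rule sum_abs)
  also have "\<dots> \<le> (\<Sum>i\<in>I. b)" by (intro sum_mono G_bound)
  finally show ?thesis by simp
qed

lemma psum_integrable:
  assumes "I \<subseteq> {1..}"
  shows "integrable M (psum I)" "integrable M (\<lambda>\<omega>. (psum I \<omega>)\<^sup>2)"
proof -
  note [measurable] = psum_measurable[OF assms]
  show "integrable M (psum I)"
    by (rule integrable_const_bound[where B="real (card I) * b"]) (auto intro: psum_bound)
  show "integrable M (\<lambda>\<omega>. (psum I \<omega>)\<^sup>2)"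
  proof (rule integrable_const_bound[where B="(real (card I) * b)\<^sup>2"])
    have "norm ((psum I \<omega>)\<^sup>2) \<le> (real (card I) * b)\<^sup>2" for \<omega>
      using power_mono[OF psum_bound[of I \<omega>], of 2] by simp
    then show "AE \<omega> in M. norm ((psum I \<omega>)\<^sup>2) \<le> (real (card I) * b)\<^sup>2" by simp
  qed measurable
qed

lemma GX_integrable:
  assumes "i \<ge> 1" "k \<ge> 1"
  shows "integrable M (\<lambda>\<omega>. G (X i \<omega>))" "integrable M (\<lambda>\<omega>. G (X i \<omega>) * G (X k \<omega>))"
proof -
  note [measurable] = GX_measurable[OF assms(1)] GX_measurable[OF assms(2)]
  show "integrable M (\<lambda>\<omega>. G (X i \<omega>))"
    by (rule integrable_const_bound[where B=b]) (auto simp: G_bound)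
  show "integrable M (\<lambda>\<omega>. G (X i \<omega>) * G (X k \<omega>))"
  proof (rule integrable_const_bound[where B="b * b"])
    have "norm (G (X i \<omega>) * G (X k \<omega>)) \<le> b * b" for \<omega>
      unfolding real_norm_def abs_mult by (intro mult_mono G_bound b_nonneg) simp
    then show "AE \<omega> in M. norm (G (X i \<omega>) * G (X k \<omega>)) \<le> b * b" by simp
  qed measurable
qed

lemma GX_mean: "i \<ge> 1 \<Longrightarrow> expectation (\<lambda>\<omega>. G (X i \<omega>)) = 0"
  by (rule trans[OF expectation_shift_one[OF G_measurable] G_mean])

definition autocov :: "nat \<Rightarrow> real" where
  "autocov j = expectation (\<lambda>\<omega>. G (X 1 \<omega>) * G (X (1 + j) \<omega>))"

lemma covariance_lag:
  assumes "i \<ge> 1" shows "expectation (\<lambda>\<omega>. G (X i \<omega>) * G (X (i + j) \<omega>)) = autocov j"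
proof -
  have "(\<lambda>\<zeta>. G (\<zeta> (1::nat)) * G (\<zeta> (1 + j))) \<in> borel_measurable borel" by measurable
  from expectation_shift[OF this, of "i - 1"] show ?thesis
    using assms by (simp add: shifted_def autocov_def add.commute)
qed

lemma covariance_gap:
  assumes "i \<ge> 1" "k \<ge> 1" shows "expectation (\<lambda>\<omega>. G (X i \<omega>) * G (X k \<omega>)) = autocov (gap k i)"
proof (cases "i \<le> k")
  case True
  then show ?thesis using covariance_lag[OF assms(1), of "k - i"] by (simp add: gap_def)
next
  case False
  then show ?thesis using covariance_lag[OF assms(2), of "i - k"] by (simp add: gap_def mult.commute)
qed

definition autocov_bound :: "nat \<Rightarrow> real" where "autocov_bound j = (b\<^sup>2 + 16 * b\<^sup>2 * Ca) * inverse ((real (Suc j))\<^sup>2)"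

lemma autocov_bound_nonneg: "autocov_bound j \<ge> 0" unfolding autocov_bound_def using Ca_nonneg by simp

lemma autocov_le: "\<bar>autocov j\<bar> \<le> autocov_bound j"
proof (cases "j = 0")
  case True
  have "\<bar>autocov 0\<bar> \<le> expectation (\<lambda>\<omega>. \<bar>G (X 1 \<omega>) * G (X (1 + 0) \<omega>)\<bar>)"
    unfolding autocov_def by (rule integral_abs_bound)
  also have "\<dots> \<le> b * b"
  proof (rule integral_le_const)
    show "integrable M (\<lambda>\<omega>. \<bar>G (X 1 \<omega>) * G (X (1 + 0) \<omega>)\<bar>)"
      by (intro integrable_abs GX_integrable(2)) simp_all
    have "\<bar>G (X 1 \<omega>) * G (X (1 + 0) \<omega>)\<bar> \<le> b * b" for \<omega>
      unfolding abs_mult by (intro mult_mono G_bound b_nonneg) simp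
    then show "AE \<omega> in M. \<bar>G (X 1 \<omega>) * G (X (1 + 0) \<omega>)\<bar> \<le> b * b" by simp
  qed
  also have "\<dots> \<le> b\<^sup>2 + 16 * b\<^sup>2 * Ca" using Ca_nonneg by (simp add: power2_eq_square)
  finally show ?thesis using True unfolding autocov_bound_def by simp
next
  case False
  have "alpha_bound M borel (\<lambda>\<omega>. G (X 1 \<omega>)) borel (\<lambda>\<omega>. G (X (1 + j) \<omega>)) (mixing_coeff M X j)"
    by (rule alpha_bound_past_future[where n=1]) (auto intro: GX_field_of)
  from covariance_bound[OF this G_bound G_bound]
  have "\<bar>autocov j\<bar> \<le> 4 * b * b * mixing_coeff M X j"
    unfolding autocov_def G_mean by (simp only: mult_zero_left diff_zero)
  also have "\<dots> \<le> 4 * b * b * (Ca / (real j)\<^sup>2)"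
    using False b_nonneg by (intro mult_left_mono mixing) auto
  also have "\<dots> \<le> 4 * b * b * (Ca * (4 * inverse ((real (Suc j))\<^sup>2)))"
  proof (intro mult_left_mono)
    have "(real (Suc j))\<^sup>2 \<le> (2 * real j)\<^sup>2" using False by (intro power_mono) auto
    then have "inverse ((2 * real j)\<^sup>2) \<le> inverse ((real (Suc j))\<^sup>2)" by (intro le_imp_inverse_le) auto
    then have "inverse ((real j)\<^sup>2) \<le> 4 * inverse ((real (Suc j))\<^sup>2)" by (simp add: power_mult_distrib)
    then show "Ca / (real j)\<^sup>2 \<le> Ca * (4 * inverse ((real (Suc j))\<^sup>2))"
      unfolding divide_inverse by (rule mult_left_mono[OF _ Ca_nonneg])
  qed (use b_nonneg in auto)
  also have "\<dots> = (16 * b\<^sup>2 * Ca) * inverse ((real (Suc j))\<^sup>2)" by (simp add: power2_eq_square)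
  also have "\<dots> \<le> autocov_bound j" unfolding autocov_bound_def by (intro mult_right_mono) auto
  finally show ?thesis .
qed

lemma autocov_bound_summable: "summable autocov_bound"
  unfolding autocov_bound_def
proof (rule summable_mult)
  have "summable (\<lambda>n. inverse ((real n)\<^sup>2))" using inverse_power_summable[of 2, where 'a=real] by simp
  then show "summable (\<lambda>j. inverse ((real (Suc j))\<^sup>2))" by (subst summable_Suc_iff)
qed

lemma autocov_summable: "summable autocov"
  by (rule summable_comparison_test'[OF autocov_bound_summable]) (simp add: autocov_le)

definition var_const :: real where "var_const = 2 * (\<Sum>j. autocov_bound j)"

lemma second_moment_expand:
  assumes "I \<subseteq> {1..}" "finite I"
  shows "expectation (\<lambda>\<omega>. (psum I \<omega>)\<^sup>2) = (\<Sum>i\<in>I. \<Sum>k\<in>I. autocov (gap k i))"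
proof -
  have "expectation (\<lambda>\<omega>. (psum I \<omega>)\<^sup>2) = expectation (\<lambda>\<omega>. \<Sum>i\<in>I. \<Sum>k\<in>I. G (X i \<omega>) * G (X k \<omega>))"
    unfolding psum_def by (simp add: power2_eq_square sum_product)
  also have "\<dots> = (\<Sum>i\<in>I. \<Sum>k\<in>I. expectation (\<lambda>\<omega>. G (X i \<omega>) * G (X k \<omega>)))"
    using assms(1) by (subst Bochner_Integration.integral_sum)
      (auto intro!: sum.cong Bochner_Integration.integral_sum Bochner_Integration.integrable_sum GX_integrable simp: subset_iff)
  also have "\<dots> = (\<Sum>i\<in>I. \<Sum>k\<in>I. autocov (gap k i))"
    using assms(1) by (intro sum.cong refl covariance_gap) (auto simp: subset_iff)
  finally show ?thesis .
qed

text \<open>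
  Summability of the covariances gives variances of linear order for sums over arbitrary index sets,
  in particular for the gaps between the blocks.
\<close>
lemma second_moment_bound:
  assumes "I \<subseteq> {1..n}"
  shows "expectation (\<lambda>\<omega>. (psum I \<omega>)\<^sup>2) \<le> var_const * real (card I)"
proof -
  have fin: "finite I" using assms finite_subset by blast
  have I1: "I \<subseteq> {1..}" using assms by auto
  have "expectation (\<lambda>\<omega>. (psum I \<omega>)\<^sup>2) = (\<Sum>i\<in>I. \<Sum>k\<in>I. autocov (gap k i))"
    by (rule second_moment_expand[OF I1 fin])
  also have "\<dots> \<le> (\<Sum>i\<in>I. var_const)"
  proof (rule sum_mono)
    fix i assume i: "i \<in> I"
    have "(\<Sum>k\<in>I. autocov (gap k i)) \<le> (\<Sum>k\<in>I. autocov_bound (gap k i))"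
      by (intro sum_mono order_trans[OF abs_ge_self autocov_le])
    also have "\<dots> \<le> (\<Sum>k\<in>{1..n}. autocov_bound (gap k i))"
      using assms by (intro sum_mono2 autocov_bound_nonneg) auto
    also have "\<dots> \<le> 2 * (\<Sum>l<n. autocov_bound l)"
      using assms i by (intro sum_gap_le autocov_bound_nonneg) auto
    also have "\<dots> \<le> var_const"
      unfolding var_const_def by (intro mult_left_mono sum_le_suminf autocov_bound_summable) (auto intro: autocov_bound_nonneg)
    finally show "(\<Sum>k\<in>I. autocov (gap k i)) \<le> var_const" .
  qed
  finally show ?thesis by (simp add: mult.commute)
qed

lemma first_moment_bound:
  assumes "I \<subseteq> {1..n}"
  shows "expectation (\<lambda>\<omega>. \<bar>psum I \<omega>\<bar>) \<le> sqrt (var_const * real (card I))"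
proof -
  have I1: "I \<subseteq> {1..}" using assms by auto
  show ?thesis
    by (rule order_trans[OF expectation_abs_le_sqrt[OF psum_integrable[OF I1]]])
      (rule real_sqrt_le_mono[OF second_moment_bound[OF assms]])
qed

definition var_sum :: "nat \<Rightarrow> real" where "var_sum p = expectation (\<lambda>\<omega>. (psum {1..p} \<omega>)\<^sup>2)"

definition \<sigma>2 :: real where "\<sigma>2 = autocov 0 + 2 * (\<Sum>j. autocov (Suc j))"

lemma var_sum_nonneg: "var_sum p \<ge> 0" unfolding var_sum_def by (rule Bochner_Integration.integral_nonneg) simp

lemma var_sum_Suc: "var_sum (Suc p) = var_sum p + (autocov 0 + 2 * (\<Sum>j<p. autocov (Suc j)))"
proof -
  let ?g = "\<lambda>i k. autocov (gap k i)"
  have var_sum: "var_sum p = (\<Sum>i\<in>{1..p}. \<Sum>k\<in>{1..p}. ?g i k)" for p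
    unfolding var_sum_def by (rule second_moment_expand) auto
  have lag: "(\<Sum>i\<in>{1..p}. ?g i (Suc p)) = (\<Sum>j<p. autocov (Suc j))" "(\<Sum>k\<in>{1..p}. ?g (Suc p) k) = (\<Sum>j<p. autocov (Suc j))"
    by (rule sum.reindex_bij_witness[where j="\<lambda>i. p - i" and i="\<lambda>j. p - j"]; force simp: gap_def Suc_diff_le)+
  have "var_sum (Suc p) = (\<Sum>i\<in>{1..p}. \<Sum>k\<in>{1..p}. ?g i k) + (\<Sum>i\<in>{1..p}. ?g i (Suc p)) + (\<Sum>k\<in>{1..p}. ?g (Suc p) k) + ?g (Suc p) (Suc p)"
    unfolding var_sum by (simp add: sum.distrib)
  then show ?thesis unfolding lag var_sum[of p] by (simp add: gap_def)
qed

text \<open>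
  The increments of \<open>var_sum\<close> are partial sums of the series that defines \<open>\<sigma>2\<close>, so the claim is
  Cesaro convergence.
\<close>
lemma var_sum_asymptotics: "(\<lambda>p. var_sum p / real p) \<longlonglongrightarrow> \<sigma>2"
proof -
  have V0: "var_sum 0 = 0" unfolding var_sum_def psum_def by simp
  have var_sum: "var_sum p = (\<Sum>k<p. autocov 0 + 2 * (\<Sum>j<k. autocov (Suc j)))" for p
    by (induction p) (simp_all add: V0 var_sum_Suc)
  have "summable (\<lambda>j. autocov (Suc j))" using autocov_summable by (subst summable_Suc_iff)
  then have "(\<lambda>k. \<Sum>j<k. autocov (Suc j)) \<longlonglongrightarrow> (\<Sum>j. autocov (Suc j))" by (rule summable_LIMSEQ)
  then have "(\<lambda>k. autocov 0 + 2 * (\<Sum>j<k. autocov (Suc j))) \<longlonglongrightarrow> \<sigma>2"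
    unfolding \<sigma>2_def by (intro tendsto_intros)
  from cesaro_mean[OF this] show ?thesis unfolding var_sum .
qed

lemma \<sigma>2_nonneg: "\<sigma>2 \<ge> 0"
  by (rule tendsto_lowerbound[OF var_sum_asymptotics]) (auto intro!: always_eventually divide_nonneg_nonneg var_sum_nonneg)

definition block_char :: "nat \<Rightarrow> real \<Rightarrow> complex" where
  "block_char p t = expectation (\<lambda>\<omega>. iexp (t * psum {1..p} \<omega>))"

lemma block_sum_shift: "expectation (\<lambda>\<omega>. iexp (t * psum {a + 1..a + p} \<omega>)) = block_char p t"
proof -
  let ?\<Phi> = "\<lambda>\<zeta> :: nat \<Rightarrow> real. iexp (t * (\<Sum>i\<in>{1..p}. G (\<zeta> i)))"
  have "?\<Phi> \<in> borel_measurable borel" by measurable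
  note sh = expectation_shift[OF this, of a]
  have "(\<Sum>i\<in>{1..p}. G (shifted k \<omega> i)) = psum {k + 1..k + p} \<omega>" for k \<omega>
    unfolding psum_def
    by (rule sum.reindex_bij_witness[where j="\<lambda>i. i + k" and i="\<lambda>i. i - k"]) (auto simp: shifted_def)
  from sh[unfolded this] show ?thesis unfolding block_char_def by simp
qed

text \<open>
  Bernstein's blocks: the gaps of length \<open>q\<close> make consecutive blocks of length \<open>p\<close> nearly
  independent.
\<close>
definition blocks :: "nat \<Rightarrow> nat \<Rightarrow> nat \<Rightarrow> nat set" where
  "blocks p q k = (\<Union>j<k. {j * (p + q) + 1..j * (p + q) + p})"

lemma blocks_subset: "blocks p q k \<subseteq> {1..k * (p + q)}"
proof -
  have "j * (p + q) + p \<le> k * (p + q)" if "j < k" for j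
  proof -
    have "j * (p + q) + p \<le> Suc j * (p + q)" by simp
    also have "\<dots> \<le> k * (p + q)" using that by (intro mult_le_mono1) simp
    finally show ?thesis .
  qed
  then show ?thesis unfolding blocks_def by (fastforce intro: order_trans)
qed

lemma blocks_Suc: "blocks p q (Suc k) = blocks p q k \<union> {k * (p + q) + 1..k * (p + q) + p}"
  unfolding blocks_def by (auto simp: lessThan_Suc)

lemma blocks_disjoint: "blocks p q k \<inter> {k * (p + q) + 1..k * (p + q) + p} = {}"
  using blocks_subset[of p q k] by fastforce

lemma finite_blocks: "finite (blocks p q k)"
  by (rule finite_subset[OF blocks_subset]) simp

lemma psum_blocks_Suc: "psum (blocks p q (Suc k)) \<omega> = psum (blocks p q k) \<omega> + psum {k * (p + q) + 1..k * (p + q) + p} \<omega>"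
  unfolding psum_def blocks_Suc by (intro sum.union_disjoint finite_blocks blocks_disjoint) simp

lemma card_blocks: "card (blocks p q k) = k * p"
proof (induction k)
  case (Suc k)
  then show ?case unfolding blocks_Suc
    by (subst card_Un_disjoint[OF finite_blocks _ blocks_disjoint]) auto
qed (simp add: blocks_def)

text \<open>
  One block after the other is split off; each time the past blocks are \<open>q + 1\<close> steps away from the next
  one.
\<close>
lemma block_factorization:
  assumes p: "p \<ge> 1"
  shows "norm (expectation (\<lambda>\<omega>. iexp (t * psum (blocks p q k) \<omega>)) - block_char p t ^ k) \<le> real k * (16 * mixing_coeff M X (q + 1))"
proof (induction k)
  case 0
  then show ?case by (simp add: blocks_def psum_def prob_space)
next
  case (Suc k)
  let ?\<alpha> = "mixing_coeff M X (q + 1)"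
  let ?B = "{k * (p + q) + 1..k * (p + q) + p}"
  let ?T = "\<lambda>\<omega>. iexp (t * psum (blocks p q k) \<omega>)" and ?U = "\<lambda>\<omega>. iexp (t * psum ?B \<omega>)"
  have cf1: "norm (block_char p t) \<le> 1"
    unfolding block_char_def by (rule order_trans[OF integral_norm_bound]) (simp add: prob_space)
  have split: "(\<lambda>\<omega>. iexp (t * psum (blocks p q (Suc k)) \<omega>)) = (\<lambda>\<omega>. ?T \<omega> * ?U \<omega>)"
    unfolding psum_blocks_Suc by (simp add: distrib_left exp_add)
  have U: "expectation ?U = block_char p t" by (rule block_sum_shift)
  have dec: "norm (expectation (\<lambda>\<omega>. ?T \<omega> * ?U \<omega>) - expectation ?T * expectation ?U) \<le> 16 * ?\<alpha>"
  proof (cases "k = 0")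
    case True
    then show ?thesis using mixing_coeff_nonneg by (simp add: blocks_def psum_def prob_space)
  next
    case False
    let ?n = "(k - 1) * (p + q) + p"
    have keq: "k * (p + q) = ?n + q" using False by (cases k) auto
    have sub: "blocks p q k \<subseteq> {1..?n}"
      using blocks_Suc[of p q "k - 1"] blocks_subset[of p q "k - 1"] False by fastforce
    have m: "(\<lambda>\<omega>. iexp (t * psum I \<omega>)) \<in> borel_measurable (field_of I)" for I
      using psum_field_of[of I] by measurable
    have "alpha_bound M borel ?T borel ?U ?\<alpha>"
    proof (rule alpha_bound_past_future[where n="?n"])
      show "1 \<le> ?n" using p by simp
      show "?T \<in> borel_measurable (field_of {1..?n})" by (rule field_of_mono[OF m sub])
      show "?U \<in> borel_measurable (field_of {?n + (q + 1)..})"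
        by (rule field_of_mono[OF m]) (use keq in auto)
    qed
    then show ?thesis by (rule covariance_bound_complex) auto
  qed
  have "norm (expectation (\<lambda>\<omega>. iexp (t * psum (blocks p q (Suc k)) \<omega>)) - block_char p t ^ Suc k)
     = norm ((expectation (\<lambda>\<omega>. ?T \<omega> * ?U \<omega>) - expectation ?T * expectation ?U) + (expectation ?T - block_char p t ^ k) * block_char p t)"
    unfolding split U by (simp add: algebra_simps)
  also have "\<dots> \<le> 16 * ?\<alpha> + norm (expectation ?T - block_char p t ^ k) * norm (block_char p t)"
    using dec by (intro norm_triangle_le add_mono) (auto simp: norm_mult)
  also have "\<dots> \<le> 16 * ?\<alpha> + norm (expectation ?T - block_char p t ^ k) * 1"
    using cf1 by (intro add_mono mult_left_mono) auto
  also have "\<dots> \<le> real (Suc k) * (16 * ?\<alpha>)"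
    using Suc.IH by (simp add: distrib_right)
  finally show ?case .
qed

text \<open>
  The third absolute moment is estimated by the trivial bound \<open>p * b\<close> of the block sum times its second
  moment.
\<close>
lemma block_char_taylor:
  "norm (block_char p t - (1 - t\<^sup>2 * var_sum p / 2)) \<le> \<bar>t\<bar> ^ 3 / 6 * (real p * b) * var_sum p"
proof -
  have I: "{1..p} \<subseteq> {1..}" by auto
  note m[measurable] = psum_measurable[OF I]
  have [measurable]: "psum {Suc 0..p} \<in> borel_measurable M" using m by simp
  have mean: "expectation (psum {1..p}) = 0"
    unfolding psum_def using GX_mean by (subst Bochner_Integration.integral_sum) (auto intro: GX_integrable)
  have var: "variance (psum {1..p}) = var_sum p" unfolding mean var_sum_def by simp
  have ch: "char (distr M borel (psum {1..p})) t = block_char p t"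
    unfolding char_def block_char_def by (subst integral_distr) auto
  have "norm (block_char p t - (1 - t\<^sup>2 * var_sum p / 2)) \<le> t\<^sup>2 / 6 * expectation (\<lambda>\<omega>. min (6 * (psum {1..p} \<omega>)\<^sup>2) (\<bar>t\<bar> * \<bar>psum {1..p} \<omega>\<bar> ^ 3))"
    unfolding ch[symmetric] using char_approx3'[OF m psum_integrable[OF I] mean var refl, of t] by simp
  also have "\<dots> \<le> t\<^sup>2 / 6 * expectation (\<lambda>\<omega>. \<bar>t\<bar> * (real p * b) * (psum {1..p} \<omega>)\<^sup>2)"
  proof (intro mult_left_mono integral_mono)
    show "integrable M (\<lambda>\<omega>. \<bar>t\<bar> * (real p * b) * (psum {1..p} \<omega>)\<^sup>2)" using psum_integrable[OF I] by simp
    show "integrable M (\<lambda>\<omega>. min (6 * (psum {1..p} \<omega>)\<^sup>2) (\<bar>t\<bar> * \<bar>psum {1..p} \<omega>\<bar> ^ 3))"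
      by (rule Bochner_Integration.integrable_bound[where f="\<lambda>\<omega>. 6 * (psum {1..p} \<omega>)\<^sup>2"])
        (use psum_integrable[OF I] in auto)
    fix \<omega>
    have "\<bar>psum {1..p} \<omega>\<bar> ^ 3 = \<bar>psum {1..p} \<omega>\<bar> * (psum {1..p} \<omega>)\<^sup>2"
      by (simp add: power3_eq_cube power2_eq_square)
    also have "\<dots> \<le> (real p * b) * (psum {1..p} \<omega>)\<^sup>2"
      using psum_bound[of "{1..p}" \<omega>] by (intro mult_right_mono) auto
    finally have "\<bar>t\<bar> * \<bar>psum {1..p} \<omega>\<bar> ^ 3 \<le> \<bar>t\<bar> * ((real p * b) * (psum {1..p} \<omega>)\<^sup>2)"
      by (intro mult_left_mono) auto
    then show "min (6 * (psum {1..p} \<omega>)\<^sup>2) (\<bar>t\<bar> * \<bar>psum {1..p} \<omega>\<bar> ^ 3) \<le> \<bar>t\<bar> * (real p * b) * (psum {1..p} \<omega>)\<^sup>2"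
      by (simp add: mult.assoc)
  qed simp
  also have "\<dots> = \<bar>t\<bar> ^ 3 / 6 * (real p * b) * var_sum p"
    unfolding var_sum_def by (simp add: power3_eq_cube power2_eq_square)
  finally show ?thesis .
qed

lemma iexp_difference:
  assumes [measurable]: "A \<in> borel_measurable M" "B \<in> borel_measurable M" and int: "integrable M (\<lambda>\<omega>. A \<omega> - B \<omega>)"
  shows "norm (expectation (\<lambda>\<omega>. iexp (A \<omega>)) - expectation (\<lambda>\<omega>. iexp (B \<omega>))) \<le> expectation (\<lambda>\<omega>. \<bar>A \<omega> - B \<omega>\<bar>)"
proof -
  have i: "integrable M (\<lambda>\<omega>. iexp (A \<omega>))" "integrable M (\<lambda>\<omega>. iexp (B \<omega>))"
    by (rule integrable_const_bound[where B=1]; simp)+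
  have pt: "norm (iexp x - iexp y) \<le> \<bar>x - y\<bar>" for x y
  proof -
    have "iexp x - iexp y = iexp y * (iexp (x - y) - 1)"
      by (simp add: algebra_simps exp_diff)
    then show ?thesis using iexp_approx1[of "x - y" 0] by (simp add: norm_mult)
  qed
  have "norm (expectation (\<lambda>\<omega>. iexp (A \<omega>)) - expectation (\<lambda>\<omega>. iexp (B \<omega>))) = norm (expectation (\<lambda>\<omega>. iexp (A \<omega>) - iexp (B \<omega>)))"
    using i by simp
  also have "\<dots> \<le> expectation (\<lambda>\<omega>. norm (iexp (A \<omega>) - iexp (B \<omega>)))" by (rule integral_norm_bound)
  also have "\<dots> \<le> expectation (\<lambda>\<omega>. \<bar>A \<omega> - B \<omega>\<bar>)"
    using i int pt by (intro integral_mono) auto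
  finally show ?thesis .
qed

text \<open>
  With blocks of length \<open>n powr (4/9)\<close> and gaps of length \<open>n powr (1/3)\<close> there are about \<open>n powr (5/9)\<close>
  blocks.  The three requirements are that gaps be short compared with blocks, that blocks be short compared with
  \<open>sqrt n\<close>, and that the number of blocks be small compared with the square of the gap length, which is
  of order \<open>n powr (2/3)\<close>.
\<close>
definition block_length :: "nat \<Rightarrow> nat" where "block_length n = nat \<lfloor>real n powr (4 / 9)\<rfloor>"
definition gap_length :: "nat \<Rightarrow> nat" where "gap_length n = nat \<lfloor>real n powr (1 / 3)\<rfloor>"
definition number_of_blocks :: "nat \<Rightarrow> nat" where "number_of_blocks n = n div (block_length n + gap_length n)"

lemma block_length_real: "real (block_length n) = real_of_int \<lfloor>real n powr (4 / 9)\<rfloor>"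
  unfolding block_length_def by simp

lemma gap_length_real: "real (gap_length n) = real_of_int \<lfloor>real n powr (1 / 3)\<rfloor>"
  unfolding gap_length_def by simp

lemma block_length_over_sqrt: "(\<lambda>n. real (block_length n) / sqrt (real n)) \<longlonglongrightarrow> 0"
  unfolding block_length_real by real_asymp

lemma block_length_at_top: "filterlim (\<lambda>n. real (block_length n)) at_top sequentially"
  unfolding block_length_real by real_asymp

lemma block_length_fraction: "(\<lambda>n. real (block_length n) / (real (block_length n) + real (gap_length n))) \<longlonglongrightarrow> 1"
  unfolding block_length_real gap_length_real by real_asymp

lemma block_length_over_n: "(\<lambda>n. real (block_length n) / real n) \<longlonglongrightarrow> 0"
  unfolding block_length_real by real_asymp

lemma block_count_vs_gap: "(\<lambda>n. real n / (real (block_length n) + real (gap_length n)) / (real (gap_length n) + 1)\<^sup>2) \<longlonglongrightarrow> 0"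
  unfolding block_length_real gap_length_real by real_asymp

lemma block_count_at_top: "filterlim (\<lambda>n. real n / (real (block_length n) + real (gap_length n)) - 1) at_top sequentially"
  unfolding block_length_real gap_length_real by real_asymp

lemma block_length_nat_at_top: "filterlim block_length at_top sequentially"
  using block_length_at_top by (simp add: filterlim_sequentially_iff_filterlim_real)

lemma number_of_blocks_bounds:
  "number_of_blocks n * (block_length n + gap_length n) \<le> n" "real n / (real (block_length n) + real (gap_length n)) - 1 \<le> real (number_of_blocks n)"
  "real (number_of_blocks n) \<le> real n / (real (block_length n) + real (gap_length n))"
proof -
  show "number_of_blocks n * (block_length n + gap_length n) \<le> n" unfolding number_of_blocks_def by (rule div_times_less_eq_dividend)
  have k: "real (number_of_blocks n) = of_int \<lfloor>real n / real (block_length n + gap_length n)\<rfloor>"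
    unfolding number_of_blocks_def by (metis floor_divide_of_nat_eq of_int_of_nat_eq)
  show "real n / (real (block_length n) + real (gap_length n)) - 1 \<le> real (number_of_blocks n)"
    "real (number_of_blocks n) \<le> real n / (real (block_length n) + real (gap_length n))"
    unfolding k of_nat_add by linarith+
qed

lemma number_of_blocks_at_top: "filterlim (\<lambda>n. real (number_of_blocks n)) at_top sequentially"
  by (rule filterlim_at_top_mono[OF block_count_at_top]) (intro always_eventually allI number_of_blocks_bounds(2))

lemma block_fraction: "(\<lambda>n. real (number_of_blocks n) * real (block_length n) / real n) \<longlonglongrightarrow> 1"
proof (rule tendsto_sandwich)
  show "(\<lambda>n. real (block_length n) / (real (block_length n) + real (gap_length n)) - real (block_length n) / real n) \<longlonglongrightarrow> 1"
    using tendsto_diff[OF block_length_fraction block_length_over_n] by simp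
  show "eventually (\<lambda>n. real (block_length n) / (real (block_length n) + real (gap_length n)) - real (block_length n) / real n \<le> real (number_of_blocks n) * real (block_length n) / real n) sequentially"
    using eventually_gt_at_top[of 0]
  proof eventually_elim
    case (elim n)
    have "(real n / (real (block_length n) + real (gap_length n)) - 1) * (real (block_length n) / real n) \<le> real (number_of_blocks n) * (real (block_length n) / real n)"
      by (rule mult_right_mono[OF number_of_blocks_bounds(2)]) simp
    moreover have "(real n / (real (block_length n) + real (gap_length n)) - 1) * (real (block_length n) / real n)
        = real n / (real (block_length n) + real (gap_length n)) * (real (block_length n) / real n) - real (block_length n) / real n"
      by (simp only: left_diff_distrib mult_1)
    moreover have "real n / (real (block_length n) + real (gap_length n)) * (real (block_length n) / real n) = real (block_length n) / (real (block_length n) + real (gap_length n))"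
      using elim by simp
    ultimately show ?case by simp
  qed
  show "eventually (\<lambda>n. real (number_of_blocks n) * real (block_length n) / real n \<le> 1) sequentially"
  proof (intro always_eventually allI)
    fix n
    have "number_of_blocks n * block_length n \<le> n" using number_of_blocks_bounds(1)[of n] by (simp add: distrib_left)
    then have "real (number_of_blocks n) * real (block_length n) \<le> real n" by (metis of_nat_le_iff of_nat_mult)
    then show "real (number_of_blocks n) * real (block_length n) / real n \<le> 1" by (simp add: divide_le_eq)
  qed
qed simp

text \<open>
  The distance is split into the contribution of the gaps \<open>B1\<close>, the error of factorisation \<open>B2\<close>, and the
  distance between the power of the characteristic function of one block and the limit.  The latter is
  written as a power with the same exponent, so that it suffices to compare one block with
  \<open>exp (-x / k)\<close>: \<open>B3\<close> is the Taylor error, \<open>B4\<close> compares the variances, and \<open>B5\<close> is the error of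
  linearising \<open>exp\<close>.
\<close>
lemma clt_characteristic:
  "(\<lambda>n. expectation (\<lambda>\<omega>. iexp (\<tau> / sqrt (real n) * psum {1..n} \<omega>))) \<longlonglongrightarrow> of_real (exp (- (\<tau>\<^sup>2 * \<sigma>2 / 2)))"
proof -
  define x where "x = \<tau>\<^sup>2 * \<sigma>2 / 2"
  have x0: "x \<ge> 0" unfolding x_def using \<sigma>2_nonneg by simp
  define fr where "fr n = real (number_of_blocks n) * real (block_length n) / real n" for n
  define vr where "vr n = var_sum (block_length n) / real (block_length n)" for n
  have fr: "fr \<longlonglongrightarrow> 1" unfolding fr_def by (rule block_fraction)
  have vr: "vr \<longlonglongrightarrow> \<sigma>2" unfolding vr_def
    using filterlim_compose[OF var_sum_asymptotics block_length_nat_at_top] by simp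
  define B1 where "B1 n = \<bar>\<tau>\<bar> * sqrt (var_const * (1 - fr n))" for n
  define B2 where "B2 n = 16 * Ca * (real n / (real (block_length n) + real (gap_length n)) / (real (gap_length n) + 1)\<^sup>2)" for n
  define B3 where "B3 n = \<bar>\<tau>\<bar> ^ 3 * b / 6 * (fr n * vr n * (real (block_length n) / sqrt (real n)))" for n
  define B4 where "B4 n = \<bar>\<tau>\<^sup>2 / 2 * (fr n * vr n) - x\<bar>" for n
  define B5 where "B5 n = \<bar>real (number_of_blocks n) * (exp (- x / real (number_of_blocks n)) - 1) + x\<bar>" for n
  have "B1 \<longlonglongrightarrow> \<bar>\<tau>\<bar> * sqrt (var_const * (1 - 1))" unfolding B1_def by (intro tendsto_intros fr)
  then have l1: "B1 \<longlonglongrightarrow> 0" by simp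
  have "B2 \<longlonglongrightarrow> 16 * Ca * 0" unfolding B2_def by (intro tendsto_intros block_count_vs_gap)
  then have l2: "B2 \<longlonglongrightarrow> 0" by simp
  have "B3 \<longlonglongrightarrow> \<bar>\<tau>\<bar> ^ 3 * b / 6 * (1 * \<sigma>2 * 0)" unfolding B3_def by (intro tendsto_mult tendsto_const fr vr block_length_over_sqrt)
  then have l3: "B3 \<longlonglongrightarrow> 0" by simp
  have "B4 \<longlonglongrightarrow> \<bar>\<tau>\<^sup>2 / 2 * (1 * \<sigma>2) - x\<bar>"
    unfolding B4_def by (intro tendsto_rabs tendsto_diff tendsto_mult tendsto_const fr vr)
  then have l4: "B4 \<longlonglongrightarrow> 0" unfolding x_def by simp
  have "((\<lambda>y. y * (exp (- x / y) - 1) + x) \<longlongrightarrow> 0) at_top" by real_asymp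
  from filterlim_compose[OF this number_of_blocks_at_top]
  have l5: "B5 \<longlonglongrightarrow> 0" unfolding B5_def by (rule tendsto_rabs_zero)
  have bound: "eventually (\<lambda>n. norm (expectation (\<lambda>\<omega>. iexp (\<tau> / sqrt (real n) * psum {1..n} \<omega>)) - of_real (exp (- x)))
      \<le> B1 n + B2 n + (B3 n + B4 n + B5 n)) sequentially"
  proof -
    have ev: "eventually (\<lambda>n. real (number_of_blocks n) \<ge> 1) sequentially" "eventually (\<lambda>n. real (block_length n) \<ge> 1) sequentially"
      using number_of_blocks_at_top block_length_at_top unfolding filterlim_at_top by blast+
    show ?thesis using ev eventually_gt_at_top[of 0]
    proof eventually_elim
      case (elim n)
      define t where "t = \<tau> / sqrt (real n)"
      define p where "p = block_length n"
      define q where "q = gap_length n"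
      define k where "k = number_of_blocks n"
      have k1: "real k \<ge> 1" and p1: "real p \<ge> 1" and n0: "real n > 0" using elim unfolding k_def p_def by auto
      have t2: "t\<^sup>2 = \<tau>\<^sup>2 / real n" unfolding t_def using n0 by (simp add: power_divide)
      have t3: "\<bar>t\<bar> ^ 3 = \<bar>\<tau>\<bar> ^ 3 / (real n * sqrt (real n))"
      proof -
        have "sqrt (real n) ^ 3 = real n * sqrt (real n)" using n0 by (simp add: power3_eq_cube)
        then show ?thesis unfolding t_def by (simp add: power_divide abs_divide)
      qed
      let ?bl = "blocks p q k"
      have sub: "?bl \<subseteq> {1..n}" using blocks_subset[of p q k] number_of_blocks_bounds(1)[of n] unfolding k_def p_def q_def by fastforce
      have sub1: "?bl \<subseteq> {1..}" "{1..n} - ?bl \<subseteq> {1..n}" "{1..n} - ?bl \<subseteq> {1..}" "{1..n} \<subseteq> {1..}" using sub by auto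
      have d1: "norm (expectation (\<lambda>\<omega>. iexp (t * psum {1..n} \<omega>)) - expectation (\<lambda>\<omega>. iexp (t * psum ?bl \<omega>))) \<le> B1 n"
      proof -
        have diff: "t * psum {1..n} \<omega> - t * psum ?bl \<omega> = t * psum ({1..n} - ?bl) \<omega>" for \<omega>
          unfolding psum_def using sum_diff[OF _ sub, of "\<lambda>i. G (X i \<omega>)"] by (simp add: right_diff_distrib)
        have "norm (expectation (\<lambda>\<omega>. iexp (t * psum {1..n} \<omega>)) - expectation (\<lambda>\<omega>. iexp (t * psum ?bl \<omega>)))
          \<le> expectation (\<lambda>\<omega>. \<bar>t * psum {1..n} \<omega> - t * psum ?bl \<omega>\<bar>)"
        proof (rule iexp_difference)
          show "(\<lambda>\<omega>. t * psum {1..n} \<omega>) \<in> borel_measurable M" "(\<lambda>\<omega>. t * psum ?bl \<omega>) \<in> borel_measurable M"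
            by (intro borel_measurable_times borel_measurable_const psum_measurable sub1)+
          show "integrable M (\<lambda>\<omega>. t * psum {1..n} \<omega> - t * psum ?bl \<omega>)"
            unfolding diff by (intro integrable_mult_right psum_integrable(1) sub1)
        qed
        also have "\<dots> = \<bar>t\<bar> * expectation (\<lambda>\<omega>. \<bar>psum ({1..n} - ?bl) \<omega>\<bar>)"
          unfolding diff abs_mult by simp
        also have "\<dots> \<le> \<bar>t\<bar> * sqrt (var_const * real (card ({1..n} - ?bl)))"
          by (rule mult_left_mono[OF first_moment_bound[OF sub1(2)]]) simp
        also have "real (card ({1..n} - ?bl)) = real n * (1 - fr n)"
        proof -
          have "card ({1..n} - ?bl) = n - k * p"
            using sub by (simp add: card_Diff_subset[OF finite_blocks] card_blocks)
          moreover have "k * p \<le> n" using card_mono[OF _ sub] by (simp add: card_blocks)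
          ultimately show ?thesis using n0 unfolding fr_def k_def p_def by (simp add: of_nat_diff right_diff_distrib)
        qed
        also have "\<bar>t\<bar> * sqrt (var_const * (real n * (1 - fr n))) = B1 n"
          unfolding B1_def t_def using n0 by (simp add: real_sqrt_mult abs_divide)
        finally show ?thesis .
      qed
      have d2: "norm (expectation (\<lambda>\<omega>. iexp (t * psum ?bl \<omega>)) - block_char p t ^ k) \<le> B2 n"
      proof -
        have "norm (expectation (\<lambda>\<omega>. iexp (t * psum ?bl \<omega>)) - block_char p t ^ k) \<le> real k * (16 * mixing_coeff M X (q + 1))"
          using p1 by (intro block_factorization) simp
        also have "\<dots> \<le> (real n / (real p + real q)) * (16 * (Ca / (real (q + 1))\<^sup>2))"
          using number_of_blocks_bounds(3)[of n] mixing[of "q + 1"] mixing_coeff_nonneg unfolding k_def p_def q_def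
          by (intro mult_mono) auto
        also have "\<dots> = B2 n" unfolding B2_def p_def q_def by (simp add: add.commute)
        finally show ?thesis .
      qed
      have d3: "norm (block_char p t ^ k - of_real (exp (- x))) \<le> B3 n + B4 n + B5 n"
      proof -
        let ?w = "of_real (exp (- x / real k)) :: complex"
        have "?w ^ k = of_real (exp (- x / real k) ^ k)" by simp
        also have "exp (- x / real k) ^ k = exp (- x)"
          using k1 by (simp add: exp_of_nat_mult[symmetric])
        finally have w: "?w ^ k = of_real (exp (- x))" .
        have cf1: "norm (block_char p t) \<le> 1"
          unfolding block_char_def by (rule order_trans[OF integral_norm_bound]) (simp add: prob_space)
        have w1: "norm ?w \<le> 1" using x0 by simp
        have "norm (block_char p t ^ k - ?w ^ k) \<le> real k * norm (block_char p t - ?w)"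
          by (rule norm_power_diff[OF cf1 w1])
        also have "norm (block_char p t - ?w) \<le> norm (block_char p t - (1 - t\<^sup>2 * var_sum p / 2)) + norm (of_real (1 - t\<^sup>2 * var_sum p / 2) - ?w)"
          using norm_triangle_ineq[of "block_char p t - (1 - t\<^sup>2 * var_sum p / 2)" "of_real (1 - t\<^sup>2 * var_sum p / 2) - ?w"] by simp
        also have "norm (of_real (1 - t\<^sup>2 * var_sum p / 2) - ?w) = \<bar>(1 - t\<^sup>2 * var_sum p / 2) - exp (- x / real k)\<bar>"
          by (simp only: of_real_diff[symmetric] norm_of_real)
        finally have "norm (block_char p t ^ k - ?w ^ k) \<le> real k * (norm (block_char p t - (1 - t\<^sup>2 * var_sum p / 2)) + \<bar>(1 - t\<^sup>2 * var_sum p / 2) - exp (- x / real k)\<bar>)"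
          using k1 by (auto simp: mult_left_mono)
        also have "\<dots> \<le> real k * (\<bar>t\<bar> ^ 3 / 6 * (real p * b) * var_sum p) + real k * \<bar>(1 - t\<^sup>2 * var_sum p / 2) - exp (- x / real k)\<bar>"
          unfolding distrib_left by (intro add_mono mult_left_mono block_char_taylor order_refl) simp
        also have "real k * (\<bar>t\<bar> ^ 3 / 6 * (real p * b) * var_sum p) = B3 n"
          unfolding B3_def fr_def vr_def t3 k_def[symmetric] p_def[symmetric] using n0 p1 by (simp add: field_simps)
        also have "real k * \<bar>(1 - t\<^sup>2 * var_sum p / 2) - exp (- x / real k)\<bar> \<le> B4 n + B5 n"
        proof -
          have kt: "real k * (t\<^sup>2 * var_sum p / 2) = \<tau>\<^sup>2 / 2 * (fr n * vr n)"
            unfolding fr_def vr_def t2 k_def[symmetric] p_def[symmetric] using n0 p1 by (simp add: field_simps)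
          have "real k * \<bar>(1 - t\<^sup>2 * var_sum p / 2) - exp (- x / real k)\<bar> = \<bar>real k * ((1 - t\<^sup>2 * var_sum p / 2) - exp (- x / real k))\<bar>"
            by (simp add: abs_mult)
          also have "real k * ((1 - t\<^sup>2 * var_sum p / 2) - exp (- x / real k)) =
              - (\<tau>\<^sup>2 / 2 * (fr n * vr n) - x) - (real k * (exp (- x / real k) - 1) + x)"
            unfolding kt[symmetric] by (simp add: algebra_simps)
          also have "\<bar>\<dots>\<bar> \<le> B4 n + B5 n"
            unfolding B4_def B5_def k_def[symmetric] by linarith
          finally show ?thesis .
        qed
        finally show ?thesis unfolding w by simp
      qed
      have "expectation (\<lambda>\<omega>. iexp (t * psum {1..n} \<omega>)) - of_real (exp (- x)) =
        (expectation (\<lambda>\<omega>. iexp (t * psum {1..n} \<omega>)) - expectation (\<lambda>\<omega>. iexp (t * psum ?bl \<omega>))) +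
        ((expectation (\<lambda>\<omega>. iexp (t * psum ?bl \<omega>)) - block_char p t ^ k) + (block_char p t ^ k - of_real (exp (- x))))" by simp
      also have "norm \<dots> \<le> B1 n + (B2 n + (B3 n + B4 n + B5 n))"
        by (intro norm_triangle_le add_mono d1 d2 d3)
      finally show ?case unfolding t_def by (simp add: add.assoc)
    qed
  qed
  have "(\<lambda>n. B1 n + B2 n + (B3 n + B4 n + B5 n)) \<longlonglongrightarrow> 0 + 0 + (0 + 0 + 0)"
    by (intro tendsto_add l1 l2 l3 l4 l5)
  then have "(\<lambda>n. expectation (\<lambda>\<omega>. iexp (\<tau> / sqrt (real n) * psum {1..n} \<omega>)) - of_real (exp (- x))) \<longlonglongrightarrow> 0"
    using bound by (intro Lim_null_comparison[OF bound]) simp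
  then show ?thesis unfolding x_def by (rule LIM_zero_cancel)
qed

end

section \<open>The Hoeffding decomposition and the limit law\<close>

text \<open>
  Induction on \<open>n\<close>.  The step is the weighted arithmetic-geometric mean inequality
  \<open>n powr (1 - q) * (n + 1) powr q \<le> (1 - q) * n + q * (n + 1)\<close>.
\<close>
lemma sum_powr_le:
  fixes q :: real
  assumes q: "0 < q" "q < 1"
  shows "(\<Sum>l<n. (real l + 1) powr (- q)) \<le> real n powr (1 - q) / (1 - q)"
proof (induction n)
  case (Suc n)
  have step: "real n powr (1 - q) + (1 - q) * (real n + 1) powr (- q) \<le> (real n + 1) powr (1 - q)"
  proof (cases "n = 0")
    case False
    let ?N = "real n + 1"
    have "real n powr (1 - q) * ?N powr q \<le> (1 - q) * real n + q * ?N"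
      using q False by (intro Youngs_inequality_0) auto
    then have "real n powr (1 - q) * ?N powr q + (1 - q) \<le> ?N" by (simp add: algebra_simps)
    then have "(real n powr (1 - q) * ?N powr q + (1 - q)) * ?N powr (- q) \<le> ?N * ?N powr (- q)"
      by (rule mult_right_mono) simp
    moreover have "?N powr q * ?N powr (- q) = 1" by (simp add: powr_add[symmetric])
    moreover have "?N * ?N powr (- q) = ?N powr (1 - q)"
      using powr_add[of ?N 1 "- q"] by simp
    ultimately show ?thesis by (simp add: distrib_right mult.assoc)
  qed (use q in simp)
  have "(\<Sum>l<Suc n. (real l + 1) powr (- q)) \<le> real n powr (1 - q) / (1 - q) + (real n + 1) powr (- q)"
    using Suc by simp
  also have "\<dots> = (real n powr (1 - q) + (1 - q) * (real n + 1) powr (- q)) / (1 - q)"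
    using q by (simp add: add_divide_distrib)
  also have "\<dots> \<le> real (Suc n) powr (1 - q) / (1 - q)"
    using step q by (intro divide_right_mono) (auto simp: add.commute)
  finally show ?case .
qed simp

text \<open>
  The centred normal law with standard deviation \<open>s\<close> is the image of the standard normal law under
  multiplication by \<open>s\<close>.
\<close>
lemma scaled_normal_distribution:
  assumes s: "s > 0"
  shows "real_distribution (density lborel (normal_density 0 s))"
    "char (density lborel (normal_density 0 s)) t = of_real (exp (- (t * s)\<^sup>2 / 2))"
proof -
  interpret N: real_distribution std_normal_distribution by (rule real_dist_normal_dist)
  have "distributed std_normal_distribution lborel (\<lambda>x. x) std_normal_density"
    unfolding distributed_def by (auto simp: distr_id2)
  from N.normal_density_affine[OF this, of s 0]
  have d: "distributed std_normal_distribution lborel (\<lambda>x. s * x) (normal_density 0 s)"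
    using s by simp
  have "density lborel (normal_density 0 s) = distr std_normal_distribution lborel (\<lambda>x. s * x)"
    using distributed_distr_eq_density[OF d] by simp
  also have "\<dots> = distr std_normal_distribution borel (\<lambda>x. s * x)" by (rule distr_cong) auto
  finally have eq: "density lborel (normal_density 0 s) = distr std_normal_distribution borel (\<lambda>x. s * x)" .
  show "real_distribution (density lborel (normal_density 0 s))"
    unfolding eq by (intro N.real_distribution_distr) simp
  have "char (density lborel (normal_density 0 s)) t = char std_normal_distribution (t * s)"
    unfolding eq char_def by (subst integral_distr) (auto simp: mult.assoc)
  then show "char (density lborel (normal_density 0 s)) t = of_real (exp (- (t * s)\<^sup>2 / 2))"
    by (simp add: char_std_normal_distribution)
qed

context u_statistic_mixing
begin

text \<open>
  As \<open>\<kappa> / 2 > 1/2\<close>, the sum of the weights is \<open>O(n powr (1 - q))\<close> for some \<open>q > 1/2\<close>; the cap at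
  \<open>3/4\<close> keeps the exponent \<open>1 - q\<close> positive.
\<close>
lemma weight_sum_small: "(\<lambda>n. (\<Sum>l<n. weight l)\<^sup>2 / real n) \<longlonglongrightarrow> 0"
proof -
  define q where "q = min (\<kappa> / 2) (3 / 4)"
  have q: "1 / 2 < q" "q < 1" "q \<le> \<kappa> / 2" using \<kappa>_gt_1 unfolding q_def by auto
  have le: "(\<Sum>l<n. weight l) \<le> real n powr (1 - q) / (1 - q)" for n
  proof -
    have "(\<Sum>l<n. weight l) \<le> (\<Sum>l<n. (real l + 1) powr (- q))"
      unfolding weight_def using q by (intro sum_mono powr_mono) auto
    also have "\<dots> \<le> real n powr (1 - q) / (1 - q)" using q by (intro sum_powr_le) auto
    finally show ?thesis .
  qed
  show ?thesis
  proof (rule tendsto_sandwich[where f="\<lambda>_. 0" and h="\<lambda>n. (1 / (1 - q))\<^sup>2 * real n powr (1 - 2 * q)"])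
    show "(\<lambda>n. (1 / (1 - q))\<^sup>2 * real n powr (1 - 2 * q)) \<longlonglongrightarrow> 0"
    proof -
      have "(\<lambda>n. real n powr (1 - 2 * q)) \<longlonglongrightarrow> 0"
        using q by (intro tendsto_neg_powr filterlim_real_sequentially) auto
      then show ?thesis by (rule tendsto_mult_right_zero)
    qed
    show "eventually (\<lambda>n. (\<Sum>l<n. weight l)\<^sup>2 / real n \<le> (1 / (1 - q))\<^sup>2 * real n powr (1 - 2 * q)) sequentially"
      using eventually_gt_at_top[of 0]
    proof eventually_elim
      case (elim n)
      have "(\<Sum>l<n. weight l)\<^sup>2 \<le> (real n powr (1 - q) / (1 - q))\<^sup>2"
        by (intro power_mono le sum_nonneg less_imp_le[OF weight_pos])
      also have "\<dots> = (1 / (1 - q))\<^sup>2 * real n powr (2 - 2 * q)"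
        by (simp add: power_divide power2_eq_square powr_add[symmetric])
      finally have "(\<Sum>l<n. weight l)\<^sup>2 / real n \<le> (1 / (1 - q))\<^sup>2 * real n powr (2 - 2 * q) / real n"
        by (intro divide_right_mono) auto
      also have "real n powr (2 - 2 * q) = real n powr (1 - 2 * q) * real n"
        using elim powr_add[of "real n" "1 - 2 * q" 1] by simp
      finally show ?case using elim by simp
    qed
  qed (auto intro!: always_eventually divide_nonneg_nonneg)
qed

abbreviation G1 :: "real \<Rightarrow> real" where "G1 \<equiv> g1 M m h Y"

lemma G1_eq: "G1 x = proj {1} (\<lambda>_. x) - theta M m h Y"
  using proj_singleton[of 1 "\<lambda>_. x"] m_ge_2 by simp

lemma G1_measurable: "G1 \<in> borel_measurable borel"
proof -
  have "(\<lambda>x (_ :: nat). x :: real) \<in> borel \<rightarrow>\<^sub>M borel" by (rule measurable_coordinatewise_then_product) simp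
  from measurable_compose[OF this proj_measurable[of "{1}"]]
  have "(\<lambda>x. proj {1} (\<lambda>_. x) - theta M m h Y) \<in> borel_measurable borel" by simp
  then show ?thesis unfolding G1_eq[abs_def] .
qed

lemma G1_bound: "\<bar>G1 x\<bar> \<le> 2 * hbound"
  unfolding G1_eq using proj_bound[of "{1}" "\<lambda>_. x"] proj_bound[of "{}" "\<lambda>_. x"] proj_empty[of "\<lambda>_. x"] by linarith

text \<open>
  Since \<open>X 1\<close> has the law of the copies and is independent of them, it may take the place of the first copy.
\<close>
lemma G1_mean: "expectation (\<lambda>\<omega>. G1 (X 1 \<omega>)) = 0"
proof -
  have c: "1 \<in> {1..m}" using m_ge_2 by simp
  let ?W = "\<lambda>\<omega> j. if j \<in> {1..m} - {1} then yvec id \<omega> j else 0"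
  let ?F = "\<lambda>z. hh ((snd z)(1 := fst z))"
  have Wm: "(\<lambda>\<eta> j. if j \<in> {1..m} - {1} then \<eta> j else 0 :: real) \<in> borel \<rightarrow>\<^sub>M borel"
  proof (rule measurable_coordinatewise_then_product)
    fix j show "(\<lambda>\<eta>. if j \<in> {1..m} - {1} then \<eta> j else 0 :: real) \<in> borel_measurable borel"
      by (cases "j \<in> {1..m} - {1}") (simp_all only: if_True if_False measurable_product_coordinates measurable_const, simp)
  qed
  have Fm: "?F \<in> borel_measurable (borel \<Otimes>\<^sub>M borel)"
  proof -
    have "(\<lambda>z :: real \<times> (nat \<Rightarrow> real). (snd z)(1 := fst z)) \<in> borel \<Otimes>\<^sub>M borel \<rightarrow>\<^sub>M borel"
    proof (rule measurable_coordinatewise_then_product)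
      fix j :: nat
      have "(\<lambda>z :: real \<times> (nat \<Rightarrow> real). snd z j) \<in> borel_measurable (borel \<Otimes>\<^sub>M borel)"
        by (rule measurable_product_then_coordinatewise[OF measurable_snd])
      then show "(\<lambda>z :: real \<times> (nat \<Rightarrow> real). ((snd z)(1 := fst z)) j) \<in> borel_measurable (borel \<Otimes>\<^sub>M borel)"
        by (cases "j = 1") simp_all
    qed
    then show ?thesis by (rule measurable_compose[OF _ hh_measurable])
  qed
  have m1: "(\<lambda>\<omega>. shifted 0 \<omega> 1) \<in> borel_measurable M" "(\<lambda>\<omega>. yvec id \<omega> 1) \<in> borel_measurable M"
    by (rule measurable_product_then_coordinatewise[OF shifted_measurable],
        rule measurable_product_then_coordinatewise[OF yvec_id_measurable])
  have mW: "?W \<in> M \<rightarrow>\<^sub>M borel" by (rule measurable_compose[OF yvec_id_measurable Wm])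
  have sX: "(\<lambda>\<omega>. shifted 0 \<omega> 1) = X 1" by (simp add: shifted_def)
  have sY: "(\<lambda>\<omega>. yvec id \<omega> 1) = Y 1" using c by (simp add: yvec_def)
  have law: "distr M borel (\<lambda>\<omega>. yvec id \<omega> 1) = distr M borel (\<lambda>\<omega>. shifted 0 \<omega> 1)"
    unfolding sX sY using iid unfolding iid_copies_def by simp
  have l1: "distr M (borel \<Otimes>\<^sub>M borel) (\<lambda>\<omega>. (shifted 0 \<omega> 1, ?W \<omega>)) =
      distr M borel (\<lambda>\<omega>. shifted 0 \<omega> 1) \<Otimes>\<^sub>M distr M borel ?W"
    by (rule alpha_bound_0_imp_product_law[OF alpha_bound_compose[OF alpha_bound_shifted_yvec measurable_product_coordinates Wm]])
  have l2: "distr M (borel \<Otimes>\<^sub>M borel) (\<lambda>\<omega>. (yvec id \<omega> 1, ?W \<omega>)) =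
      distr M borel (\<lambda>\<omega>. shifted 0 \<omega> 1) \<Otimes>\<^sub>M distr M borel ?W"
    using alpha_bound_0_imp_product_law[OF yvec_split_independent[OF c measurable_ident]]
    unfolding law by simp
  have "expectation (\<lambda>\<omega>. ?F (shifted 0 \<omega> 1, ?W \<omega>)) = expectation (\<lambda>\<omega>. ?F (yvec id \<omega> 1, ?W \<omega>))"
    by (rule trans[OF expectation_product_law[OF m1(1) mW m1(1) mW l1 Fm]
          expectation_product_law[OF m1(1) mW m1(2) mW l2 Fm, symmetric]])
  moreover have "?F (yvec id \<omega> 1, ?W \<omega>) = proj {1..m} (yvec id \<omega>)" for \<omega>
    unfolding proj_full by (rule hh_cong) simp
  moreover have "?F (shifted 0 \<omega> 1, ?W \<omega>) = hh (\<lambda>j. if j \<in> {1} then shifted 0 \<omega> ((\<lambda>_. 1) j) else yvec id \<omega> j)" for \<omega>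
    by (rule hh_cong) simp
  ultimately have "expectation (\<lambda>\<omega>. hh (\<lambda>j. if j \<in> {1} then shifted 0 \<omega> ((\<lambda>_. 1) j) else yvec id \<omega> j) * 1) =
      expectation (\<lambda>\<omega>. hh (yvec id \<omega>))"
    unfolding proj_full by simp
  moreover have "expectation (\<lambda>\<omega>. hh (\<lambda>j. if j \<in> {1} then shifted 0 \<omega> ((\<lambda>_. 1) j) else yvec id \<omega> j) * (\<lambda>_. 1) (shifted 0 \<omega>))
      = expectation (\<lambda>\<omega>. proj {1} (\<lambda>j. shifted 0 \<omega> ((\<lambda>_. 1) j)) * (\<lambda>_. 1) (shifted 0 \<omega>))"
    by (rule expectation_proj[where B=1, symmetric]) auto
  moreover have "expectation (\<lambda>\<omega>. hh (yvec id \<omega>)) = theta M m h Y"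
    using proj_empty[of "\<lambda>_. 0"] unfolding proj_def by simp
  ultimately have e: "expectation (\<lambda>\<omega>. proj {1} (\<lambda>_. shifted 0 \<omega> 1)) = theta M m h Y" by simp
  have "(\<lambda>\<omega>. proj {1} (\<lambda>_. shifted 0 \<omega> 1)) = (\<lambda>\<omega>. proj {1} (\<lambda>_. X 1 \<omega>))" by (simp add: shifted_def)
  with e have "expectation (\<lambda>\<omega>. proj {1} (\<lambda>_. X 1 \<omega>)) = theta M m h Y" by simp
  moreover have "integrable M (\<lambda>\<omega>. proj {1} (\<lambda>_. X 1 \<omega>))"
    using proj_shift_integrable(1)[of "{1}" "\<lambda>_. 1"] by (simp add: shifted_def)
  ultimately show ?thesis unfolding G1_eq by (simp add: prob_space)
qed

text \<open>
  The constant of the quadratic mixing bound; it has to be a definite term to serve as a parameter of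
  the interpretation below.
\<close>
definition Calpha :: real where
  "Calpha = (SOME C. \<forall>l\<ge>1. mixing_coeff M X l \<le> C / (real l)\<^sup>2)"

lemma Calpha: "l \<ge> 1 \<Longrightarrow> mixing_coeff M X l \<le> Calpha / (real l)\<^sup>2"
proof -
  obtain C where C: "C > 0" "\<And>l. l \<ge> 1 \<Longrightarrow> mixing_coeff M X l \<le> C * real l powr (- \<delta>)"
    using mixing_polynomial_bound[OF mixing_rate] \<delta>_gt_2 by auto
  have "\<forall>l\<ge>1. mixing_coeff M X l \<le> C / (real l)\<^sup>2"
  proof (intro allI impI)
    fix l :: nat assume l: "l \<ge> 1"
    have "real l powr (- \<delta>) \<le> real l powr (- 2)" using l \<delta>_gt_2 by (intro powr_mono) auto
    also have "\<dots> = 1 / (real l)\<^sup>2" using l by (simp add: powr_minus powr_numeral divide_inverse)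
    finally have "C * real l powr (- \<delta>) \<le> C * (1 / (real l)\<^sup>2)" using C(1) by (intro mult_left_mono) auto
    then show "mixing_coeff M X l \<le> C / (real l)\<^sup>2" using C(2)[OF l] by simp
  qed
  then have "\<forall>l\<ge>1. mixing_coeff M X l \<le> Calpha / (real l)\<^sup>2"
    unfolding Calpha_def by (rule someI[of "\<lambda>C. \<forall>l\<ge>1. mixing_coeff M X l \<le> C / (real l)\<^sup>2"])
  then show "l \<ge> 1 \<Longrightarrow> mixing_coeff M X l \<le> Calpha / (real l)\<^sup>2" by blast
qed

sublocale lin: bounded_mixing_functional M X G1 "2 * hbound" Calpha
  by unfold_locales (fact G1_measurable G1_bound G1_mean Calpha)+

lemma g1_cov_eq: "g1_cov M m h X Y j = lin.autocov (Suc j)"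
proof -
  have "expectation (\<lambda>\<omega>. G1 (X (1 + Suc j) \<omega>)) = 0" by (rule lin.GX_mean) simp
  then show ?thesis unfolding g1_cov_def covar_def lin.autocov_def G1_mean by (simp only: diff_zero)
qed

lemma asymp_var_eq: "asymp_var M m h X Y = lin.\<sigma>2"
proof -
  have "var M (\<lambda>\<omega>. G1 (X 1 \<omega>)) = lin.autocov 0"
    unfolding var_def lin.autocov_def G1_mean by (simp add: power2_eq_square)
  then show ?thesis unfolding asymp_var_def lin.\<sigma>2_def g1_cov_eq by simp
qed

lemma g1_cov_summable: "summable (g1_cov M m h X Y)"
  unfolding g1_cov_eq[abs_def] using lin.autocov_summable by (subst summable_Suc_iff)

lemma bij_increasing_tuples_subsets:
  "bij_betw (\<lambda>i. i ` {1..m}) (increasing_tuples n) {B. B \<subseteq> {1..n} \<and> card B = m}"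
  unfolding bij_betw_def
proof (intro conjI inj_onI set_eqI iffI)
  fix i i' assume I: "i \<in> increasing_tuples n" "i' \<in> increasing_tuples n" and eq: "i ` {1..m} = i' ` {1..m}"
  have srt: "sorted_wrt (<) (map k [1..<Suc m])" if "k \<in> increasing_tuples n" for k
    unfolding sorted_wrt_iff_nth_less
  proof (intro allI impI)
    fix a b assume ab: "a < b" "b < length (map k [1..<Suc m])"
    have len: "length [1..<Suc m] = m" by (simp only: length_upt diff_Suc_1)
    have bm: "b < m" using ab(2) unfolding length_map len .
    have nth: "map k [1..<Suc m] ! c = k (1 + c)" if "c < m" for c
    proof -
      have "1 + c < Suc m" using that by linarith
      from nth_upt[OF this] show ?thesis
        using nth_map[of c "[1..<Suc m]" k] that unfolding len by argo
    qed
    have "strict_mono_on {1..m} k" using that unfolding increasing_tuples_def by blast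
    moreover have "1 + a \<in> {1..m}" "1 + b \<in> {1..m}" "1 + a < 1 + b"
      using ab(1) bm unfolding atLeastAtMost_iff by linarith+
    ultimately have "k (1 + a) < k (1 + b)" by (rule strict_mono_onD)
    moreover have "a < m" using ab(1) bm by linarith
    ultimately show "map k [1..<Suc m] ! a < map k [1..<Suc m] ! b" unfolding nth[OF bm] nth[OF \<open>a < m\<close>] by blast
  qed
  have st: "set (map k [1..<Suc m]) = k ` {1..m}" for k :: "nat \<Rightarrow> nat"
    by (simp only: set_map set_upt atLeastLessThanSuc_atLeastAtMost)
  have "map i [1..<Suc m] = map i' [1..<Suc m]"
    by (rule strict_sorted_equal[OF srt[OF I(2)] srt[OF I(1)]]) (simp only: st eq)
  then have pt: "i j = i' j" if "j \<in> {1..m}" for j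
    using that unfolding map_eq_conv set_upt atLeastLessThanSuc_atLeastAtMost by blast
  have P: "i \<in> {1..m} \<rightarrow>\<^sub>E {1..n}" "i' \<in> {1..m} \<rightarrow>\<^sub>E {1..n}" using I unfolding increasing_tuples_def by simp_all
  show "i = i'" by (rule PiE_ext[OF P pt])
next
  fix B assume "B \<in> (\<lambda>i. i ` {1..m}) ` increasing_tuples n"
  then obtain i where i: "i \<in> {1..m} \<rightarrow>\<^sub>E {1..n}" "strict_mono_on {1..m} i" "B = i ` {1..m}"
    unfolding increasing_tuples_def by blast
  have "card B = m" using card_image[OF strict_mono_on_imp_inj_on[OF i(2)]] i(3) by simp
  moreover have "B \<subseteq> {1..n}" using i(1,3) by (auto dest: PiE_mem)
  ultimately show "B \<in> {B. B \<subseteq> {1..n} \<and> card B = m}" by simp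
next
  fix B assume "B \<in> {B. B \<subseteq> {1..n} \<and> card B = m}"
  then have B: "B \<subseteq> {1..n}" "card B = m" by auto
  have "finite B" using B(1) finite_subset by blast
  then obtain e where e: "bij_betw e {..<m} B" "strict_mono_on {..<m} e"
    using ex_bij_betw_strict_mono_card[of B] B(2) by auto
  define i where "i = (\<lambda>j\<in>{1..m}. e (j - 1))"
  have "i ` {1..m} = e ` ((\<lambda>j. j - 1) ` {1..m})" unfolding i_def by (auto simp: image_image)
  also have "(\<lambda>j. j - 1) ` {1..m} = {..<m}"
  proof (intro set_eqI iffI)
    fix j assume "j \<in> {..<m}"
    then show "j \<in> (\<lambda>j. j - 1) ` {1..m}" by (intro image_eqI[of _ _ "Suc j"]) auto
  qed auto
  finally have img: "i ` {1..m} = B" using e(1) by (simp add: bij_betw_def)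
  have "strict_mono_on {1..m} i"
  proof (rule strict_mono_onI)
    fix a b assume ab: "a \<in> {1..m}" "b \<in> {1..m}" "a < b"
    then have "e (a - 1) < e (b - 1)" by (intro strict_mono_onD[OF e(2)]) auto
    then show "i a < i b" using ab unfolding i_def by simp
  qed
  moreover have "i \<in> {1..m} \<rightarrow>\<^sub>E {1..n}" using img B(1) unfolding i_def by (intro PiE_I) (auto simp: image_subset_iff)
  ultimately have "i \<in> increasing_tuples n" unfolding increasing_tuples_def by simp
  then show "B \<in> (\<lambda>i. i ` {1..m}) ` increasing_tuples n" using img by blast
qed

lemma card_increasing_tuples: "card (increasing_tuples n) = n choose m"
  using bij_betw_same_card[OF bij_increasing_tuples_subsets[of n]] n_subsets[of "{1..n}" m] by simp

text \<open>
  Increasing tuples correspond to \<open>m\<close>-element subsets, and a given time lies in as many of them as there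
  are \<open>(m - 1)\<close>-element subsets of the other times.
\<close>
lemma sum_coordinates_increasing_tuples:
  fixes f :: "nat \<Rightarrow> real"
  shows "(\<Sum>i\<in>increasing_tuples n. \<Sum>c\<in>{1..m}. f (i c)) = real ((n - 1) choose (m - 1)) * (\<Sum>t\<in>{1..n}. f t)"
proof -
  let ?B = "{B. B \<subseteq> {1..n} \<and> card B = m}"
  have finB: "finite ?B" by (rule finite_subset[of _ "Pow {1..n}"]) auto
  have "(\<Sum>i\<in>increasing_tuples n. \<Sum>c\<in>{1..m}. f (i c)) = (\<Sum>i\<in>increasing_tuples n. \<Sum>t\<in>i ` {1..m}. f t)"
  proof (rule sum.cong[OF refl])
    fix i assume "i \<in> increasing_tuples n"
    then have "inj_on i {1..m}" unfolding increasing_tuples_def using strict_mono_on_imp_inj_on by blast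
    then show "(\<Sum>c\<in>{1..m}. f (i c)) = (\<Sum>t\<in>i ` {1..m}. f t)" by (simp add: sum.reindex)
  qed
  also have "\<dots> = (\<Sum>B\<in>?B. \<Sum>t\<in>B. f t)"
    by (rule sum.reindex_bij_betw[OF bij_increasing_tuples_subsets])
  also have "\<dots> = (\<Sum>B\<in>?B. \<Sum>t\<in>{1..n}. if t \<in> B then f t else 0)"
  proof (rule sum.cong[OF refl])
    fix B assume "B \<in> ?B"
    then have "{1..n} \<inter> B = B" by auto
    then show "(\<Sum>t\<in>B. f t) = (\<Sum>t\<in>{1..n}. if t \<in> B then f t else 0)"
      using sum.inter_restrict[of "{1..n}" f B] by simp
  qed
  also have "\<dots> = (\<Sum>t\<in>{1..n}. \<Sum>B\<in>?B. if t \<in> B then f t else 0)" by (rule sum.swap)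
  also have "\<dots> = (\<Sum>t\<in>{1..n}. real ((n - 1) choose (m - 1)) * f t)"
  proof (rule sum.cong[OF refl])
    fix t assume t: "t \<in> {1..n}"
    let ?C = "{C. C \<subseteq> {1..n} - {t} \<and> card C = m - 1}"
    have "bij_betw (insert t) ?C {B \<in> ?B. t \<in> B}"
    proof (rule bij_betw_byWitness[where f'="\<lambda>B. B - {t}"])
      show "insert t ` ?C \<subseteq> {B \<in> ?B. t \<in> B}"
      proof (rule image_subsetI)
        fix C assume C: "C \<in> ?C"
        then have "finite C" using finite_subset[of C "{1..n} - {t}"] by simp
        moreover have "t \<notin> C" using C by blast
        ultimately have "card (insert t C) = m" using C m_ge_2 by simp
        then show "insert t C \<in> {B \<in> ?B. t \<in> B}" using C t by auto
      qed
      show "(\<lambda>B. B - {t}) ` {B \<in> ?B. t \<in> B} \<subseteq> ?C" by (auto simp: card_Diff_singleton)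
    qed auto
    then have "card {B \<in> ?B. t \<in> B} = card ?C" by (rule bij_betw_same_card[symmetric])
    also have "\<dots> = (n - 1) choose (m - 1)" using n_subsets[of "{1..n} - {t}" "m - 1"] t by simp
    finally have cnt: "card {B \<in> ?B. t \<in> B} = (n - 1) choose (m - 1)" .
    have "(\<Sum>B\<in>?B. if t \<in> B then f t else 0) = (\<Sum>B\<in>{B \<in> ?B. t \<in> B}. f t)"
      by (rule sum.inter_filter[OF finB, symmetric])
    then show "(\<Sum>B\<in>?B. if t \<in> B then f t else 0) = real ((n - 1) choose (m - 1)) * f t"
      using cnt by simp
  qed
  finally show ?thesis by (simp add: sum_distrib_left)
qed

definition remainder :: "nat \<Rightarrow> 'a \<Rightarrow> real" where
  "remainder n \<omega> = sqrt (real n) / real (n choose m) * (\<Sum>i\<in>increasing_tuples n. residual i \<omega>)"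

lemma hoeffding_decomposition:
  assumes n: "n \<ge> m"
  shows "sqrt (real n) * (U_stat m h X n \<omega> - theta M m h Y) = real m / sqrt (real n) * lin.psum {1..n} \<omega> + remainder n \<omega>"
proof -
  let ?I = "increasing_tuples n" and ?C = "real (n choose m)" and ?\<theta> = "theta M m h Y"
  have C0: "?C > 0" using n by simp
  have n0: "real n > 0" using n m_ge_2 by simp
  have ge1: "1 \<le> i j" if "i \<in> ?I" "j \<in> {1..m}" for i j
    using that unfolding increasing_tuples_def by (auto dest: PiE_mem)
  have "(\<Sum>i\<in>?I. h (\<lambda>j\<in>{1..m}. X (i j) \<omega>)) = (\<Sum>i\<in>?I. residual i \<omega> + (\<Sum>c\<in>{1..m}. G1 (X (i c) \<omega>)) + ?\<theta>)"
  proof (rule sum.cong[OF refl])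
    fix i assume i: "i \<in> ?I"
    have "h (\<lambda>j\<in>{1..m}. X (i j) \<omega>) = hh (\<lambda>j. shifted 0 \<omega> (i j))"
      unfolding hh_def using ge1[OF i] by (intro arg_cong[where f=h]) (simp add: fun_eq_iff shifted_def restrict_def)
    moreover have "(\<Sum>c\<in>{1..m}. G1 (shifted 0 \<omega> (i c))) = (\<Sum>c\<in>{1..m}. G1 (X (i c) \<omega>))"
      using ge1[OF i] by (intro sum.cong refl) (simp add: shifted_def)
    ultimately show "h (\<lambda>j\<in>{1..m}. X (i j) \<omega>) = residual i \<omega> + (\<Sum>c\<in>{1..m}. G1 (X (i c) \<omega>)) + ?\<theta>"
      unfolding residual_def by simp
  qed
  also have "\<dots> = (\<Sum>i\<in>?I. residual i \<omega>) + real ((n - 1) choose (m - 1)) * lin.psum {1..n} \<omega> + ?C * ?\<theta>"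
    by (simp only: sum.distrib sum_constant card_increasing_tuples lin.psum_def
        sum_coordinates_increasing_tuples[of "\<lambda>t. G1 (X t \<omega>)"])
  finally have U: "U_stat m h X n \<omega> = ((\<Sum>i\<in>?I. residual i \<omega>) + real ((n - 1) choose (m - 1)) * lin.psum {1..n} \<omega> + ?C * ?\<theta>) / ?C"
    unfolding U_stat_def increasing_tuples_def by simp
  have "real m * ?C = real n * real ((n - 1) choose (m - 1))"
    using times_binomial_minus1_eq[of m n] m_ge_2 by (metis of_nat_mult less_le_trans zero_less_numeral)
  then have bin: "real ((n - 1) choose (m - 1)) / ?C = real m / real n"
    using C0 n0 by (simp add: field_simps)
  have "U_stat m h X n \<omega> - ?\<theta> = (\<Sum>i\<in>?I. residual i \<omega>) / ?C + real ((n - 1) choose (m - 1)) / ?C * lin.psum {1..n} \<omega>"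
    unfolding U using C0 by (simp add: add_divide_distrib)
  then have "sqrt (real n) * (U_stat m h X n \<omega> - ?\<theta>) = remainder n \<omega> + sqrt (real n) * (real m / real n) * lin.psum {1..n} \<omega>"
    unfolding bin remainder_def by (simp add: distrib_left)
  moreover have w: "sqrt (real n) * (real m / real n) = real m / sqrt (real n)"
    using n0 by (simp add: field_simps)
  ultimately show ?thesis unfolding w by (simp only: add.commute)
qed

lemma remainder_square_integrable: "integrable M (\<lambda>\<omega>. (remainder n \<omega>)\<^sup>2)" "integrable M (remainder n)"
proof -
  have "integrable M (residual i)" for i
    unfolding residual_eq_alternating[abs_def] by (rule alternating_expectation(1)) (rule proj_shift_integrable(1))
  then show "integrable M (remainder n)" unfolding remainder_def by simp
  show "integrable M (\<lambda>\<omega>. (remainder n \<omega>)\<^sup>2)"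
    unfolding remainder_def power_mult_distrib power2_eq_square[of "\<Sum>i\<in>_. _ i"] sum_product
    by (intro integrable_mult_right Bochner_Integration.integrable_sum expectation_residual_product(1))
qed

text \<open>
  The bound on the degenerate sum is divided by the square of the binomial coefficient, which is at
  least \<open>(n / m) ^ m\<close>.
\<close>
lemma remainder_second_moment: "(\<lambda>n. expectation (\<lambda>\<omega>. (remainder n \<omega>)\<^sup>2)) \<longlonglongrightarrow> 0"
proof -
  from degenerate_second_moment obtain C where C: "C > 0" "\<forall>n. expectation (\<lambda>\<omega>. (\<Sum>i\<in>increasing_tuples n. residual i \<omega>)\<^sup>2) \<le>
     C * (\<Sum>l<n. weight l)\<^sup>2 * real n ^ (2 * m - 2)" by (elim exE conjE)
  show ?thesis
  proof (rule tendsto_sandwich[where f="\<lambda>_. 0" and h="\<lambda>n. C * real m ^ (2 * m) * ((\<Sum>l<n. weight l)\<^sup>2 / real n)"])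
    show "(\<lambda>n. C * real m ^ (2 * m) * ((\<Sum>l<n. weight l)\<^sup>2 / real n)) \<longlonglongrightarrow> 0"
      by (rule tendsto_mult_right_zero[OF weight_sum_small])
    show "eventually (\<lambda>n. expectation (\<lambda>\<omega>. (remainder n \<omega>)\<^sup>2) \<le> C * real m ^ (2 * m) * ((\<Sum>l<n. weight l)\<^sup>2 / real n)) sequentially"
      using eventually_ge_at_top[of m]
    proof eventually_elim
      case (elim n)
      have n0: "real n > 0" using elim m_ge_2 by simp
      let ?C = "real (n choose m)"
      have Cge: "(real n / real m) ^ m \<le> ?C" using binomial_ge_n_over_k_pow_k[OF elim] by blast
      have pos: "(real n / real m) ^ m > 0" using n0 m_ge_2 by simp
      have "expectation (\<lambda>\<omega>. (remainder n \<omega>)\<^sup>2) = real n / ?C\<^sup>2 * expectation (\<lambda>\<omega>. (\<Sum>i\<in>increasing_tuples n. residual i \<omega>)\<^sup>2)"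
        unfolding remainder_def power_mult_distrib power_divide by simp
      also have "\<dots> \<le> real n / ((real n / real m) ^ m)\<^sup>2 * (C * (\<Sum>l<n. weight l)\<^sup>2 * real n ^ (2 * m - 2))"
      proof (rule mult_mono)
        show "real n / ?C\<^sup>2 \<le> real n / ((real n / real m) ^ m)\<^sup>2"
        proof (rule divide_left_mono)
          show "((real n / real m) ^ m)\<^sup>2 \<le> ?C\<^sup>2" using pos Cge by (intro power_mono) auto
          have "?C > 0" using pos Cge by linarith
          then show "0 < ?C\<^sup>2 * ((real n / real m) ^ m)\<^sup>2" by (rule mult_pos_pos[OF zero_less_power zero_less_power[OF pos]])
        qed simp
        show "expectation (\<lambda>\<omega>. (\<Sum>i\<in>increasing_tuples n. residual i \<omega>)\<^sup>2) \<le> C * (\<Sum>l<n. weight l)\<^sup>2 * real n ^ (2 * m - 2)"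
          using C(2) by blast
      qed (auto intro: Bochner_Integration.integral_nonneg)
      also have "\<dots> = C * real m ^ (2 * m) * ((\<Sum>l<n. weight l)\<^sup>2 * (real n * real n ^ (2 * m - 2) / real n ^ (2 * m)))"
        using n0 m_ge_2 by (simp add: power_divide power_mult[symmetric] mult.commute[of m 2])
      also have "real n * real n ^ (2 * m - 2) / real n ^ (2 * m) = 1 / real n"
      proof -
        have "2 * m = Suc (Suc (2 * m - 2))" using m_ge_2 by simp
        then have "real n ^ (2 * m) = real n * (real n * real n ^ (2 * m - 2))" by (metis power_Suc)
        then show ?thesis using n0 by simp
      qed
      finally show ?case by simp
    qed
  qed (auto intro!: always_eventually Bochner_Integration.integral_nonneg)
qed

abbreviation scaled_deviation :: "nat \<Rightarrow> 'a \<Rightarrow> real" where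
  "scaled_deviation n \<omega> \<equiv> sqrt (real n) * (U_stat m h X n \<omega> - theta M m h Y)"

lemma scaled_deviation_measurable: "scaled_deviation n \<in> borel_measurable M"
proof -
  have "(\<lambda>\<omega>. h (\<lambda>j\<in>{1..m}. X (i j) \<omega>)) \<in> borel_measurable M" if "i \<in> {1..m} \<rightarrow>\<^sub>E {1..n}" for i
  proof -
    have 1: "(\<lambda>\<omega>. \<lambda>j\<in>{1..m}. X (i j) \<omega>) \<in> M \<rightarrow>\<^sub>M borel_vec m"
    proof (rule measurable_restrict)
      fix j assume "j \<in> {1..m}"
      then have "1 \<le> i j" using that by (auto dest: PiE_mem)
      then show "X (i j) \<in> borel_measurable M" by (rule X_measurable)
    qed
    have 2: "h \<in> borel_measurable (borel_vec m)" using symmetric by (simp add: symmetric_kernel_def)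
    show ?thesis by (rule measurable_compose[OF 1 2])
  qed
  then show ?thesis unfolding U_stat_def
    by (intro borel_measurable_times borel_measurable_diff borel_measurable_const borel_measurable_sum) auto
qed

text \<open>
  If the asymptotic variance is zero, the linear part also tends to zero in mean square.
\<close>
lemma degenerate_limit:
  assumes "asymp_var M m h X Y = 0"
  shows "tendsto_zero_in_prob M scaled_deviation"
  unfolding tendsto_zero_in_prob_def
proof (intro allI impI)
  fix e :: real assume e: "e > 0"
  let ?b = "\<lambda>n. (2 * (real m)\<^sup>2 * (lin.var_sum n / real n) + 2 * expectation (\<lambda>\<omega>. (remainder n \<omega>)\<^sup>2)) / e\<^sup>2"
  have s0: "lin.\<sigma>2 = 0" using assms asymp_var_eq by simp
  have "?b \<longlonglongrightarrow> (2 * (real m)\<^sup>2 * 0 + 2 * 0) / e\<^sup>2"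
    using lin.var_sum_asymptotics unfolding s0 by (intro tendsto_intros remainder_second_moment) (use e in auto)
  then have lim: "?b \<longlonglongrightarrow> 0" by simp
  show "(\<lambda>n. prob {\<omega> \<in> space M. \<bar>scaled_deviation n \<omega>\<bar> > e}) \<longlonglongrightarrow> 0"
  proof (rule tendsto_sandwich[where f="\<lambda>_. 0", OF _ _ tendsto_const lim])
    show "eventually (\<lambda>n. prob {\<omega> \<in> space M. \<bar>scaled_deviation n \<omega>\<bar> > e} \<le> ?b n) sequentially"
      using eventually_ge_at_top[of m]
    proof eventually_elim
      case (elim n)
      have n0: "real n > 0" using elim m_ge_2 by simp
      have I: "{1..n} \<subseteq> {1..}" by auto
      let ?q = "\<lambda>\<omega>. 2 * ((real m)\<^sup>2 / real n * (lin.psum {1..n} \<omega>)\<^sup>2) + 2 * (remainder n \<omega>)\<^sup>2"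
      have iq: "integrable M ?q" using lin.psum_integrable(2)[OF I] remainder_square_integrable(1) by simp
      have "prob {\<omega> \<in> space M. \<bar>scaled_deviation n \<omega>\<bar> > e} \<le> prob {\<omega> \<in> space M. ?q \<omega> \<ge> e\<^sup>2}"
      proof (rule finite_measure_mono)
        show "{\<omega> \<in> space M. ?q \<omega> \<ge> e\<^sup>2} \<in> events"
          using borel_measurable_integrable[OF iq] by measurable
        show "{\<omega> \<in> space M. \<bar>scaled_deviation n \<omega>\<bar> > e} \<subseteq> {\<omega> \<in> space M. ?q \<omega> \<ge> e\<^sup>2}"
        proof safe
          fix \<omega> assume "e < \<bar>scaled_deviation n \<omega>\<bar>"
          then have "e\<^sup>2 \<le> \<bar>scaled_deviation n \<omega>\<bar>\<^sup>2" using e by (intro power_mono) auto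
          also have "\<dots> = (real m / sqrt (real n) * lin.psum {1..n} \<omega> + remainder n \<omega>)\<^sup>2"
            unfolding hoeffding_decomposition[OF elim] by simp
          also have "\<dots> \<le> 2 * (real m / sqrt (real n) * lin.psum {1..n} \<omega>)\<^sup>2 + 2 * (remainder n \<omega>)\<^sup>2"
            by (rule sum_squares_bound[THEN order_trans[rotated]] | smt (verit) power2_sum power2_diff zero_le_power2)+
          also have "\<dots> = ?q \<omega>" using n0 by (simp add: power_mult_distrib power_divide)
          finally show "e\<^sup>2 \<le> ?q \<omega>" .
        qed
      qed
      also have "\<dots> \<le> expectation ?q / e\<^sup>2"
        using e by (intro integral_Markov_inequality_measure[OF iq, where A="{}"]) auto
      also have "expectation ?q = 2 * (real m)\<^sup>2 * (lin.var_sum n / real n) + 2 * expectation (\<lambda>\<omega>. (remainder n \<omega>)\<^sup>2)"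
        using lin.psum_integrable(2)[OF I] remainder_square_integrable(1) unfolding lin.var_sum_def by simp
      finally show ?case .
    qed
  qed simp
qed

text \<open>
  By continuity of characteristic functions; the remainder changes them by at most \<open>\<bar>t\<bar>\<close> times its mean
  absolute value.
\<close>
lemma nondegenerate_limit:
  assumes pos: "asymp_var M m h X Y > 0"
  shows "weak_conv_m (\<lambda>n. distr M borel (scaled_deviation n))
    (density lborel (normal_density 0 (sqrt ((real m)\<^sup>2 * asymp_var M m h X Y))))"
proof -
  let ?s = "sqrt ((real m)\<^sup>2 * asymp_var M m h X Y)"
  have s: "?s > 0" using pos m_ge_2 by simp
  have s2: "?s\<^sup>2 = (real m)\<^sup>2 * lin.\<sigma>2" using pos by (simp add: asymp_var_eq)
  show ?thesis
  proof (rule levy_continuity)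
    show "real_distribution (distr M borel (scaled_deviation n))" for n
      by (rule real_distribution_distr[OF scaled_deviation_measurable])
    show "real_distribution (density lborel (normal_density 0 ?s))"
      by (rule scaled_normal_distribution(1)[OF s])
    fix t :: real
    define a where "a n = expectation (\<lambda>\<omega>. iexp (t * real m / sqrt (real n) * lin.psum {1..n} \<omega>))" for n
    have la: "a \<longlonglongrightarrow> of_real (exp (- ((t * real m)\<^sup>2 * lin.\<sigma>2 / 2)))"
      unfolding a_def by (rule lin.clt_characteristic)
    have ch: "char (distr M borel (scaled_deviation n)) t = expectation (\<lambda>\<omega>. iexp (t * scaled_deviation n \<omega>))" for n
      unfolding char_def using scaled_deviation_measurable[of n] by (subst integral_distr) auto
    have "(\<lambda>n. char (distr M borel (scaled_deviation n)) t - a n) \<longlonglongrightarrow> 0"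
    proof (rule Lim_null_comparison)
      show "(\<lambda>n. \<bar>t\<bar> * sqrt (expectation (\<lambda>\<omega>. (remainder n \<omega>)\<^sup>2))) \<longlonglongrightarrow> 0"
        using tendsto_mult[OF tendsto_const tendsto_real_sqrt[OF remainder_second_moment], of "\<bar>t\<bar>"] by simp
      show "eventually (\<lambda>n. norm (char (distr M borel (scaled_deviation n)) t - a n) \<le> \<bar>t\<bar> * sqrt (expectation (\<lambda>\<omega>. (remainder n \<omega>)\<^sup>2))) sequentially"
        using eventually_ge_at_top[of m]
      proof eventually_elim
        case (elim n)
        have I: "{1..n} \<subseteq> {1..}" by auto
        have diff: "t * scaled_deviation n \<omega> - t * real m / sqrt (real n) * lin.psum {1..n} \<omega> = t * remainder n \<omega>" for \<omega>
          unfolding hoeffding_decomposition[OF elim] by (simp add: distrib_left)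
        have "norm (char (distr M borel (scaled_deviation n)) t - a n) \<le>
          expectation (\<lambda>\<omega>. \<bar>t * scaled_deviation n \<omega> - t * real m / sqrt (real n) * lin.psum {1..n} \<omega>\<bar>)"
          unfolding ch a_def
        proof (rule lin.iexp_difference)
          show "(\<lambda>\<omega>. t * scaled_deviation n \<omega>) \<in> borel_measurable M"
            by (intro borel_measurable_times borel_measurable_const scaled_deviation_measurable)
          show "(\<lambda>\<omega>. t * real m / sqrt (real n) * lin.psum {1..n} \<omega>) \<in> borel_measurable M"
            by (intro borel_measurable_times borel_measurable_const lin.psum_measurable I)
          show "integrable M (\<lambda>\<omega>. t * scaled_deviation n \<omega> - t * real m / sqrt (real n) * lin.psum {1..n} \<omega>)"
            unfolding diff using remainder_square_integrable(2) by simp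
        qed
        also have "\<dots> = \<bar>t\<bar> * expectation (\<lambda>\<omega>. \<bar>remainder n \<omega>\<bar>)"
          unfolding diff abs_mult by simp
        also have "\<dots> \<le> \<bar>t\<bar> * sqrt (expectation (\<lambda>\<omega>. (remainder n \<omega>)\<^sup>2))"
          by (intro mult_left_mono expectation_abs_le_sqrt remainder_square_integrable) simp
        finally show ?case .
      qed
    qed
    from tendsto_add[OF this la]
    have "(\<lambda>n. char (distr M borel (scaled_deviation n)) t) \<longlonglongrightarrow> of_real (exp (- ((t * real m)\<^sup>2 * lin.\<sigma>2 / 2)))" by simp
    moreover have "- (t * ?s)\<^sup>2 / 2 = - ((t * real m)\<^sup>2 * lin.\<sigma>2 / 2)"
      unfolding power_mult_distrib s2 by simp
    ultimately show "(\<lambda>n. char (distr M borel (scaled_deviation n)) t) \<longlonglongrightarrow> char (density lborel (normal_density 0 ?s)) t"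
      unfolding scaled_normal_distribution(2)[OF s] by (simp only:)
  qed
qed

end

theorem theorem2p3:
  fixes M :: "'a measure" and X Y :: "nat \<Rightarrow> 'a \<Rightarrow> real"
    and h :: "(nat \<Rightarrow> real) \<Rightarrow> real" and m :: nat and \<rho> \<delta> :: real
  assumes "prob_space M"
    and "m \<ge> 2"
    and "stationary M X"
    and "iid_copies M X Y"
    and "symmetric_kernel m h"
    and "bounded_kernel m h"
    and "extended_variation_condition M X Y m h"
    and "strongly_mixing M X"
    and "\<rho> > 0"
    and "integrable M (\<lambda>\<omega>. \<bar>X 1 \<omega>\<bar> powr \<rho>)"
    and "\<delta> > (2 * \<rho> + 1) / \<rho>"
    and "mixing_coeff M X \<in> O(\<lambda>l. real l powr (- \<delta>))"
  shows "summable (g1_cov M m h X Y)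
    \<and> asymp_var M m h X Y \<ge> 0
    \<and> converges_to_normal M (\<lambda>n \<omega>. sqrt (real n) * (U_stat m h X n \<omega> - theta M m h Y))
        ((real m)\<^sup>2 * asymp_var M m h X Y)"
proof -
  interpret prob_space M by fact
  interpret u_statistic_mixing M X Y h m \<rho> \<delta>
    by unfold_locales fact+
  have nn: "asymp_var M m h X Y \<ge> 0" unfolding asymp_var_eq by (rule lin.\<sigma>2_nonneg)
  have "converges_to_normal M scaled_deviation ((real m)\<^sup>2 * asymp_var M m h X Y)"
  proof (cases "asymp_var M m h X Y = 0")
    case True
    then show ?thesis unfolding converges_to_normal_def using degenerate_limit by simp
  next
    case False
    then have "asymp_var M m h X Y > 0" using nn by simp
    then show ?thesis unfolding converges_to_normal_def using nondegenerate_limit m_ge_2 by simp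
  qed
  then show ?thesis using g1_cov_summable nn by blast
qed

end
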